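(* (1) For $w\in Y^+$, the polynomial $\Sigma_w$ is proper (zero constant term) and homogeneous of degree $(w)$, for $\deg(y_i)=i$, and has rational positive coefficients. (2) The diagonal series $\mathcal{D}_Y=\sum_{w\in Y^*}w\otimes w$ satisfies $$\mathcal{D}_Y=\sum_{w\in Y^*}\Sigma_w\otimes\Pi_w=\prod_{l\in\mathcal{L}yn\,Y}^{\searrow}\exp(\Sigma_l\otimes\Pi_l),$$ the product being taken over Lyndon words in decreasing order. (3) The family $\mathcal{L}yn\,Y$ of Lyndon words forms a transcendence basis of the quasi-shuffle algebra $(\mathbf{k}\langle Y\rangle,\star,1_{Y^*})$, and the family of proper polynomials of rational positive coefficients defined, for any $w=l_1^{i_1}\cdots l_k^{i_k}$ with $l_1>\cdots>l_k$ and $l_1,\dots,l_k\in\mathcal{L}yn\,Y$, by $$\chi_w=\frac{1}{i_1!\cdots i_k!}\,l_1^{\star i_1}\star\cdots\star l_k^{\star i_k}$$ forms a basis of the quasi-shuffle algebra. (4) Let $\{\xi_w\}_{w\in Y^*}$ be the basis of the enveloping algebra $\mathcal{U}(\mathcal{L}ie_{\mathbb{Q}}\langle Y\rangle)$ obtained by duality with $\{\chi_w\}_{w\in Y^*}$, i.e. $\langle\chi_v\mid\xi_u\rangle=\delta_{u,v}$ for all $u,v\in Y^*$. Then the family $\{\xi_l\}_{l\in\mathcal{L}yn\,Y}$ forms a basis of the free Lie algebra $\mathcal{L}ie_{\mathbb{Q}}\langle Y\rangle$.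
   Context: Let $\mathbf{k}$ be a commutative unital $\mathbb{Q}$-algebra containing $q$. Let $Y=\{y_s\}_{s\ge1}$ be an alphabet totally ordered by $y_1>y_2>\cdots$; $Y^*$ is the set of words, ordered lexicographically (a proper prefix being smaller), $1_{Y^*}$ the empty word, $Y^+=Y^*\setminus\{1_{Y^*}\}$, $\mathbf{k}\langle Y\rangle$ the noncommutative polynomials. $\langle P\mid w\rangle$ is the coefficient of the word $w$ in $P$, extended to a bilinear pairing for which words are orthonormal. The weight of $w=y_{i_1}\cdots y_{i_r}$ is $(w)=i_1+\cdots+i_r$. $\mathcal{L}ie_{\mathbb{Q}}\langle Y\rangle$ is the free Lie algebra over $\mathbb{Q}$ on $Y$ and $\mathcal{U}(\mathcal{L}ie_{\mathbb{Q}}\langle Y\rangle)$ its enveloping algebra, identified with the noncommutative polynomials in $Y$ under concatenation. The $q$-stuffle product $\star$ is the bilinear product on $\mathbf{k}\langle Y\rangle$ with $u\star 1_{Y^*}=1_{Y^*}\star u=u$ and $y_su\star y_tv=y_s(u\star y_tv)+y_t(y_su\star v)+q\,y_{s+t}(u\star v)$; it is commutative, associative and unital. $P^{\star i}$ is the $i$-th $\star$-power. The algebra $(\mathbf{k}\langle Y\rangle,\star,1_{Y^*})$ is called the quasi-shuffle algebra. For $w\in Y^+$ set $\pi_1(w)=w+\sum_{k\ge2}\frac{(-1)^{k-1}}{k}\sum_{u_1,\dots,u_k\in Y^+}\langle w\mid u_1\star\cdots\star u_k\rangle\,u_1\cdots u_k$. A Lyndon word is a nonempty word strictly smaller than each of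 its proper nonempty right factors; $\mathcal{L}yn\,Y$ is the set of Lyndon words. The standard factorization of a Lyndon word $l$ of length $\ge 2$ is $(s,r)$ with $l=sr$ and $r$ the longest proper right factor of $l$ that is Lyndon (then $s$ is Lyndon). Every word factors uniquely as $w=l_1^{i_1}\cdots l_k^{i_k}$ with $l_1>\cdots>l_k$ Lyndon. Define $\Pi_{y_k}=\pi_1(y_k)$ for $k\ge1$; $\Pi_l=[\Pi_s,\Pi_r]$ (commutator) for $l$ Lyndon of length $\ge2$ with standard factorization $(s,r)$; $\Pi_w=\Pi_{l_1}^{i_1}\cdots\Pi_{l_k}^{i_k}$ for $w=l_1^{i_1}\cdots l_k^{i_k}$ with $l_1>\cdots>l_k$ Lyndon words ($\Pi_{1_{Y^*}}=1$). The family $\{\Pi_w\}_{w\in Y^*}$ is a weight-homogeneous basis of $\mathbf{k}\langle Y\rangle$, and $\{\Sigma_w\}_{w\in Y^*}$ is the family obtained by duality: $\langle\Sigma_v\mid\Pi_u\rangle=\delta_{u,v}$ for all $u,v\in Y^*$. In the identities for $\mathcal{D}_Y$, which hold in the completion, multiplication is $\star$ on the left tensor factor and concatenation on the right one.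
   Formalization: In (4) the free Lie algebra is taken over k and embedded via y_k ↦ π_1(y_k) (for q≠0 the literal claim fails: ξ_{y_2}=y_2−(q/2)y_1y_1); "rational positive coefficients" means values at q of polynomials with nonnegative rational coefficients. *)

theory Defs
  imports
    Complex_Main
    "HOL-Library.Poly_Mapping"
    "HOL-Library.List_Lexorder"
    "HOL-Computational_Algebra.Polynomial"
begin

section \<open>Commutative unital algebras over the rationals\<close>

class rat_comm_algebra_1 = comm_ring_1 +
  fixes scaleQ :: "rat \<Rightarrow> 'a \<Rightarrow> 'a"
  assumes scaleQ_add_right: "scaleQ r (x + y) = scaleQ r x + scaleQ r y"
    and scaleQ_add_left: "scaleQ (r + s) x = scaleQ r x + scaleQ s x"
    and scaleQ_scaleQ: "scaleQ r (scaleQ s x) = scaleQ (r * s) x"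
    and scaleQ_one: "scaleQ 1 x = x"
    and scaleQ_mult_left: "scaleQ r x * y = scaleQ r (x * y)"

instantiation rat :: rat_comm_algebra_1
begin
definition scaleQ_rat :: "rat \<Rightarrow> rat \<Rightarrow> rat" where "scaleQ_rat r x = r * x"
instance by standard (simp_all add: scaleQ_rat_def algebra_simps)
end

definition of_Q :: "rat \<Rightarrow> 'a::rat_comm_algebra_1" where
  "of_Q r = scaleQ r 1"

lemma of_Q_add: "of_Q (r + s) = of_Q r + of_Q s"
  by (simp add: of_Q_def scaleQ_add_left)

lemma of_Q_0 [simp]: "of_Q 0 = 0"
  using of_Q_add[of 0 0] by simp

lemma of_Q_1 [simp]: "of_Q 1 = 1"
  by (simp add: of_Q_def scaleQ_one)

lemma of_Q_mult: "of_Q (r * s) = of_Q r * of_Q s"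
  by (simp add: of_Q_def scaleQ_mult_left scaleQ_scaleQ)

section \<open>Letters and words\<close>

typedef letter = "{s::nat. 1 \<le> s}"
  morphisms index y
  by auto

text \<open>The alphabet is ordered by \<open>y 1 > y 2 > y 3 > \<dots>\<close>.\<close>

instantiation letter :: linorder
begin
definition less_eq_letter :: "letter \<Rightarrow> letter \<Rightarrow> bool" where
  "less_eq_letter a b \<longleftrightarrow> index b \<le> index a"
definition less_letter :: "letter \<Rightarrow> letter \<Rightarrow> bool" where
  "less_letter a b \<longleftrightarrow> index b < index a"
instance
  by standard (auto simp: less_eq_letter_def less_letter_def index_inject)
end

text \<open>
  Words are lists of letters, compared by the lexicographic order of
  \<^theory>\<open>HOL-Library.List_Lexorder\<close> (a proper prefix is smaller). Making lists an additive
  monoid under concatenation turns the convolution product of \<^theory>\<open>HOL-Library.Poly_Mapping\<close>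
  into the concatenation product of noncommutative polynomials.
\<close>

instantiation list :: (type) monoid_add
begin
definition zero_list :: "'a list" where "zero_list = []"
definition plus_list :: "'a list \<Rightarrow> 'a list \<Rightarrow> 'a list" where "plus_list u v = u @ v"
instance by standard (simp_all add: zero_list_def plus_list_def)
end

type_synonym word = "letter list"

definition weight :: "word \<Rightarrow> nat" where
  "weight w = sum_list (map index w)"

section \<open>Noncommutative polynomials\<close>

type_synonym 'k ncpoly = "word \<Rightarrow>\<^sub>0 'k"

abbreviation coeff_at :: "'k::zero ncpoly \<Rightarrow> word \<Rightarrow> 'k" where
  "coeff_at P w \<equiv> Poly_Mapping.lookup P w"

definition wd :: "word \<Rightarrow> 'k::comm_ring_1 ncpoly" where
  "wd w = Poly_Mapping.single w 1"

definition scl :: "'k::comm_ring_1 \<Rightarrow> 'k ncpoly \<Rightarrow> 'k ncpoly" where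
  "scl c P = Poly_Mapping.map ((*) c) P"

lemma lookup_scl: "coeff_at (scl c P) w = c * coeff_at P w"
  by (simp add: scl_def Poly_Mapping.map.rep_eq when_def)

interpretation ncp: module "scl :: 'k::comm_ring_1 \<Rightarrow> 'k ncpoly \<Rightarrow> 'k ncpoly"
  by standard (auto intro!: poly_mapping_eqI simp: lookup_scl lookup_add algebra_simps)

definition basis_family :: "('i \<Rightarrow> 'k::comm_ring_1 ncpoly) \<Rightarrow> 'i set \<Rightarrow> 'k ncpoly set \<Rightarrow> bool" where
  "basis_family b I M \<longleftrightarrow> inj_on b I \<and> ncp.independent (b ` I) \<and> ncp.span (b ` I) = M"

definition pairing :: "'k::comm_ring_1 ncpoly \<Rightarrow> 'k ncpoly \<Rightarrow> 'k" where
  "pairing P Q = (\<Sum>w\<in>Poly_Mapping.keys P. coeff_at P w * coeff_at Q w)"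

text \<open>
  The pairing is symmetric, so the same operator serves for a family written on either side of it.
\<close>

definition dual_family :: "(word \<Rightarrow> 'k::comm_ring_1 ncpoly) \<Rightarrow> word \<Rightarrow> 'k ncpoly" where
  "dual_family B = (THE S. \<forall>v u. pairing (S v) (B u) = (if u = v then 1 else 0))"

definition proper :: "'k::comm_ring_1 ncpoly \<Rightarrow> bool" where
  "proper P \<longleftrightarrow> coeff_at P [] = 0"

definition weight_homogeneous :: "nat \<Rightarrow> 'k::comm_ring_1 ncpoly \<Rightarrow> bool" where
  "weight_homogeneous n P \<longleftrightarrow> (\<forall>v\<in>Poly_Mapping.keys P. weight v = n)"

text \<open>
  Positivity of rational coefficients, for an arbitrary parameter \<open>q\<close> of the base algebra, means
  that each coefficient is the value at \<open>q\<close> of a polynomial with nonnegative rational coefficients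
  that does not depend on \<open>q\<close>. Hence the argument is the polynomial as a function of \<open>q\<close>.
  Since the base algebra contains the rationals, these polynomials are uniquely determined.
\<close>

definition rational_positive :: "('k::rat_comm_algebra_1 \<Rightarrow> 'k ncpoly) \<Rightarrow> bool" where
  "rational_positive F \<longleftrightarrow>
     (\<forall>v. \<exists>p :: rat poly. (\<forall>i. 0 \<le> poly.coeff p i) \<and>
        (\<forall>q. coeff_at (F q) v = poly (map_poly of_Q p) q))"

lemma rational_positive_at_rational:
  fixes F :: "'k::rat_comm_algebra_1 \<Rightarrow> 'k ncpoly"
  assumes "rational_positive F" and "0 \<le> r"
  shows "\<exists>c\<ge>0. coeff_at (F (of_Q r)) v = of_Q c"
proof -
  obtain p :: "rat poly" where p: "\<forall>i. 0 \<le> poly.coeff p i"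
    and F: "coeff_at (F (of_Q r)) v = poly (map_poly of_Q p) (of_Q r)"
    using assms(1) unfolding rational_positive_def by blast
  have "poly (map_poly of_Q p) (of_Q r :: 'k) = of_Q (poly p r)"
    by (induction p) (simp_all add: map_poly_pCons of_Q_add of_Q_mult)
  moreover have "0 \<le> poly p r"
    using p \<open>0 \<le> r\<close> by (simp add: poly_altdef sum_nonneg)
  ultimately show ?thesis using F by auto
qed

section \<open>The q-stuffle product\<close>

fun stuffle_words :: "'k::comm_ring_1 \<Rightarrow> word \<Rightarrow> word \<Rightarrow> 'k ncpoly" where
  "stuffle_words q u [] = wd u"
| "stuffle_words q [] v = wd v"
| "stuffle_words q (a # u) (b # v) =
     wd [a] * stuffle_words q u (b # v)
   + wd [b] * stuffle_words q (a # u) v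
   + scl q (wd [y (index a + index b)] * stuffle_words q u v)"

definition stuffle :: "'k::comm_ring_1 \<Rightarrow> 'k ncpoly \<Rightarrow> 'k ncpoly \<Rightarrow> 'k ncpoly" where
  "stuffle q P Q = (\<Sum>u\<in>Poly_Mapping.keys P. \<Sum>v\<in>Poly_Mapping.keys Q.
     scl (coeff_at P u * coeff_at Q v) (stuffle_words q u v))"

definition stuffle_list :: "'k::comm_ring_1 \<Rightarrow> 'k ncpoly list \<Rightarrow> 'k ncpoly" where
  "stuffle_list q Ps = foldr (stuffle q) Ps (wd [])"

definition stuffle_pow :: "'k::comm_ring_1 \<Rightarrow> 'k ncpoly \<Rightarrow> nat \<Rightarrow> 'k ncpoly" where
  "stuffle_pow q P i = stuffle_list q (replicate i P)"

text \<open>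
  Both sums below have finite support: a nonzero coefficient forces the weights of \<open>us\<close>, which are
  positive, to add up to the weight of \<open>w\<close>.
\<close>

definition pi1 :: "'k::rat_comm_algebra_1 \<Rightarrow> word \<Rightarrow> 'k ncpoly" where
  "pi1 q w = wd w + Sum_any (\<lambda>k::nat.
     scl (of_Q ((- 1) ^ (k - 1) / of_nat k))
       (Sum_any (\<lambda>us. scl (coeff_at (stuffle_list q (map wd us)) w) (wd (concat us))
          when length us = k \<and> [] \<notin> set us))
     when 2 \<le> k)"

section \<open>Lyndon words and the family \<open>\<Pi>\<close>\<close>

definition lyndon :: "word \<Rightarrow> bool" where
  "lyndon l \<longleftrightarrow> l \<noteq> [] \<and> (\<forall>k. 0 < k \<and> k < length l \<longrightarrow> l < drop k l)"

definition Lyn :: "word set" where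
  "Lyn = {l. lyndon l}"

text \<open>The standard factorization of \<open>l\<close> is \<open>(take k l, drop k l)\<close> for \<open>k = std_split l\<close>.\<close>

definition std_split :: "word \<Rightarrow> nat" where
  "std_split l = (LEAST k. 0 < k \<and> lyndon (drop k l))"

lemma std_split_bounds:
  assumes "2 \<le> length l"
  shows "0 < std_split l" "std_split l < length l"
proof -
  have "length (drop (length l - 1) l) = 1" using assms by simp
  then have "lyndon (drop (length l - 1) l)"
    unfolding lyndon_def by (metis One_nat_def less_one list.size(3) not_gr_zero zero_neq_one)
  then have *: "0 < length l - 1 \<and> lyndon (drop (length l - 1) l)"
    using assms by simp
  show "0 < std_split l"
    unfolding std_split_def using LeastI[of "\<lambda>k. 0 < k \<and> lyndon (drop k l)", OF *] by simp
  have "std_split l \<le> length l - 1"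
    unfolding std_split_def by (rule Least_le) (rule *)
  then show "std_split l < length l" using assms by simp
qed

text \<open>Only the values at Lyndon words matter.\<close>

function Pi_lyndon :: "'k::rat_comm_algebra_1 \<Rightarrow> word \<Rightarrow> 'k ncpoly" where
  "Pi_lyndon q l =
     (if length l < 2 then pi1 q l
      else Pi_lyndon q (take (std_split l) l) * Pi_lyndon q (drop (std_split l) l)
         - Pi_lyndon q (drop (std_split l) l) * Pi_lyndon q (take (std_split l) l))"
  by auto
termination
  by (relation "Wellfounded.measure (\<lambda>(q, l). length l)")
    (auto simp: not_less min_def std_split_bounds intro!: diff_less dest: std_split_bounds)

declare Pi_lyndon.simps [simp del]

text \<open>The list of pairs \<open>(l\<^sub>1, i\<^sub>1), \<dots>, (l\<^sub>k, i\<^sub>k)\<close> with \<open>l\<^sub>1 > \<dots> > l\<^sub>k\<close>.\<close>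

definition lyndon_factorization :: "word \<Rightarrow> (word \<times> nat) list" where
  "lyndon_factorization w = (THE fs.
     sorted_wrt (>) (map fst fs) \<and> (\<forall>(l, i)\<in>set fs. lyndon l \<and> 1 \<le> i) \<and>
     concat (map (\<lambda>(l, i). concat (replicate i l)) fs) = w)"

definition Pi_word :: "'k::rat_comm_algebra_1 \<Rightarrow> word \<Rightarrow> 'k ncpoly" where
  "Pi_word q w = prod_list (map (\<lambda>(l, i). Pi_lyndon q l ^ i) (lyndon_factorization w))"

definition Sigma_word :: "'k::rat_comm_algebra_1 \<Rightarrow> word \<Rightarrow> 'k ncpoly" where
  "Sigma_word q = dual_family (Pi_word q)"

definition chi :: "'k::rat_comm_algebra_1 \<Rightarrow> word \<Rightarrow> 'k ncpoly" where
  "chi q w = scl (of_Q (1 / (\<Prod>(l, i)\<leftarrow>lyndon_factorization w. fact i)))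
     (stuffle_list q (map (\<lambda>(l, i). stuffle_pow q (wd l) i) (lyndon_factorization w)))"

definition xi :: "'k::rat_comm_algebra_1 \<Rightarrow> word \<Rightarrow> 'k ncpoly" where
  "xi q = dual_family (chi q)"

section \<open>Double series\<close>

text \<open>
  The completed tensor square consists of all functions assigning a coefficient to every pair of
  words, with the topology of coefficientwise convergence in the discrete base ring.
\<close>

type_synonym 'k double_series = "word \<Rightarrow> word \<Rightarrow> 'k"

definition tensor :: "'k::comm_ring_1 ncpoly \<Rightarrow> 'k ncpoly \<Rightarrow> 'k double_series" where
  "tensor P Q = (\<lambda>u v. coeff_at P u * coeff_at Q v)"

definition double_sums :: "('i \<Rightarrow> 'k::comm_ring_1 double_series) \<Rightarrow> 'k double_series \<Rightarrow> bool" where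
  "double_sums f S \<longleftrightarrow>
     (\<forall>u v. finite {i. f i u v \<noteq> 0} \<and> (\<Sum>i | f i u v \<noteq> 0. f i u v) = S u v)"

definition diagonal :: "'k::comm_ring_1 double_series" where
  "diagonal = (\<lambda>u v. if u = v then 1 else 0)"

definition dbl_one :: "'k::comm_ring_1 double_series" where
  "dbl_one = (\<lambda>u v. if u = [] \<and> v = [] then 1 else 0)"

text \<open>
  Stuffle product on the left factor, concatenation on the right one. The outer sum has finite
  support since \<open>u\<close> occurs in the product of \<open>u1\<close> and \<open>u2\<close> only if their weights add up to that
  of \<open>u\<close>.
\<close>

definition dbl_mult ::
    "'k::comm_ring_1 \<Rightarrow> 'k double_series \<Rightarrow> 'k double_series \<Rightarrow> 'k double_series" where
  "dbl_mult q F G = (\<lambda>u v. Sum_any (\<lambda>(u1, u2).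
     \<Sum>k\<le>length v. F u1 (take k v) * G u2 (drop k v) * coeff_at (stuffle_words q u1 u2) u))"

primrec dbl_pow :: "'k::comm_ring_1 \<Rightarrow> 'k double_series \<Rightarrow> nat \<Rightarrow> 'k double_series" where
  "dbl_pow q F 0 = dbl_one"
| "dbl_pow q F (Suc n) = dbl_mult q F (dbl_pow q F n)"

text \<open>
  Meant for series \<open>F\<close> whose right factors have no constant term; then only finitely many powers
  contribute to a given coefficient.
\<close>

definition dbl_exp :: "'k::rat_comm_algebra_1 \<Rightarrow> 'k double_series \<Rightarrow> 'k double_series" where
  "dbl_exp q F = (\<lambda>u v. Sum_any (\<lambda>n::nat. scaleQ (1 / fact n) (dbl_pow q F n u v)))"

definition decreasing_prod ::
    "'k::comm_ring_1 \<Rightarrow> (word \<Rightarrow> 'k double_series) \<Rightarrow> word set \<Rightarrow> 'k double_series" where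
  "decreasing_prod q f A = foldr (\<lambda>l. dbl_mult q (f l)) (rev (sorted_list_of_set A)) dbl_one"

text \<open>
  The set of Lyndon words is infinite and not well-ordered in either direction, so the ordered
  product is the limit of the decreasing products over its finite subsets.
\<close>

definition has_decreasing_prod ::
    "'k::comm_ring_1 \<Rightarrow> (word \<Rightarrow> 'k double_series) \<Rightarrow> word set \<Rightarrow> 'k double_series \<Rightarrow> bool" where
  "has_decreasing_prod q f I S \<longleftrightarrow>
     (\<forall>u v. eventually (\<lambda>A. decreasing_prod q f A u v = S u v) (finite_subsets_at_top I))"

section \<open>Transcendence bases of the quasi-shuffle algebra\<close>

text \<open>
  Commutative polynomials in indeterminates indexed by words are finitely supported functions on
  monomials, and monomials are finitely supported exponent functions.
\<close>

type_synonym 'k cpoly = "(word \<Rightarrow>\<^sub>0 nat) \<Rightarrow>\<^sub>0 'k"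

definition cpolys_in :: "word set \<Rightarrow> 'k::comm_ring_1 cpoly set" where
  "cpolys_in I = {p. \<forall>m\<in>Poly_Mapping.keys p. Poly_Mapping.keys m \<subseteq> I}"

definition stuffle_eval :: "'k::comm_ring_1 \<Rightarrow> (word \<Rightarrow> 'k ncpoly) \<Rightarrow> 'k cpoly \<Rightarrow> 'k ncpoly" where
  "stuffle_eval q x p = (\<Sum>m\<in>Poly_Mapping.keys p. scl (Poly_Mapping.lookup p m)
     (stuffle_list q (map (\<lambda>l. stuffle_pow q (x l) (Poly_Mapping.lookup m l))
        (sorted_list_of_set (Poly_Mapping.keys m)))))"

text \<open>
  In the sense customary for shuffle algebras: the family is algebraically independent and every
  element is a polynomial in it (in particular, algebraic over it).
\<close>

definition stuffle_transcendence_basis ::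
    "'k::comm_ring_1 \<Rightarrow> (word \<Rightarrow> 'k ncpoly) \<Rightarrow> word set \<Rightarrow> bool" where
  "stuffle_transcendence_basis q x I \<longleftrightarrow>
     (\<forall>p\<in>cpolys_in I. stuffle_eval q x p = 0 \<longrightarrow> p = 0) \<and>
     (\<forall>P. \<exists>p\<in>cpolys_in I. P = stuffle_eval q x p)"

section \<open>The free Lie algebra\<close>

inductive_set lie_generated :: "'k::comm_ring_1 ncpoly set \<Rightarrow> 'k ncpoly set"
  for B :: "'k ncpoly set" where
  gen: "P \<in> B \<Longrightarrow> P \<in> lie_generated B"
| zero: "0 \<in> lie_generated B"
| add: "P \<in> lie_generated B \<Longrightarrow> Q \<in> lie_generated B \<Longrightarrow> P + Q \<in> lie_generated B"
| scale: "P \<in> lie_generated B \<Longrightarrow> scl c P \<in> lie_generated B"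
| bracket: "P \<in> lie_generated B \<Longrightarrow> Q \<in> lie_generated B \<Longrightarrow> P * Q - Q * P \<in> lie_generated B"

definition free_lie :: "'k::comm_ring_1 ncpoly set" where
  "free_lie = lie_generated (range (\<lambda>a. wd [a]))"

text \<open>
  The endomorphism of the concatenation algebra sending each letter \<open>a\<close> to \<open>pi1 q [a]\<close>. It
  identifies the enveloping algebra of the free Lie algebra on the letters (with its usual
  coproduct, for which letters are primitive) with the concatenation algebra carrying the coproduct
  dual to the \<open>q\<close>-stuffle product. For \<open>q \<noteq> 0\<close> the letters themselves are not primitive for the
  latter; their images \<open>pi1 q [a]\<close> are. For \<open>q = 0\<close> this is the identity.
\<close>

definition lie_identification :: "'k::rat_comm_algebra_1 \<Rightarrow> 'k ncpoly \<Rightarrow> 'k ncpoly" where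
  "lie_identification q P = (\<Sum>w\<in>Poly_Mapping.keys P.
     scl (coeff_at P w) (prod_list (map (\<lambda>a. pi1 q [a]) w)))"

end

theory Submission
  imports Defs "HOL-Library.Multiset" "HOL-Computational_Algebra.Formal_Power_Series"
begin

text \<open>
  The elements \<open>\<pi>\<^sub>1(y\<^sub>k)\<close> are primitive for the coproduct dual to the q-stuffle product: the
  coefficients of the logarithm are the derivatives at \<open>x = 0\<close> of the binomial polynomials
  \<open>x gchoose n\<close>, and for every \<open>x\<close> these define a character of the quasi-shuffle algebra. Hence all
  \<open>\<Pi>\<^sub>l\<close> are primitive. Pairing with products of primitive elements shows that, up to factorials of
  multiplicities, \<open>\<Sigma>\<^sub>u \<star> \<Sigma>\<^sub>v\<close> is the \<open>\<Sigma>\<close> indexed by the union of the multisets of Lyndon factors of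
  \<open>u\<close> and \<open>v\<close>, so the quasi-shuffle algebra is the algebra of a free commutative monoid. The product
  formula follows, and primitivity means orthogonality to all \<open>\<Sigma>\<^sub>w\<close> with \<open>w\<close> not Lyndon. Since \<open>l\<close>
  is \<open>\<Sigma>\<^sub>l\<close> plus smaller terms, \<open>\<chi>\<close> is unitriangular over \<open>\<Sigma>\<close>, and the same orthogonality with \<open>\<chi>\<close>
  describes the primitive elements.

  Positivity comes from two facts: for a Lyndon word \<open>a u\<close>, pairing \<open>\<Sigma>\<^bsub>au\<^esub>\<close> with \<open>\<pi>\<^sub>1(b) X\<close> gives the
  pairing of \<open>\<Sigma>\<^sub>u\<close> with \<open>X\<close> if \<open>a = b\<close> and \<open>0\<close> otherwise; and each letter is a combination of products
  of the \<open>\<pi>\<^sub>1(y\<^sub>k)\<close> with coefficients \<open>q\<^bsup>j-1\<^esup> / j!\<close>.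
\<close>

section \<open>Lyndon words\<close>

text \<open>The base ring is an arbitrary commutative Q-algebra, possibly with zero divisors and
  with \<open>q\<close> not invertible, so neither dimension counts nor a rescaling of the letters
  by \<open>q\<close> can be relied on. All bases therefore come from matrices that are
  unitriangular within a weight, where only finitely many words occur; the only denominators are
  integers. Equal weight also prevents one word from being a proper prefix of another, and this
  makes leading words multiply. Binomials enter because the monomial quasi-symmetric function of a
  word of length n takes the value \<open>m choose n\<close> at m variables equal to 1. This is a
  character for every natural m (with q = 1), hence for an indeterminate x, and the derivative at x
  = 0, where the character is the counit, vanishes on products of nonempty words. The obstacle to
  positivity is that the \<open>\<pi>\<^sub>1(y\<^sub>k)\<close> have coefficients of both signs.
  Positivity is visible for pairings with products of the \<open>\<pi>\<^sub>1(y\<^sub>k)\<close>,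
  which are primitive, and the passage from there to words is an exponential, whose coefficients are
  nonnegative.\<close>

definition strictly_less :: "'a::linorder list \<Rightarrow> 'a list \<Rightarrow> bool" where
  "strictly_less u v \<longleftrightarrow> (\<exists>p a b x z. u = p @ a # x \<and> v = p @ b # z \<and> a < b)"

lemma strictly_less_Cons: "strictly_less u v \<Longrightarrow> strictly_less (a # u) (a # v)"
  unfolding strictly_less_def by (metis append_Cons)

lemma strictly_less_append: "strictly_less u v \<Longrightarrow> strictly_less (u @ x) (v @ z)"
  unfolding strictly_less_def by fastforce

lemma less_append_left: "(x @ u < x @ v) = (u < (v :: 'a::linorder list))"
  by (induction x) auto

lemma le_append_left: "(x @ u \<le> x @ v) = (u \<le> (v :: 'a::linorder list))"
  by (induction x) auto

lemma strictly_less_imp_less: "strictly_less u v \<Longrightarrow> u < v"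
  unfolding strictly_less_def by (auto simp: less_append_left)

lemma prefix_le: "u \<le> u @ (x :: 'a::linorder list)"
  by (induction u) auto

text \<open>Only a comparison decided at a first differing letter survives appending arbitrary tails
  on both sides; a comparison by proper prefix does not. The order arguments below separate these
  two cases.\<close>

lemma less_list_cases:
  assumes "u < (v :: 'a::linorder list)"
  obtains x where "x \<noteq> []" "v = u @ x" | "strictly_less u v"
  using assms
proof (induction u arbitrary: v thesis)
  case Nil
  then show ?case by (metis append_Nil not_less_Nil)
next
  case (Cons a u)
  obtain b z where v: "v = b # z" using Cons.prems(3) by (cases v) auto
  show ?case
  proof (cases "a < b")
    case True
    then have "strictly_less (a # u) v" unfolding strictly_less_def v by (metis append_Nil)
    then show ?thesis using Cons.prems(2) by blast
  next
    case False
    then have "a = b" "u < z" using Cons.prems(3) v by auto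
    then show ?thesis
      using Cons.IH[of z thesis] Cons.prems(1,2) strictly_less_Cons[of u z a] unfolding v by auto
  qed
qed

lemma less_append_of_not_prefix:
  assumes "u < (v :: 'a::linorder list)" "\<And>z. v \<noteq> u @ z"
  shows "u @ x < v @ z"
  using assms by (metis less_list_cases strictly_less_append strictly_less_imp_less)

lemma less_append_of_length:
  assumes "u < (v :: 'a::linorder list)" "length v \<le> length u"
  shows "u @ x < v @ z"
proof -
  have "strictly_less u v" using assms by (metis less_list_cases length_append length_greater_0_conv
        add_le_same_cancel1 le_zero_eq length_0_conv)
  then show ?thesis by (metis strictly_less_append strictly_less_imp_less)
qed

lemma lyndon_not_Nil: "lyndon l \<Longrightarrow> l \<noteq> []"
  by (simp add: lyndon_def)

lemma lyndon_suffix: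
  assumes "lyndon (u @ v)" "u \<noteq> []" "v \<noteq> []"
  shows "u @ v < v"
proof -
  have "0 < length u \<and> length u < length (u @ v)" using assms by auto
  then have "u @ v < drop (length u) (u @ v)" using assms unfolding lyndon_def by blast
  then show ?thesis by simp
qed

lemma lyndonI:
  assumes "l \<noteq> []" "\<And>u v. l = u @ v \<Longrightarrow> u \<noteq> [] \<Longrightarrow> v \<noteq> [] \<Longrightarrow> l < v"
  shows "lyndon l"
  unfolding lyndon_def using assms
  by (metis append_take_drop_id drop_eq_Nil not_less take_eq_Nil2 less_numeral_extra(3))

lemma lyndon_letter: "lyndon [a]"
  by (rule lyndonI) (auto simp: Cons_eq_append_conv)

text \<open>Everything rests on \<open>u @ v < v\<close>. If \<open>v = u @ x\<close>, then
  \<open>v < x\<close> since \<open>v\<close> is Lyndon, and prefixing \<open>u\<close> gives the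
  claim; otherwise a first difference decides. A proper right factor of \<open>u @ v\<close> is a
  tail of \<open>u\<close> followed by \<open>v\<close>, or \<open>v\<close> itself, or a tail of
  \<open>v\<close>.\<close>

lemma lyndon_append:
  assumes u: "lyndon u" and v: "lyndon v" and "u < v"
  shows "lyndon (u @ v)"
proof (rule lyndonI)
  show "u @ v \<noteq> []" using u lyndon_not_Nil by auto
  have uvv: "u @ v < v"
  proof (cases rule: less_list_cases[OF \<open>u < v\<close>])
    case (1 x)
    then have "v < x" using lyndon_suffix[of u x] v lyndon_not_Nil[OF u] by auto
    then show ?thesis using 1 by (simp add: less_append_left)
  next
    case 2
    then show ?thesis using strictly_less_append[of u v v "[]"] by (simp add: strictly_less_imp_less)
  qed
  fix x z assume e: "u @ v = x @ z" and ne: "x \<noteq> []" "z \<noteq> []"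
  from e consider t where "u = x @ t" "t \<noteq> []" "z = t @ v" | "x = u" "z = v"
    | t where "t \<noteq> []" "x = u @ t" "v = t @ z"
    by (auto simp: append_eq_append_conv2)
  then show "u @ v < z"
  proof cases
    case 1
    then have "u < t" using lyndon_suffix[of x t] u ne by auto
    then show ?thesis using less_append_of_length[of u t v v] 1 by simp
  next
    case 2 then show ?thesis using uvv by simp
  next
    case 3
    then have "v < z" using lyndon_suffix[of t z] v ne by auto
    then show ?thesis using uvv by order
  qed
qed

text \<open>Stated for a right factor \<open>x\<close> of a Lyndon word so that the induction can
  cancel a factor \<open>m\<close> that is a prefix of \<open>x\<close>: what remains is again a
  right factor of the same Lyndon word, hence still above all later factors.\<close>

lemma concat_less_suffix_lyndon:
  assumes "lyndon (s @ x)" "x \<noteq> []" "\<And>m. m \<in> set ms \<Longrightarrow> m < s @ x"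
  shows "concat ms < x"
  using assms
proof (induction ms arbitrary: s x)
  case Nil
  then show ?case by (cases x) auto
next
  case (Cons m ms)
  have "s @ x \<le> x"
    using lyndon_suffix[of s x] Cons.prems by (cases "s = []") auto
  then have mx: "m < x" using Cons.prems(3)[of m] by auto
  show ?case
  proof (cases rule: less_list_cases[OF mx])
    case (1 x')
    have "concat ms < x'"
      using Cons.IH[of "s @ m" x'] Cons.prems 1 by auto
    then show ?thesis using 1 by (simp add: less_append_left)
  next
    case 2
    then show ?thesis
      using strictly_less_append[of m x "concat ms" "[]"] by (simp add: strictly_less_imp_less)
  qed
qed

lemma concat_less_lyndon:
  assumes "lyndon l" "\<And>m. m \<in> set ms \<Longrightarrow> m < l"
  shows "concat ms < l"
  using concat_less_suffix_lyndon[of "[]" l ms] assms lyndon_not_Nil by auto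

section \<open>Factorization into a weakly decreasing list of Lyndon words\<close>

definition declyn :: "word list \<Rightarrow> bool" where
  "declyn ls \<longleftrightarrow> sorted_wrt (\<ge>) ls \<and> (\<forall>l\<in>set ls. lyndon l)"

lemma declyn_Nil [simp]: "declyn []"
  by (simp add: declyn_def)

lemma declyn_Cons: "declyn (l # ls) \<longleftrightarrow> lyndon l \<and> (\<forall>m\<in>set ls. m \<le> l) \<and> declyn ls"
  by (auto simp: declyn_def)

lemma declyn_unique:
  assumes "declyn ls" "declyn ms" "concat ls = concat ms"
  shows "ls = ms"
  using assms
proof (induction ls arbitrary: ms)
  case Nil
  then show ?case by (cases ms) (auto simp: declyn_Cons lyndon_not_Nil)
next
  case (Cons l ls)
  obtain m ms' where ms: "ms = m # ms'"
    using Cons.prems by (cases ms) (auto simp: declyn_Cons lyndon_not_Nil)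
  \<comment> \<open>If the first factors differ, the word built from the smaller one lies below the
    larger first factor, which is a prefix of the other word.\<close>
  have *: False if "declyn (a # as)" "declyn (b # bs)" "concat (a # as) = concat (b # bs)" "a < b"
    for a b as bs
  proof -
    have "concat (a # as) < b"
      using that by (intro concat_less_lyndon) (auto simp: declyn_Cons dest: le_less_trans)
    also have "b \<le> concat (b # bs)" by (simp add: prefix_le)
    finally show False using that(3) by auto
  qed
  have "l = m" using *[of l ls m ms'] *[of m ms' l ls] Cons.prems ms by (metis neqE)
  then show ?case using Cons.IH[of ms'] Cons.prems ms by (auto simp: declyn_Cons)
qed

text \<open>Factorizations are built from right to left, one letter at a time: a new Lyndon word in
  front swallows the following factors as long as it is smaller than they are, and
  \<open>lyndon_append\<close> keeps it Lyndon.\<close>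

fun absorb :: "word \<Rightarrow> word list \<Rightarrow> word list" where
  "absorb m [] = [m]"
| "absorb m (l # ls) = (if m < l then absorb (m @ l) ls else m # l # ls)"

lemma absorb: "lyndon m \<Longrightarrow> declyn ls \<Longrightarrow> declyn (absorb m ls) \<and> concat (absorb m ls) = m @ concat ls"
proof (induction m ls rule: absorb.induct)
  case (2 m l ls)
  then show ?case by (fastforce simp: declyn_Cons lyndon_append)
qed (auto simp: declyn_Cons)

lemma declyn_exists: "\<exists>ls. declyn ls \<and> concat ls = w"
proof (induction w)
  case Nil
  then show ?case by (intro exI[of _ "[]"]) simp
next
  case (Cons a w)
  then obtain ls where "declyn ls" "concat ls = w" by blast
  then show ?case using absorb[OF lyndon_letter, of ls a] by auto
qed

definition fac :: "word \<Rightarrow> word list" where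
  "fac w = (THE ls. declyn ls \<and> concat ls = w)"

lemma declyn_fac [simp]: "declyn (fac w)" and concat_fac [simp]: "concat (fac w) = w"
proof -
  have "\<exists>!ls. declyn ls \<and> concat ls = w" using declyn_exists declyn_unique by blast
  from theI'[OF this] show "declyn (fac w)" "concat (fac w) = w" unfolding fac_def by auto
qed

lemma fac_eqI: "declyn ls \<Longrightarrow> concat ls = w \<Longrightarrow> fac w = ls"
  using declyn_unique[of "fac w" ls] by simp

lemma fac_concat: "declyn ls \<Longrightarrow> fac (concat ls) = ls"
  by (rule fac_eqI) auto

lemma fac_Nil [simp]: "fac [] = []"
  by (rule fac_eqI) auto

lemma fac_eq_Nil [simp]: "fac w = [] \<longleftrightarrow> w = []"
  by (metis concat.simps(1) concat_fac fac_Nil)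

lemma fac_lyndon: "lyndon l \<Longrightarrow> fac l = [l]"
  by (rule fac_eqI) (auto simp: declyn_Cons)

lemma lyndon_of_mem_fac: "l \<in> set (fac w) \<Longrightarrow> lyndon l"
  using declyn_fac[of w] by (simp add: declyn_def)

lemma lyndon_iff_length_fac: "lyndon w \<longleftrightarrow> length (fac w) = 1"
proof
  assume "length (fac w) = 1"
  then obtain l where "fac w = [l]" by (metis One_nat_def length_0_conv length_Suc_conv)
  then show "lyndon w" using concat_fac[of w] declyn_fac[of w] by (auto simp: declyn_Cons)
qed (simp add: fac_lyndon)

text \<open>The longest proper Lyndon right factor is also the least of all proper right factors:
  the least one, \<open>t\<close>, is Lyndon by minimality, and a longer Lyndon right factor would
  end in \<open>t\<close> and so be smaller than \<open>t\<close>. Minimality is the form in which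
  the standard factorization is used later.\<close>

lemma
  assumes l: "lyndon l" and len: "2 \<le> length l"
  defines "s \<equiv> take (std_split l) l" and "r \<equiv> drop (std_split l) l"
  shows lyndon_std_left: "lyndon s" and lyndon_std_right: "lyndon r" and std_less: "s < r"
    and std_right_minimal: "\<And>x z. l = x @ z \<Longrightarrow> x \<noteq> [] \<Longrightarrow> z \<noteq> [] \<Longrightarrow> r \<le> z"
proof -
  let ?S = "{z. z \<noteq> [] \<and> (\<exists>x. x \<noteq> [] \<and> l = x @ z)}"
  have fin: "finite ?S"
  proof (rule finite_subset)
    show "?S \<subseteq> (\<lambda>k. drop k l) ` {..length l}"
    proof
      fix z assume "z \<in> ?S"
      then obtain x where "l = x @ z" by auto
      then show "z \<in> (\<lambda>k. drop k l) ` {..length l}" by (intro image_eqI[of _ _ "length x"]) auto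
    qed
  qed simp
  obtain a l' where "l = a # l'" "l' \<noteq> []" using len by (cases l) (auto simp: Suc_le_eq)
  then have ne: "l' \<in> ?S" by (auto intro!: exI[of _ "[a]"])
  define t where "t = Min ?S"
  have tS: "t \<in> ?S" and tmin: "\<And>z. z \<in> ?S \<Longrightarrow> t \<le> z"
    unfolding t_def using Min_in[OF fin] Min_le[OF fin] ne by blast+
  then obtain x0 where x0: "l = x0 @ t" "x0 \<noteq> []" "t \<noteq> []" by auto
  have t_lyn: "lyndon t"
  proof (rule lyndonI)
    show "t \<noteq> []" using x0 by simp
    fix u v assume "t = u @ v" "u \<noteq> []" "v \<noteq> []"
    then have "v \<in> ?S" using x0 by (auto intro: exI[of _ "x0 @ u"])
    moreover have "t \<noteq> v" using \<open>t = u @ v\<close> \<open>u \<noteq> []\<close> by auto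
    ultimately show "t < v" using tmin by force
  qed
  have long: "length z \<le> length t" if "l = x @ z" "x \<noteq> []" "lyndon z" for x z
  proof (rule ccontr)
    assume "\<not> ?thesis"
    then have "\<exists>u. u \<noteq> [] \<and> z = u @ t" using that x0
      by (metis append_eq_append_conv2 length_append linorder_not_le not_add_less2 self_append_conv2
          less_irrefl append_Nil le_add2)
    then have "z < t" using lyndon_suffix that x0 by blast
    moreover have "t \<le> z" using tmin[of z] that lyndon_not_Nil by blast
    ultimately show False by simp
  qed
  have "std_split l = length x0"
    unfolding std_split_def
  proof (rule Least_equality)
    show "0 < length x0 \<and> lyndon (drop (length x0) l)" using x0 t_lyn by simp
    fix k assume k: "0 < k \<and> lyndon (drop k l)"
    then have "k < length l" using lyndon_not_Nil by force
    then have "length (drop k l) \<le> length t" 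
      using long[OF append_take_drop_id[symmetric, of l k]] k x0 by fastforce
    then show "length x0 \<le> k" using x0 \<open>k < length l\<close> by auto
  qed
  then have sr: "s = x0" "r = t" unfolding s_def r_def using x0 by auto
  show "lyndon r" using sr t_lyn by simp
  show "\<And>x z. l = x @ z \<Longrightarrow> x \<noteq> [] \<Longrightarrow> z \<noteq> [] \<Longrightarrow> r \<le> z" using sr tmin by blast
  have lt: "l < t" using lyndon_suffix l x0 by blast
  then show "s < r" using prefix_le[of x0 t] sr x0 by auto
  have "lyndon x0"
  proof (rule lyndonI)
    show "x0 \<noteq> []" using x0 by simp
    fix u x assume e: "x0 = u @ x" "u \<noteq> []" "x \<noteq> []"
    have lxt: "l < x @ t" using lyndon_suffix[of u "x @ t"] l x0 e by simp
    show "x0 < x"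
    proof (rule ccontr)
      assume "\<not> x0 < x"
      moreover have "x \<noteq> x0" using e by auto
      ultimately have "x < x0" by auto
      then show False
      \<comment> \<open>If \<open>x0 = x @ z\<close>, the inequality \<open>l < x @ t\<close>
        cancels to \<open>z @ t < t\<close>, against the minimality of \<open>t\<close>; a first
        difference between \<open>x\<close> and \<open>x0\<close> contradicts
        \<open>l < x @ t\<close> directly.\<close>
      proof (cases rule: less_list_cases)
        case (1 z)
        then have "z @ t < t" using lxt x0 by (simp add: less_append_left)
        moreover have "t \<le> z @ t" using 1 x0 e by (intro tmin) (auto intro!: exI[of _ x])
        ultimately show False by simp
      next
        case 2
        then show False using strictly_less_append[of x x0 t t] lxt x0 strictly_less_imp_less
          by (metis order.asym)
      qed
    qed
  qed
  then show "lyndon s" using sr by simp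
qed

text \<open>An earlier cut would leave the Lyndon word \<open>drop k m @ l\<close>, which lies below
  its right factor \<open>l\<close>. But \<open>drop k m\<close> is at least the standard right
  factor of \<open>m\<close>, hence at least \<open>l\<close>. A letter \<open>m\<close> admits no
  earlier cut, hence the length guard.\<close>

lemma std_split_append:
  assumes m: "lyndon m" and l: "lyndon l" and "m < l"
    and "2 \<le> length m \<Longrightarrow> l \<le> drop (std_split m) m"
  shows "std_split (m @ l) = length m"
  unfolding std_split_def
proof (rule Least_equality)
  show "0 < length m \<and> lyndon (drop (length m) (m @ l))"
    using m l lyndon_not_Nil by auto
  fix k assume k: "0 < k \<and> lyndon (drop k (m @ l))"
  show "length m \<le> k"
  proof (rule ccontr)
    assume "\<not> ?thesis"
    then have kl: "k < length m" by simp
    then have "lyndon (drop k m @ l)" using k by simp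
    then have 1: "drop k m @ l < l" using lyndon_suffix[of "drop k m" l] kl l lyndon_not_Nil by auto
    have len: "2 \<le> length m" using kl k by linarith
    have "drop (std_split m) m \<le> drop k m"
      using std_right_minimal[OF m len append_take_drop_id[symmetric, of m k]] kl k lyndon_not_Nil[OF m]
      by auto
    then have "l \<le> drop k m" using assms(4)[OF len] by order
    also have "\<dots> \<le> drop k m @ l" by (rule prefix_le)
    finally show False using 1 by simp
  qed
qed

subsection \<open>Multisets of Lyndon words\<close>

definition word_of :: "word multiset \<Rightarrow> word" where
  "word_of M = concat (rev (sorted_list_of_multiset M))"

abbreviation facm :: "word \<Rightarrow> word multiset" where
  "facm w \<equiv> mset (fac w)"

lemma sorted_wrt_ge_rev: "sorted_wrt (\<ge>) ls \<longleftrightarrow> sorted (rev ls)"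
  by (simp add: sorted_wrt_rev)

lemma declyn_mset_eq: "declyn ls \<Longrightarrow> declyn ms \<Longrightarrow> mset ls = mset ms \<Longrightarrow> ls = ms"
  unfolding declyn_def sorted_wrt_ge_rev
  by (metis mset_rev properties_for_sort rev_rev_ident)

lemma declyn_rev_sorted_list:
  "(\<And>l. l \<in># M \<Longrightarrow> lyndon l) \<Longrightarrow> declyn (rev (sorted_list_of_multiset M))"
  unfolding declyn_def by (auto simp: sorted_wrt_ge_rev)

lemma fac_word_of: "(\<And>l. l \<in># M \<Longrightarrow> lyndon l) \<Longrightarrow> fac (word_of M) = rev (sorted_list_of_multiset M)"
  unfolding word_of_def by (rule fac_concat) (rule declyn_rev_sorted_list)

lemma facm_word_of: "(\<And>l. l \<in># M \<Longrightarrow> lyndon l) \<Longrightarrow> facm (word_of M) = M"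
  by (simp add: fac_word_of)

lemma word_of_mset: "declyn ls \<Longrightarrow> word_of (mset ls) = concat ls"
  unfolding word_of_def
  by (metis declyn_def declyn_mset_eq declyn_rev_sorted_list mset_rev mset_sorted_list_of_multiset
      set_mset_mset)

lemma word_of_facm [simp]: "word_of (facm w) = w"
  by (simp add: word_of_mset)

lemma facm_inject: "facm u = facm v \<longleftrightarrow> u = v"
  by (metis word_of_facm)

lemma lyndon_of_mem_facm: "l \<in># facm w \<Longrightarrow> lyndon l"
  by (simp add: lyndon_of_mem_fac)

text \<open>The product of the free commutative monoid on Lyndon words, transported to words;
  \<open>facm\<close> turns it into addition of multisets.\<close>

definition merge :: "word \<Rightarrow> word \<Rightarrow> word" where
  "merge u v = word_of (facm u + facm v)"

lemma facm_merge: "facm (merge u v) = facm u + facm v"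
  unfolding merge_def by (rule facm_word_of) (auto simp: lyndon_of_mem_fac)

lemma merge_Cons_max:
  assumes "lyndon l" "\<And>m. m \<in># facm w \<Longrightarrow> m \<le> l"
  shows "merge l w = l @ w"
  using word_of_mset[of "l # fac w"] assms by (simp add: merge_def declyn_Cons fac_lyndon)

lemma fac_append_max:
  assumes "lyndon l" "\<And>m. m \<in># facm w \<Longrightarrow> m \<le> l"
  shows "fac (l @ w) = l # fac w"
  using assms by (intro fac_eqI) (auto simp: declyn_Cons)

section \<open>Comparing words through their largest Lyndon factor\<close>

lemma mem_fac_le: "l \<in> set (fac w) \<Longrightarrow> l \<le> w"
proof (cases "fac w")
  case (Cons m ms)
  assume "l \<in> set (fac w)"
  then have "l \<le> m" using declyn_fac[of w] unfolding Cons by (auto simp: declyn_Cons)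
  also have "m \<le> w" using concat_fac[of w] prefix_le[of m "concat ms"] unfolding Cons by simp
  finally show ?thesis .
qed simp

text \<open>A factor of \<open>v\<close> above \<open>l\<close> would exceed every factor of
  \<open>w\<close>, hence \<open>w\<close> itself, while each factor of \<open>v\<close> is at most
  \<open>v\<close>.\<close>

lemma mem_fac_le_of_word_le:
  assumes "v \<le> w" "\<And>m. m \<in># facm w \<Longrightarrow> m \<le> l" "x \<in># facm v"
  shows "x \<le> l"
proof (rule ccontr)
  assume "\<not> x \<le> l"
  then have "concat (fac w) < x"
    using assms lyndon_of_mem_facm by (intro concat_less_lyndon) force+
  then show False using mem_fac_le[of x v] assms by simp
qed

lemma fac_split_max:
  assumes "l \<in># facm w" "\<And>m. m \<in># facm w \<Longrightarrow> m \<le> l"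
  obtains w' where "w = l @ w'" "fac w = l # fac w'"
proof (cases "fac w")
  case (Cons a as)
  have d: "declyn (a # as)" using declyn_fac[of w] unfolding Cons .
  then have "a = l" using assms Cons by (fastforce simp: declyn_Cons)
  moreover have "w = a @ concat as" using concat_fac[of w] Cons by simp
  moreover have "fac (concat as) = as" using d by (intro fac_concat) (simp add: declyn_Cons)
  ultimately show ?thesis using that Cons by simp
qed (use assms in simp)

text \<open>This monotonicity makes products of leading terms leading. If \<open>l\<close> occurs in
  neither argument, all factors are below \<open>l\<close>, and so is their decreasing product. If
  \<open>u = l\<close>, a common prefix cancels. Otherwise \<open>l\<close> is the first factor of
  \<open>v\<close>, which forces it to be the first factor of \<open>w\<close> too, and one copy is
  removed from both.\<close>

lemma merge_le:
  assumes "lyndon l" "\<And>m. m \<in># facm w \<Longrightarrow> m \<le> l" "u \<le> l" "v \<le> w" "(u, v) \<noteq> (l, w)"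
  shows "merge u v < l @ w"
  using assms
proof (induction "length w" arbitrary: v w rule: less_induct)
  case less
  have vl: "x \<le> l" if "x \<in># facm v" for x
    using mem_fac_le_of_word_le[OF less.prems(4,2) that] .
  have ul: "x \<le> l" if "x \<in># facm u" for x
    using mem_fac_le_of_word_le[OF less.prems(3) _ that, of l] fac_lyndon[OF less.prems(1)] by auto
  show ?case
  proof (cases "l \<in># facm u + facm v")
    case False
    then have "\<And>x. x \<in> set (rev (sorted_list_of_multiset (facm u + facm v))) \<Longrightarrow> x < l"
      using vl ul by (force simp: order.order_iff_strict)
    then have "merge u v < l"
      unfolding merge_def word_of_def using less.prems(1) by (rule concat_less_lyndon[rotated]) auto
    then show ?thesis using prefix_le[of l w] by order
  next
    case lin: True
    show ?thesis
    proof (cases "u = l")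
      case True
      then show ?thesis using less.prems merge_Cons_max[OF less.prems(1) vl]
        by (auto simp: less_append_left order.order_iff_strict)
    next
      case False
      then have "l \<notin># facm u" using mem_fac_le[of l u] less.prems(3) by auto
      then have lv: "l \<in># facm v" using lin by auto
      obtain v' where v: "v = l @ v'" "fac v = l # fac v'" using fac_split_max[OF lv vl] .
      have lw: "l \<in># facm w"
      proof (rule ccontr)
        assume "l \<notin># facm w"
        then have "concat (fac w) < l" using less.prems(1,2)
          by (intro concat_less_lyndon) (force simp: order.order_iff_strict)+
        then show False using mem_fac_le[of l v] lv less.prems(4) by auto
      qed
      obtain w' where w: "w = l @ w'" "fac w = l # fac w'" using fac_split_max[OF lw less.prems(2)] .
      have "merge u v' < l @ w'"
      proof (rule less.hyps)
        show "length w' < length w" using w lyndon_not_Nil[OF less.prems(1)] by simp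
        show "\<And>m. m \<in># facm w' \<Longrightarrow> m \<le> l" using less.prems(2) w by simp
        show "v' \<le> w'" using less.prems(4) v w by (simp add: le_append_left)
      qed (use False less.prems in auto)
      moreover have "merge u v = l @ merge u v'"
      proof -
        have "merge u v = merge l (merge u v')"
          by (simp add: merge_def[of l] merge_def[of u v] facm_merge v(2) fac_lyndon[OF less.prems(1)])
        also have "\<dots> = l @ merge u v'"
          using less.prems(1) ul vl v(2) by (intro merge_Cons_max) (auto simp: facm_merge)
        finally show ?thesis .
      qed
      ultimately show ?thesis using w by (simp add: less_append_left)
    qed
  qed
qed

subsection \<open>Factorizations with exponents\<close>

definition expand :: "('a \<times> nat) list \<Rightarrow> 'a list" where
  "expand fs = concat (map (\<lambda>(l, i). replicate i l) fs)"

definition grouped :: "('a::linorder \<times> nat) list \<Rightarrow> bool" where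
  "grouped fs \<longleftrightarrow> sorted_wrt (>) (map fst fs) \<and> (\<forall>(l, i)\<in>set fs. 1 \<le> i)"

lemma expand_Nil [simp]: "expand [] = []"
  and expand_Cons [simp]: "expand (p # fs) = replicate (snd p) (fst p) @ expand fs"
  by (auto simp: expand_def split: prod.split)

lemma grouped_Nil [simp]: "grouped []"
  and grouped_Cons: "grouped (p # fs) \<longleftrightarrow> (\<forall>x\<in>fst ` set fs. x < fst p) \<and> 1 \<le> snd p \<and> grouped fs"
  by (auto simp: grouped_def)

lemma set_expand: "grouped fs \<Longrightarrow> set (expand fs) = fst ` set fs"
  by (induction fs) (auto simp: grouped_Cons)

lemma sorted_expand: "grouped fs \<Longrightarrow> sorted_wrt (\<ge>) (expand fs)"
  by (induction fs) (auto simp: grouped_Cons sorted_wrt_append set_expand dest: less_imp_le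
      intro!: sorted_wrt_iff_nth_less[THEN iffD2])

lemma grouped_exists: "sorted_wrt (\<ge>) ls \<Longrightarrow> \<exists>fs. grouped fs \<and> expand fs = ls"
proof (induction ls)
  case Nil
  then show ?case by (intro exI[of _ "[]"]) simp
next
  case (Cons l ls)
  then obtain fs where fs: "grouped fs" "expand fs = ls" by auto
  show ?case
  proof (cases "\<exists>i fs'. fs = (l, i) # fs'")
    case True
    then obtain i fs' where "fs = (l, i) # fs'" by blast
    then show ?thesis using fs by (intro exI[of _ "(l, Suc i) # fs'"]) (auto simp: grouped_Cons)
  next
    case False
    have "x < l" if xin: "x \<in> fst ` set fs" for x
    proof -
      obtain p fs' where p: "fs = p # fs'" using xin by (cases fs) simp_all
      have "x \<le> fst p" using xin fs p by (auto simp: grouped_Cons)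
      moreover have "fst p \<noteq> l" using False p by (metis prod.collapse)
      moreover have "fst p \<le> l" using Cons.prems set_expand[OF fs(1)] fs(2) p by auto
      ultimately show ?thesis by order
    qed
    then show ?thesis using fs by (intro exI[of _ "(l, 1) # fs"]) (auto simp: grouped_Cons)
  qed
qed

lemma grouped_unique: "grouped fs \<Longrightarrow> grouped gs \<Longrightarrow> expand fs = expand gs \<Longrightarrow> fs = gs"
proof (induction fs arbitrary: gs)
  case Nil
  then show ?case by (cases gs) (auto simp: grouped_Cons)
next
  case (Cons p fs)
  obtain r gs' where gs: "gs = r # gs'"
    using Cons.prems by (cases gs) (auto simp: grouped_Cons)
  have "hd (expand (p # fs)) = fst p" "hd (expand gs) = fst r"
    using Cons.prems gs by (cases "snd p"; cases "snd r"; auto simp: grouped_Cons)+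
  then have 1: "fst p = fst r" using Cons.prems by simp
  have c: "count_list (expand (a # as)) (fst a) = snd a" if "grouped (a # as)" for a :: "'a \<times> nat" and as
  proof -
    have "fst a \<notin> set (expand as)" using that set_expand[of as] by (auto simp: grouped_Cons)
    then have "count_list (expand as) (fst a) = 0" by (simp add: count_list_0_iff)
    moreover have "count_list (replicate n x) x = n" for n and x :: 'a by (induction n) auto
    ultimately show ?thesis by simp
  qed
  have 2: "snd p = snd r" using c[of p fs] c[of r gs'] Cons.prems gs 1 by metis
  have "expand fs = expand gs'" using Cons.prems gs 1 2 by simp
  then show ?case using Cons.IH[of gs'] Cons.prems gs 1 2 by (auto simp: grouped_Cons prod_eq_iff)
qed

text \<open>\<open>lyndon_factorization\<close> is a definite description, so it says nothing until
  unique existence is shown. Its predicate amounts to \<open>fs\<close> being the run-length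
  encoding of \<open>fac w\<close>.\<close>

lemma
  shows grouped_lyndon_factorization: "grouped (lyndon_factorization w)"
    and expand_lyndon_factorization: "expand (lyndon_factorization w) = fac w"
proof -
  let ?P = "\<lambda>fs. sorted_wrt (>) (map fst fs) \<and> (\<forall>(l, i)\<in>set fs. lyndon l \<and> 1 \<le> i) \<and>
     concat (map (\<lambda>(l, i). concat (replicate i l)) fs) = w"
  have cc: "concat (map (\<lambda>(l, i). concat (replicate i l)) fs) = concat (expand fs)"
    for fs :: "(word \<times> nat) list"
    by (induction fs) (auto split: prod.split)
  have eq: "?P fs \<longleftrightarrow> grouped fs \<and> expand fs = fac w" for fs
  proof
    assume P: "?P fs"
    then have g: "grouped fs" by (auto simp: grouped_def)
    then have "declyn (expand fs)" using P set_expand[OF g] sorted_expand by (auto simp: declyn_def)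
    then have "fac w = expand fs" using P cc by (intro fac_eqI) auto
    then show "grouped fs \<and> expand fs = fac w" using g by simp
  next
    assume g: "grouped fs \<and> expand fs = fac w"
    then have "concat (expand fs) = w" by simp
    moreover have "\<forall>l\<in>fst ` set fs. lyndon l" using g set_expand lyndon_of_mem_fac by metis
    ultimately show "?P fs" using g cc by (force simp: grouped_def)
  qed
  have "\<exists>!fs. ?P fs" unfolding eq
    using grouped_exists[of "fac w"] grouped_unique declyn_fac[of w] by (metis declyn_def)
  from theI'[OF this] have "?P (lyndon_factorization w)" unfolding lyndon_factorization_def .
  then show "grouped (lyndon_factorization w)" "expand (lyndon_factorization w) = fac w"
    unfolding eq by auto
qed

section \<open>Noncommutative polynomials and the pairing\<close>

abbreviation supp :: "('a \<Rightarrow>\<^sub>0 'b::zero) \<Rightarrow> 'a set" where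
  "supp \<equiv> Poly_Mapping.keys"

lemma coeff_wd: "coeff_at (wd u) v = (if u = v then 1 else 0)"
  by (simp add: wd_def lookup_single when_def)

lemma wd_mult: "wd u * wd v = wd (u @ v)"
  by (simp add: wd_def mult_single plus_list_def)

lemma wd_Nil: "wd [] = 1"
  unfolding wd_def zero_list_def[symmetric] by (rule single_one)

lemma ncpoly_expand: "finite K \<Longrightarrow> supp P \<subseteq> K \<Longrightarrow> P = (\<Sum>w\<in>K. scl (coeff_at P w) (wd w))"
  by (rule poly_mapping_eqI)
    (auto simp: lookup_sum lookup_scl coeff_wd not_in_keys_iff_lookup_eq_zero if_distrib
      intro!: in_keys_iff[THEN iffD2] cong: if_cong)

lemma ncpoly_induct [case_names zero word add]:
  assumes "Q 0" "\<And>c w. Q (scl c (wd w))" "\<And>A B. Q A \<Longrightarrow> Q B \<Longrightarrow> Q (A + B)"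
  shows "Q P"
proof -
  have "Q (\<Sum>w\<in>K. scl (coeff_at P w) (wd w))" if "finite K" for K
    using that by (induction K) (auto intro: assms)
  then show ?thesis using ncpoly_expand[of "supp P" P] by (metis finite_keys subset_refl)
qed

lemma
  fixes c :: "'k::comm_ring_1"
  shows scl_mult_left: "scl c P * Q = scl c (P * Q)"
    and scl_mult_right: "P * scl c Q = scl c (P * Q)"
proof -
  have s: "scl c P = Poly_Mapping.single 0 c * P" for P :: "'k ncpoly"
    by (rule poly_mapping_eqI) (simp add: lookup_scl mult_map_scale_conv_mult[symmetric] scl_def)
  show "scl c P * Q = scl c (P * Q)" by (simp add: s mult.assoc)
  have w: "scl d (wd w) = Poly_Mapping.single w d" for d :: 'k and w
    by (rule poly_mapping_eqI) (simp add: lookup_scl wd_def lookup_single when_def)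
  have comm: "P * Poly_Mapping.single 0 c = Poly_Mapping.single 0 c * P" for P :: "'k ncpoly"
  proof (induction P rule: ncpoly_induct)
    case (word d w)
    then show ?case by (simp add: w mult_single mult.commute)
  qed (simp_all add: algebra_simps)
  show "P * scl c Q = scl c (P * Q)" by (simp add: s mult.assoc[symmetric] comm)
qed

lemma coeff_mult:
  fixes P :: "'k::comm_ring_1 ncpoly"
  shows "coeff_at (P * Q) w = (\<Sum>k\<le>length w. coeff_at P (take k w) * coeff_at Q (drop k w))"
proof (induction P rule: ncpoly_induct)
  case (word c u)
  show ?case
  proof (induction Q rule: ncpoly_induct)
    case (word d v)
    have "(\<Sum>k\<le>length w. coeff_at (wd u) (take k w) * coeff_at (wd v) (drop k w) :: 'k) =
      (\<Sum>k\<le>length w. if k = length u \<and> w = u @ v then 1 else 0)"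
    proof (rule sum.cong[OF refl])
      fix k assume "k \<in> {..length w}"
      then have "take k w = u \<and> drop k w = v \<longleftrightarrow> k = length u \<and> w = u @ v"
        by (metis append_eq_conv_conj atMost_iff length_take min.absorb2)
      then show "coeff_at (wd u) (take k w) * coeff_at (wd v) (drop k w) =
          (if k = length u \<and> w = u @ v then 1 else 0 :: 'k)"
        by (auto simp: coeff_wd)
    qed
    also have "\<dots> = coeff_at (wd u * wd v) w"
      by (auto simp: wd_mult coeff_wd)
    finally show ?case
      by (simp add: scl_mult_left scl_mult_right lookup_scl sum_distrib_left[symmetric] mult.assoc
          mult.left_commute[of _ d])
  qed (simp_all add: lookup_add algebra_simps sum.distrib)
qed (simp_all add: lookup_add algebra_simps sum.distrib)

lemma keys_scl: "supp (scl c P) \<subseteq> supp P"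
  by (auto simp: in_keys_iff lookup_scl)

text \<open>The functional \<open>g\<close> may be nonzero on infinitely many words, so it need not
  come from a polynomial as in \<open>pairing\<close>.\<close>

definition extend_linear :: "(word \<Rightarrow> 'k) \<Rightarrow> 'k::comm_ring_1 ncpoly \<Rightarrow> 'k" where
  "extend_linear g P = (\<Sum>w\<in>supp P. coeff_at P w * g w)"

lemma extend_linear_eq_sum:
  "finite K \<Longrightarrow> supp P \<subseteq> K \<Longrightarrow> extend_linear g P = (\<Sum>w\<in>K. coeff_at P w * g w)"
  unfolding extend_linear_def by (rule sum.mono_neutral_left) (auto simp: in_keys_iff)

lemma extend_linear_add: "extend_linear g (P + Q) = extend_linear g P + extend_linear g Q"
  using keys_add[of P Q]
  by (simp add: extend_linear_eq_sum[of "supp P \<union> supp Q"] lookup_add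
      distrib_right sum.distrib)

lemma extend_linear_scl: "extend_linear g (scl c P) = c * extend_linear g P"
  using keys_scl[of c P]
  by (simp add: extend_linear_eq_sum[of "supp P"] lookup_scl sum_distrib_left mult.assoc)

lemma extend_linear_wd: "extend_linear g (wd w) = g w"
  by (subst extend_linear_eq_sum[of "{w}"]) (auto simp: in_keys_iff coeff_wd split: if_splits)

lemma pairing_eq_sum:
  "finite K \<Longrightarrow> supp P \<subseteq> K \<Longrightarrow> pairing P Q = (\<Sum>w\<in>K. coeff_at P w * coeff_at Q w)"
  unfolding pairing_def by (rule sum.mono_neutral_left) (auto simp: in_keys_iff)

lemma pairing_eq_extend_linear: "pairing P Q = extend_linear (coeff_at Q) P"
  by (simp add: pairing_def extend_linear_def)

lemma pairing_zero_left [simp]: "pairing 0 Q = 0" and pairing_zero_right [simp]: "pairing P 0 = 0"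
  by (simp_all add: pairing_def)

lemma pairing_add_left: "pairing (P + P') Q = pairing P Q + pairing P' Q"
  and pairing_scl_left: "pairing (scl c P) Q = c * pairing P Q"
  and pairing_wd_left: "pairing (wd w) P = coeff_at P w"
  by (simp_all add: pairing_eq_extend_linear extend_linear_add extend_linear_scl extend_linear_wd)

lemma pairing_add_right: "pairing P (Q + Q') = pairing P Q + pairing P Q'"
  and pairing_scl_right: "pairing P (scl c Q) = c * pairing P Q"
  by (simp_all add: pairing_def lookup_add lookup_scl algebra_simps sum.distrib sum_distrib_left)

lemma pairing_minus_left: "pairing (P - P') Q = pairing P Q - pairing P' Q"
  using pairing_add_left[of "P - P'" P' Q] by simp

lemma pairing_minus_right: "pairing P (Q - Q') = pairing P Q - pairing P Q'"
  using pairing_add_right[of P "Q - Q'" Q'] by simp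

lemma pairing_sum_left: "pairing (sum f A) Q = (\<Sum>i\<in>A. pairing (f i) Q)"
  by (induction A rule: infinite_finite_induct) (auto simp: pairing_add_left)

lemma pairing_sum_right: "pairing P (sum f A) = (\<Sum>i\<in>A. pairing P (f i))"
  by (induction A rule: infinite_finite_induct) (auto simp: pairing_add_right)

lemma pairing_wd_right: "pairing P (wd w) = coeff_at P w"
  by (auto simp: pairing_def coeff_wd in_keys_iff if_distrib cong: if_cong)

lemmas pairing_simps = pairing_add_left pairing_add_right pairing_scl_left pairing_scl_right
  pairing_minus_left pairing_minus_right pairing_sum_left pairing_sum_right pairing_wd_left
  pairing_wd_right

lemma pairing_commute: "pairing P Q = pairing Q P"
  by (induction P rule: ncpoly_induct) (simp_all add: pairing_simps)

lemma weight_Nil [simp]: "weight [] = 0"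
  and weight_Cons [simp]: "weight (a # w) = index a + weight w"
  and weight_append [simp]: "weight (u @ v) = weight u + weight v"
  by (simp_all add: weight_def)

lemma index_pos [simp]: "0 < index a" and index_neq_0 [simp]: "index a \<noteq> 0"
  using index[of a] by simp_all

lemma length_le_weight: "length w \<le> weight w"
proof (induction w)
  case (Cons a w)
  then show ?case using index_pos[of a] by (simp del: index_pos)
qed simp

lemma weight_eq_0_iff [simp]: "weight w = 0 \<longleftrightarrow> w = []"
  using length_le_weight[of w] by auto

lemma index_y: "0 < k \<Longrightarrow> index (y k) = k"
  by (simp add: y_inverse)

lemma y_index: "y (index a) = a"
  by (rule index_inverse)

definition words_of_weight :: "nat \<Rightarrow> word set" where
  "words_of_weight n = {w. weight w = n}"

lemma mem_words_of_weight [simp]: "w \<in> words_of_weight n \<longleftrightarrow> weight w = n"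
  by (simp add: words_of_weight_def)

lemma finite_words_of_weight [simp]: "finite (words_of_weight n)"
proof (rule finite_subset)
  show "words_of_weight n \<subseteq> {w. set w \<subseteq> y ` {..n} \<and> length w \<le> n}"
  proof safe
    fix w a assume w: "w \<in> words_of_weight n"
    then show "length w \<le> n" using length_le_weight[of w] by simp
    assume "a \<in> set w"
    then have "index a \<le> n" using w member_le_sum_list[of "index a" "map index w"]
      by (auto simp: weight_def)
    then show "a \<in> y ` {..n}" by (metis atMost_iff image_eqI y_index)
  qed
  show "finite {w. set w \<subseteq> y ` {..n} \<and> length w \<le> n}"
    by (rule finite_lists_length_le) simp
qed

text \<open>A finite index set sufficient for expanding \<open>P\<close> in any basis whose member
  at \<open>w\<close> is homogeneous of the weight of \<open>w\<close>; the support of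
  \<open>P\<close> alone would be too small.\<close>

definition words_of_weights :: "'k::comm_ring_1 ncpoly \<Rightarrow> word set" where
  "words_of_weights P = (\<Union>u\<in>supp P. words_of_weight (weight u))"

lemma finite_words_of_weights [simp]: "finite (words_of_weights P)"
  by (simp add: words_of_weights_def)

section \<open>Dual weight-homogeneous bases\<close>

lemma homogeneousD: "weight_homogeneous n P \<Longrightarrow> coeff_at P v \<noteq> 0 \<Longrightarrow> weight v = n"
  by (auto simp: weight_homogeneous_def in_keys_iff)

lemma homogeneous_coeff_0: "weight_homogeneous n P \<Longrightarrow> weight v \<noteq> n \<Longrightarrow> coeff_at P v = 0"
  by (auto simp: weight_homogeneous_def in_keys_iff)

lemma homogeneousI: "(\<And>v. coeff_at P v \<noteq> 0 \<Longrightarrow> weight v = n) \<Longrightarrow> weight_homogeneous n P"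
  by (auto simp: weight_homogeneous_def in_keys_iff)

lemma homogeneous_expand:
  "weight_homogeneous n P \<Longrightarrow> P = (\<Sum>w\<in>words_of_weight n. scl (coeff_at P w) (wd w))"
  by (rule ncpoly_expand) (auto simp: weight_homogeneous_def)

lemma pairing_homogeneous:
  "weight_homogeneous n P \<Longrightarrow> pairing P Q = (\<Sum>w\<in>words_of_weight n. coeff_at P w * coeff_at Q w)"
  by (rule pairing_eq_sum) (auto simp: weight_homogeneous_def)

lemma homogeneous_add:
  "weight_homogeneous n P \<Longrightarrow> weight_homogeneous n Q \<Longrightarrow> weight_homogeneous n (P + Q)"
  by (rule homogeneousI) (metis add_0 homogeneousD lookup_add)

lemma homogeneous_minus:
  "weight_homogeneous n P \<Longrightarrow> weight_homogeneous n Q \<Longrightarrow> weight_homogeneous n (P - Q)"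
  by (rule homogeneousI) (metis diff_self homogeneousD lookup_minus diff_0_right)

lemma homogeneous_scl: "weight_homogeneous n P \<Longrightarrow> weight_homogeneous n (scl c P)"
  by (rule homogeneousI) (metis mult_zero_right homogeneousD lookup_scl)

lemma homogeneous_wd: "weight_homogeneous (weight w) (wd w)"
  by (rule homogeneousI) (auto simp: coeff_wd split: if_splits)

lemma homogeneous_mult:
  assumes "weight_homogeneous m P" "weight_homogeneous n Q"
  shows "weight_homogeneous (m + n) (P * Q)"
proof (rule homogeneousI)
  fix v assume "coeff_at (P * Q) v \<noteq> 0"
  then obtain k where "coeff_at P (take k v) * coeff_at Q (drop k v) \<noteq> 0"
    unfolding coeff_mult by (meson sum.neutral)
  then have "weight (take k v) = m" "weight (drop k v) = n"
    using assms by (metis homogeneousD mult_zero_left mult_zero_right)+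
  then show "weight v = m + n" by (metis append_take_drop_id weight_append)
qed

text \<open>The third condition is biorthogonality, the fourth completeness: within each weight the
  two transition matrices are inverse in both orders. Restricting the index to the weight of
  \<open>u\<close> keeps the sum finite and, by homogeneity, omits nothing.\<close>

definition dual_bases ::
    "(word \<Rightarrow> 'k::comm_ring_1 ncpoly) \<Rightarrow> (word \<Rightarrow> 'k ncpoly) \<Rightarrow> bool" where
  "dual_bases B S \<longleftrightarrow>
     (\<forall>w. weight_homogeneous (weight w) (B w)) \<and> (\<forall>w. weight_homogeneous (weight w) (S w)) \<and>
     (\<forall>u v. pairing (S v) (B u) = (if u = v then 1 else 0)) \<and>
     (\<forall>u v. (\<Sum>w\<in>words_of_weight (weight u). coeff_at (S w) u * coeff_at (B w) v) =
        (if u = v then 1 else 0))"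

lemma dual_basesD:
  assumes "dual_bases B S"
  shows "weight_homogeneous (weight w) (B w)" "weight_homogeneous (weight w) (S w)"
    "pairing (S v) (B u) = (if u = v then 1 else 0)"
    "(\<Sum>w\<in>words_of_weight (weight u). coeff_at (S w) u * coeff_at (B w) v) = (if u = v then 1 else 0)"
  using assms unfolding dual_bases_def by blast+

lemma dual_bases_sym:
  assumes "dual_bases B S"
  shows "dual_bases S B"
  unfolding dual_bases_def
proof (intro conjI allI)
  fix u v
  show "(\<Sum>w\<in>words_of_weight (weight u). coeff_at (B w) u * coeff_at (S w) v) = (if u = v then 1 else 0)"
  proof (cases "weight u = weight v")
    case True
    then show ?thesis using dual_basesD(4)[OF assms, of v u] by (simp add: mult.commute)
  next
    case False
    then have "(\<Sum>w\<in>words_of_weight (weight u). coeff_at (B w) u * coeff_at (S w) v) = 0"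
      using homogeneous_coeff_0[OF dual_basesD(2)[OF assms]] by (intro sum.neutral) auto
    then show ?thesis using False by auto
  qed
qed (use dual_basesD[OF assms] in \<open>auto simp: pairing_commute[of "B _"]\<close>)

lemma dual_bases_expand:
  assumes "dual_bases B S"
  shows "P = (\<Sum>w\<in>words_of_weights P. scl (pairing (S w) P) (B w))"
proof (rule poly_mapping_eqI)
  fix v
  let ?W = "words_of_weights P"
  have "coeff_at (\<Sum>w\<in>?W. scl (pairing (S w) P) (B w)) v =
    (\<Sum>w\<in>?W. (\<Sum>u\<in>supp P. coeff_at P u * coeff_at (S w) u) * coeff_at (B w) v)"
    by (subst pairing_commute) (simp add: lookup_sum lookup_scl pairing_def)
  also have "\<dots> = (\<Sum>u\<in>supp P. coeff_at P u * (\<Sum>w\<in>?W. coeff_at (S w) u * coeff_at (B w) v))"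
    unfolding sum_distrib_right sum_distrib_left by (subst sum.swap) (simp add: ac_simps)
  also have "\<dots> = (\<Sum>u\<in>supp P. coeff_at P u * (if u = v then 1 else 0))"
  proof (rule sum.cong[OF refl])
    fix u assume u: "u \<in> supp P"
    have "(\<Sum>w\<in>?W. coeff_at (S w) u * coeff_at (B w) v) =
      (\<Sum>w\<in>words_of_weight (weight u). coeff_at (S w) u * coeff_at (B w) v)"
      by (rule sum.mono_neutral_right)
        (use u homogeneous_coeff_0[OF dual_basesD(2)[OF assms]] in \<open>auto simp: words_of_weights_def\<close>)
    then show "coeff_at P u * (\<Sum>w\<in>?W. coeff_at (S w) u * coeff_at (B w) v) =
      coeff_at P u * (if u = v then 1 else 0)"
      using dual_basesD(4)[OF assms] by simp
  qed
  also have "\<dots> = coeff_at P v"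
    by (auto simp: if_distrib in_keys_iff cong: if_cong)
  finally show "coeff_at P v = coeff_at (\<Sum>w\<in>?W. scl (pairing (S w) P) (B w)) v" ..
qed

lemma dual_bases_expand_homogeneous:
  assumes "dual_bases B S" "weight_homogeneous n P"
  shows "P = (\<Sum>w\<in>words_of_weight n. scl (pairing (S w) P) (B w))"
proof -
  have "words_of_weights P \<subseteq> words_of_weight n"
    using assms(2) by (auto simp: words_of_weights_def weight_homogeneous_def)
  moreover have "pairing (S w) P = 0" if "w \<notin> words_of_weights P" for w
  proof -
    have "coeff_at P v = 0" if "weight v = weight w" for v
      using that \<open>w \<notin> words_of_weights P\<close> by (metis UN_I in_keys_iff mem_words_of_weight words_of_weights_def)
    then show ?thesis
      unfolding pairing_homogeneous[OF dual_basesD(2)[OF assms(1)]] by (intro sum.neutral) simp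
  qed
  ultimately have "(\<Sum>w\<in>words_of_weights P. scl (pairing (S w) P) (B w)) =
    (\<Sum>w\<in>words_of_weight n. scl (pairing (S w) P) (B w))"
    by (intro sum.mono_neutral_left) auto
  then show ?thesis using dual_bases_expand[OF assms(1), of P] by simp
qed

lemma dual_bases_induct:
  assumes "dual_bases B S" "Q 0" "\<And>c w. Q (scl c (B w))" "\<And>A B. Q A \<Longrightarrow> Q B \<Longrightarrow> Q (A + B)"
  shows "Q P"
proof -
  have "Q (\<Sum>w\<in>K. scl (c w) (B w))" if "finite K" for K c
    using that by (induction K) (auto intro: assms)
  then show ?thesis using dual_bases_expand[OF assms(1), of P] by (metis finite_words_of_weights)
qed

lemma dual_bases_ext:
  assumes "dual_bases B S" "\<And>w. pairing P (B w) = pairing Q (B w)"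
  shows "P = Q"
proof -
  have "pairing P X = pairing Q X" for X
    by (subst (1 2) dual_bases_expand[OF assms(1), of X]) (simp add: pairing_simps assms(2))
  from this[of "wd _"] show ?thesis by (intro poly_mapping_eqI) (simp add: pairing_wd_right)
qed

lemma dual_family_eq:
  assumes "dual_bases B S"
  shows "dual_family B = S"
  unfolding dual_family_def
proof (rule the_equality)
  show "\<forall>v u. pairing (S v) (B u) = (if u = v then 1 else 0)"
    using dual_basesD(3)[OF assms] by blast
  fix T assume "\<forall>v u. pairing (T v) (B u) = (if u = v then 1 else 0)"
  then show "T = S"
    by (intro ext dual_bases_ext[OF assms]) (simp add: dual_basesD(3)[OF assms])
qed

text \<open>In the expansion along \<open>B\<close> the coefficients are the pairings with
  \<open>S\<close>, so those outside \<open>I\<close> are the only obstruction. Membership in the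
  span of a Lyndon-indexed family thereby becomes a family of orthogonality relations.\<close>

lemma dual_bases_span:
  assumes "dual_bases B S"
  shows "ncp.span (B ` I) = {P. \<forall>w. w \<notin> I \<longrightarrow> pairing (S w) P = 0}"
proof
  show "ncp.span (B ` I) \<subseteq> {P. \<forall>w. w \<notin> I \<longrightarrow> pairing (S w) P = 0}"
    by (rule ncp.span_minimal)
      (auto simp: dual_basesD(3)[OF assms] ncp.subspace_def pairing_simps)
  show "{P. \<forall>w. w \<notin> I \<longrightarrow> pairing (S w) P = 0} \<subseteq> ncp.span (B ` I)"
  proof
    fix P assume P: "P \<in> {P. \<forall>w. w \<notin> I \<longrightarrow> pairing (S w) P = 0}"
    have "scl (pairing (S w) P) (B w) \<in> ncp.span (B ` I)" for w
      using P by (cases "w \<in> I") (auto intro: ncp.span_scale ncp.span_base ncp.span_zero)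
    then have "(\<Sum>w\<in>words_of_weights P. scl (pairing (S w) P) (B w)) \<in> ncp.span (B ` I)"
      by (intro ncp.span_sum)
    then show "P \<in> ncp.span (B ` I)" using dual_bases_expand[OF assms, of P] by simp
  qed
qed

lemma dual_bases_basis_family:
  assumes "dual_bases B S" "M = {P. \<forall>w. w \<notin> I \<longrightarrow> pairing (S w) P = 0}"
  shows "basis_family B I M"
  unfolding basis_family_def
proof (intro conjI)
  have inj: "inj B"
    by (rule injI) (metis dual_basesD(3)[OF assms(1)] zero_neq_one)
  then show "inj_on B I" by (rule inj_on_subset) simp
  show "ncp.independent (B ` I)"
    unfolding ncp.independent_explicit_module
  proof (intro allI impI)
    fix t u v assume t: "finite t" "t \<subseteq> B ` I" "(\<Sum>v\<in>t. scl (u v) v) = 0" "v \<in> t"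
    obtain w where w: "v = B w" using t by auto
    have "0 = pairing (S w) (\<Sum>v\<in>t. scl (u v) v)" using t by simp
    also have "\<dots> = (\<Sum>x\<in>t. u x * pairing (S w) x)" by (simp add: pairing_simps)
    also have "\<dots> = (\<Sum>x\<in>t. if x = v then u v else 0)"
      using t(2) by (intro sum.cong) (auto simp: w dual_basesD(3)[OF assms(1)])
    also have "\<dots> = u v" using t by simp
    finally show "u v = 0" ..
  qed
  show "ncp.span (B ` I) = M" using dual_bases_span[OF assms(1)] assms(2) by simp
qed

lemma scale_delta:
  "finite W \<Longrightarrow> u \<in> W \<Longrightarrow> (\<Sum>w\<in>W. scl (if w = u then 1 else 0) (B w)) = B u"
  by (simp add: if_distrib[of "\<lambda>c. scl c _"] cong: if_cong)

text \<open>The orders on words are not well-founded, but each weight has only finitely many words;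
  counting \<open>R\<close>-predecessors of equal weight gives a rank suitable for
  induction.\<close>

lemma card_less_of_transp:
  assumes "transp R" "irreflp R" "R v w" "weight v = weight w"
  shows "card {x\<in>words_of_weight (weight v). R x v} < card {x\<in>words_of_weight (weight w). R x w}"
proof (rule psubset_card_mono)
  show "finite {x\<in>words_of_weight (weight w). R x w}"
    by (rule finite_subset[OF _ finite_words_of_weight[of "weight w"]]) auto
  show "{x\<in>words_of_weight (weight v). R x v} \<subset> {x\<in>words_of_weight (weight w). R x w}"
    using assms by (auto dest: transpD irreflpD)
qed

text \<open>Inverts a unitriangular matrix weight by weight; no division occurs since the diagonal
  is 1. \<open>A\<close> is the inverse matrix, obtained by induction on the rank, and
  \<open>S\<close> its transpose.\<close>

lemma dual_bases_of_triangular: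
  fixes B :: "word \<Rightarrow> 'k::comm_ring_1 ncpoly"
  assumes R: "transp R" "irreflp R"
    and hom: "\<And>w. weight_homogeneous (weight w) (B w)"
    and one: "\<And>w. coeff_at (B w) w = 1"
    and tri': "\<And>w v. coeff_at (B w) v \<noteq> 0 \<Longrightarrow> v = w \<or> R v w"
  shows "\<exists>S. dual_bases B S"
proof -
  define r where "r w = card {x\<in>words_of_weight (weight w). R x w}" for w
  have tri: "v = w \<or> r v < r w" if "coeff_at (B w) v \<noteq> 0" for v w
    using tri'[OF that] card_less_of_transp[OF R] homogeneousD[OF hom that] by (auto simp: r_def)
  have "\<exists>a. wd u = (\<Sum>w\<in>words_of_weight (weight u). scl (a w) (B w))" for u
  proof (induction "r u" arbitrary: u rule: less_induct)
    case less
    let ?W = "words_of_weight (weight u)"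
    have "\<exists>a. coeff_at (B u) v \<noteq> 0 \<and> v \<noteq> u \<longrightarrow> wd v = (\<Sum>w\<in>?W. scl (a w) (B w))" for v
    proof (cases "coeff_at (B u) v \<noteq> 0 \<and> v \<noteq> u")
      case True
      then have "weight v = weight u" "r v < r u" using homogeneousD[OF hom] tri by auto
      then show ?thesis using less[of v] by simp
    qed auto
    then obtain a where a: "\<And>v. coeff_at (B u) v \<noteq> 0 \<Longrightarrow> v \<noteq> u \<Longrightarrow>
        wd v = (\<Sum>w\<in>?W. scl (a v w) (B w))" by metis
    have "B u = (\<Sum>v\<in>?W. scl (coeff_at (B u) v) (wd v))" by (rule homogeneous_expand[OF hom])
    also have "\<dots> = wd u + (\<Sum>v\<in>?W - {u}. scl (coeff_at (B u) v) (wd v))"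
      by (subst sum.remove[of _ u]) (auto simp: one)
    also have "(\<Sum>v\<in>?W - {u}. scl (coeff_at (B u) v) (wd v)) =
        (\<Sum>v\<in>?W - {u}. \<Sum>w\<in>?W. scl (coeff_at (B u) v * a v w) (B w))"
    proof (rule sum.cong[OF refl])
      fix v assume "v \<in> ?W - {u}"
      then show "scl (coeff_at (B u) v) (wd v) = (\<Sum>w\<in>?W. scl (coeff_at (B u) v * a v w) (B w))"
        using a[of v] by (cases "coeff_at (B u) v = 0") (auto simp: ncp.scale_sum_right)
    qed
    also have "\<dots> = (\<Sum>w\<in>?W. scl (\<Sum>v\<in>?W - {u}. coeff_at (B u) v * a v w) (B w))"
      by (subst sum.swap) (simp add: ncp.scale_sum_left)
    finally have "wd u = B u - (\<Sum>w\<in>?W. scl (\<Sum>v\<in>?W - {u}. coeff_at (B u) v * a v w) (B w))"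
      by (subst eq_diff_eq) (rule sym)
    also have "\<dots> = (\<Sum>w\<in>?W. scl ((if w = u then 1 else 0) - (\<Sum>v\<in>?W - {u}. coeff_at (B u) v * a v w)) (B w))"
      by (simp add: ncp.scale_left_diff_distrib sum_subtractf scale_delta)
    finally show ?case
      by (intro exI[of _ "\<lambda>w. (if w = u then 1 else 0) - (\<Sum>v\<in>?W - {u}. coeff_at (B u) v * a v w)"])
  qed
  then have "\<forall>u. \<exists>a. wd u = (\<Sum>w\<in>words_of_weight (weight u). scl (a w) (B w))" ..
  from choice[OF this] obtain A
    where A: "\<And>u. wd u = (\<Sum>w\<in>words_of_weight (weight u). scl (A u w) (B w))" by blast
  \<comment> \<open>At an index of maximal rank among those with nonzero coefficient, no other
    \<open>B w'\<close> of the combination contributes.\<close>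
  have indep: "\<forall>w\<in>W. c w = 0" if W: "finite W" "(\<Sum>w\<in>W. scl (c w) (B w)) = 0" for c :: "word \<Rightarrow> 'k" and W
  proof (rule ccontr)
    assume "\<not> ?thesis"
    then have T: "finite {w\<in>W. c w \<noteq> 0}" "{w\<in>W. c w \<noteq> 0} \<noteq> {}" using W by auto
    obtain w where w: "w \<in> W" "c w \<noteq> 0" and max: "\<And>w'. w' \<in> W \<Longrightarrow> c w' \<noteq> 0 \<Longrightarrow> r w' \<le> r w"
    proof -
      have "Max (r ` {w\<in>W. c w \<noteq> 0}) \<in> r ` {w\<in>W. c w \<noteq> 0}" using T by (intro Max_in) auto
      then obtain w where "w \<in> W" "c w \<noteq> 0" "r w = Max (r ` {w\<in>W. c w \<noteq> 0})" by auto
      then show ?thesis using T by (intro that[of w]) auto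
    qed
    have "0 = coeff_at (\<Sum>w\<in>W. scl (c w) (B w)) w" using W by simp
    also have "\<dots> = (\<Sum>w'\<in>W. c w' * coeff_at (B w') w)" by (simp add: lookup_sum lookup_scl)
    also have "\<dots> = (\<Sum>w'\<in>W. if w' = w then c w else 0)"
    proof (rule sum.cong[OF refl])
      fix w' assume w': "w' \<in> W"
      show "c w' * coeff_at (B w') w = (if w' = w then c w else 0)"
      proof (cases "w' = w")
        case False
        then have "c w' = 0 \<or> coeff_at (B w') w = 0"
          using tri[of w' w] max[OF w'] by (metis not_less)
        then show ?thesis using False by auto
      qed (simp add: one)
    qed
    also have "\<dots> = c w" using W(1) w(1) by simp
    finally show False using w(2) by simp
  qed
  define S where "S w = (\<Sum>u\<in>words_of_weight (weight w). scl (A u w) (wd u))" for w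
  have S: "coeff_at (S w) u = (if weight u = weight w then A u w else 0)" for w u
    by (simp add: S_def lookup_sum lookup_scl coeff_wd if_distrib cong: if_cong)
  have homS: "weight_homogeneous (weight w) (S w)" for w
    by (rule homogeneousI) (simp add: S split: if_splits)
  have D: "(\<Sum>w\<in>words_of_weight (weight u). coeff_at (S w) u * coeff_at (B w) v) = (if u = v then 1 else 0)"
    for u v
  proof -
    have "(if u = v then 1 else 0) = coeff_at (wd u :: 'k ncpoly) v" by (simp add: coeff_wd)
    also have "\<dots> = (\<Sum>w\<in>words_of_weight (weight u). coeff_at (S w) u * coeff_at (B w) v)"
      by (subst A) (simp add: lookup_sum lookup_scl S)
    finally show ?thesis ..
  qed
  have "pairing (S v) (B u) = (if u = v then 1 else 0)" for u v
  proof (cases "weight u = weight v")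
    case False
    then have "pairing (S v) (B u) = 0"
      unfolding pairing_homogeneous[OF homS] using homogeneous_coeff_0[OF hom, of _ u]
      by (intro sum.neutral) auto
    then show ?thesis using False by auto
  next
    case True
    let ?W = "words_of_weight (weight u)"
    have "B u = (\<Sum>x\<in>?W. scl (coeff_at (B u) x) (wd x))" by (rule homogeneous_expand[OF hom])
    also have "\<dots> = (\<Sum>x\<in>?W. scl (coeff_at (B u) x) (\<Sum>w\<in>?W. scl (A x w) (B w)))"
      by (intro sum.cong refl arg_cong[of _ _ "scl _"]) (subst A, simp)
    also have "\<dots> = (\<Sum>w\<in>?W. \<Sum>x\<in>?W. scl (coeff_at (B u) x * A x w) (B w))"
      unfolding ncp.scale_sum_right by (subst sum.swap) simp
    also have "\<dots> = (\<Sum>w\<in>?W. scl (pairing (S w) (B u)) (B w))"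
      by (intro sum.cong)
        (auto simp: pairing_homogeneous[OF homS] S ncp.scale_sum_left[symmetric] mult.commute)
    \<comment> \<open>The sought pairings are now coefficients of \<open>B u\<close> along the
      family itself; independence forces them to be those of the trivial expansion.\<close>
    finally have e: "B u = (\<Sum>w\<in>?W. scl (pairing (S w) (B u)) (B w))" .
    have "(\<Sum>w\<in>?W. scl (pairing (S w) (B u) - (if w = u then 1 else 0)) (B w)) =
        (\<Sum>w\<in>?W. scl (pairing (S w) (B u)) (B w)) - B u"
      unfolding ncp.scale_left_diff_distrib sum_subtractf by (simp add: scale_delta)
    also have "\<dots> = 0" using e[symmetric] by simp
    finally have "(\<Sum>w\<in>?W. scl (pairing (S w) (B u) - (if w = u then 1 else 0)) (B w)) = 0" .
    then have "\<forall>w\<in>?W. pairing (S w) (B u) - (if w = u then 1 else 0) = 0"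
      by (intro indep) auto
    then show ?thesis using True by auto
  qed
  then have "dual_bases B S" unfolding dual_bases_def using hom homS D by blast
  then show ?thesis by blast
qed

section \<open>The q-stuffle product and primitive elements\<close>

lemma coeff_letter_mult_Nil: "coeff_at (wd [a] * P) [] = 0"
  by (simp add: coeff_mult coeff_wd)

lemma coeff_letter_mult_Cons: "coeff_at (wd [a] * P) (c # w) = (if a = c then coeff_at P w else 0)"
proof -
  have "coeff_at (wd [a] * P) (c # w) =
    (\<Sum>k\<le>Suc (length w). if k = 1 then (if a = c then coeff_at P w else 0) else 0)"
    unfolding coeff_mult
  proof (intro sum.cong)
    fix k assume "k \<in> {..Suc (length w)}"
    then show "coeff_at (wd [a]) (take k (c # w)) * coeff_at P (drop k (c # w)) =
      (if k = 1 then (if a = c then coeff_at P w else 0) else 0)"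
      by (cases k; cases "k - 1"; cases w) (auto simp: coeff_wd)
  qed simp
  then show ?thesis by (simp del: sum.atMost_Suc)
qed

lemma coeff_one: "coeff_at (1 :: 'k::comm_ring_1 ncpoly) v = (if v = [] then 1 else 0)"
  by (simp add: coeff_wd eq_commute[of "[]"] flip: wd_Nil)

lemma pairing_one: "pairing 1 P = coeff_at P []"
  by (simp add: wd_Nil[symmetric] pairing_wd_left)

lemma stuffle_words_Nil_left [simp]: "stuffle_words q [] v = wd v"
  by (cases v) auto

lemma coeff_stuffle_words_Nil:
  "coeff_at (stuffle_words q u v) [] = (if u = [] \<and> v = [] then 1 else 0)"
  by (cases u; cases v)
    (auto simp: coeff_wd lookup_add lookup_scl coeff_letter_mult_Nil)

lemma coeff_stuffle_words_Cons:
  "coeff_at (stuffle_words q [] []) (c # w) = 0"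
  "coeff_at (stuffle_words q (a # u) []) (c # w) =
     (if a = c then coeff_at (stuffle_words q u []) w else 0)"
  "coeff_at (stuffle_words q [] (b # v)) (c # w) =
     (if b = c then coeff_at (stuffle_words q [] v) w else 0)"
  "coeff_at (stuffle_words q (a # u) (b # v)) (c # w) =
     (if a = c then coeff_at (stuffle_words q u (b # v)) w else 0) +
     (if b = c then coeff_at (stuffle_words q (a # u) v) w else 0) +
     (if y (index a + index b) = c then q * coeff_at (stuffle_words q u v) w else 0)"
  by (auto simp: coeff_wd lookup_add lookup_scl coeff_letter_mult_Cons)

text \<open>The coproduct dual to the stuffle product is multiplicative for concatenation.\<close>

lemma coeff_stuffle_words_append:
  "coeff_at (stuffle_words q u v) (w @ x) =
    (\<Sum>i\<le>length u. \<Sum>j\<le>length v. coeff_at (stuffle_words q (take i u) (take j v)) w *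
       coeff_at (stuffle_words q (drop i u) (drop j v)) x)"
proof (induction w arbitrary: u v)
  case Nil
  have "(\<Sum>i\<le>length u. \<Sum>j\<le>length v. coeff_at (stuffle_words q (take i u) (take j v)) [] *
       coeff_at (stuffle_words q (drop i u) (drop j v)) x) =
    (\<Sum>i\<le>length u. \<Sum>j\<le>length v. if j = 0 then if i = 0 then coeff_at (stuffle_words q u v) x else 0 else 0)"
    by (intro sum.cong) (auto simp: coeff_stuffle_words_Nil)
  then show ?case by simp
next
  case (Cons c w)
  show ?case
  proof (cases u)
    case Nil
    then show ?thesis
      by (cases v) (auto simp: coeff_stuffle_words_Cons(1,3) Cons.IH sum.atMost_Suc_shift
          simp del: stuffle_words_Nil_left stuffle_words.simps sum.atMost_Suc)
  next
    case u: (Cons a u')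
    show ?thesis
    proof (cases v)
      case Nil
      then show ?thesis
        by (auto simp: u coeff_stuffle_words_Cons(1,2) Cons.IH sum.atMost_Suc_shift
          simp del: stuffle_words_Nil_left stuffle_words.simps sum.atMost_Suc)
    next
      case v: (Cons b v')
      have if_mult: "(if P then s else 0) * t = (if P then s * t else 0)" for P and s t :: 'a by simp
      have if_sum: "(\<Sum>i\<in>A. if P then f i else 0) = (if P then sum f A else 0)"
        for P and f :: "nat \<Rightarrow> 'a" and A by simp
      show ?thesis
        unfolding u v append_Cons coeff_stuffle_words_Cons(4) Cons.IH list.size add_0_right add_Suc_right
          sum.atMost_Suc_shift take_Suc_Cons drop_Suc_Cons take_0 drop_0 coeff_stuffle_words_Cons
        by (simp del: stuffle_words_Nil_left stuffle_words.simps
            add: distrib_right sum.distrib sum_distrib_left if_mult if_sum mult.assoc)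
    qed
  qed
qed

lemma stuffle_eq_sum:
  assumes "finite K" "finite L" "supp P \<subseteq> K" "supp Q \<subseteq> L"
  shows "stuffle q P Q =
    (\<Sum>u\<in>K. \<Sum>v\<in>L. scl (coeff_at P u * coeff_at Q v) (stuffle_words q u v))"
proof -
  have "stuffle q P Q = (\<Sum>u\<in>K. \<Sum>v\<in>supp Q.
      scl (coeff_at P u * coeff_at Q v) (stuffle_words q u v))"
    unfolding stuffle_def by (rule sum.mono_neutral_left) (use assms in \<open>auto simp: in_keys_iff\<close>)
  also have "\<dots> = (\<Sum>u\<in>K. \<Sum>v\<in>L. scl (coeff_at P u * coeff_at Q v) (stuffle_words q u v))"
    by (intro sum.cong refl sum.mono_neutral_left) (use assms in \<open>auto simp: in_keys_iff\<close>)
  finally show ?thesis .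
qed

lemma stuffle_zero_left [simp]: "stuffle q 0 Q = 0" and stuffle_zero_right [simp]: "stuffle q P 0 = 0"
  by (simp_all add: stuffle_def)

lemma stuffle_add_left: "stuffle q (P + P') Q = stuffle q P Q + stuffle q P' Q"
proof -
  let ?K = "supp P \<union> supp P'"
  show ?thesis
    using keys_add[of P P']
    by (simp add: stuffle_eq_sum[of ?K "supp Q"] lookup_add distrib_right
        ncp.scale_left_distrib sum.distrib)
qed

lemma stuffle_add_right: "stuffle q P (Q + Q') = stuffle q P Q + stuffle q P Q'"
proof -
  let ?K = "supp Q \<union> supp Q'"
  show ?thesis
    using keys_add[of Q Q']
    by (simp add: stuffle_eq_sum[of "supp P" ?K] lookup_add distrib_left
        ncp.scale_left_distrib sum.distrib)
qed

lemma stuffle_scl_left: "stuffle q (scl c P) Q = scl c (stuffle q P Q)"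
  using keys_scl[of c P]
  by (simp add: stuffle_eq_sum[of "supp P" "supp Q"] lookup_scl
      ncp.scale_sum_right mult.assoc)

lemma stuffle_scl_right: "stuffle q P (scl c Q) = scl c (stuffle q P Q)"
  using keys_scl[of c Q]
  by (simp add: stuffle_eq_sum[of "supp P" "supp Q"] lookup_scl
      ncp.scale_sum_right mult.left_commute)

lemma stuffle_sum_left: "stuffle q (sum f A) Q = (\<Sum>i\<in>A. stuffle q (f i) Q)"
  by (induction A rule: infinite_finite_induct) (auto simp: stuffle_add_left)

lemma stuffle_sum_right: "stuffle q P (sum f A) = (\<Sum>i\<in>A. stuffle q P (f i))"
  by (induction A rule: infinite_finite_induct) (auto simp: stuffle_add_right)

lemma stuffle_wd: "stuffle q (wd u) (wd v) = stuffle_words q u v"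
proof -
  have "supp (wd w :: 'a ncpoly) \<subseteq> {w}" for w by (auto simp: in_keys_iff coeff_wd split: if_splits)
  then show ?thesis by (subst stuffle_eq_sum[of "{u}" "{v}"]) (simp_all add: coeff_wd)
qed

lemma homogeneous_stuffle_words: "weight_homogeneous (weight u + weight v) (stuffle_words q u v)"
proof (induction q u v rule: stuffle_words.induct)
  case (3 q a u b v)
  have l: "weight_homogeneous n P \<Longrightarrow> m = index c + n \<Longrightarrow> weight_homogeneous m (wd [c] * P)"
    for c m n and P :: "'a ncpoly"
    using homogeneous_mult[OF homogeneous_wd[of "[c]"], of n P] by simp
  show ?case
    unfolding stuffle_words.simps
    by (intro homogeneous_add homogeneous_scl)
      (rule l[OF 3(1)] l[OF 3(2)] l[OF 3(3)]; simp add: index_y)+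
next
  case (1 q u)
  then show ?case using homogeneous_wd[of u] by simp
next
  case (2 q v va)
  then show ?case using homogeneous_wd[of "v # va"] by simp
qed

lemma homogeneous_zero [simp]: "weight_homogeneous n 0"
  by (simp add: weight_homogeneous_def)

lemma homogeneous_sum:
  "(\<And>i. i \<in> A \<Longrightarrow> weight_homogeneous n (f i)) \<Longrightarrow> weight_homogeneous n (sum f A)"
  by (induction A rule: infinite_finite_induct) (auto intro: homogeneous_add)

lemma homogeneous_stuffle:
  assumes "weight_homogeneous m P" "weight_homogeneous n Q"
  shows "weight_homogeneous (m + n) (stuffle q P Q)"
  unfolding stuffle_def
proof (intro homogeneous_sum homogeneous_scl)
  fix u v assume "u \<in> supp P" "v \<in> supp Q"
  then show "weight_homogeneous (m + n) (stuffle_words q u v)"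
    using homogeneous_stuffle_words[of u v q] assms unfolding weight_homogeneous_def by metis
qed

lemma coeff_stuffle_Nil: "coeff_at (stuffle q P Q) [] = coeff_at P [] * coeff_at Q []"
proof (induction P rule: ncpoly_induct)
  case (word c u)
  show ?case
    by (induction Q rule: ncpoly_induct)
      (auto simp: lookup_add stuffle_add_right distrib_left stuffle_scl_left stuffle_scl_right
        stuffle_wd lookup_scl coeff_wd coeff_stuffle_words_Nil)
qed (simp_all add: lookup_add stuffle_add_left distrib_right)

lemma pairing_stuffle_words_mult:
  fixes P X :: "'k::comm_ring_1 ncpoly"
  shows "pairing (stuffle_words q u v) (P * X) =
    (\<Sum>i\<le>length u. \<Sum>j\<le>length v. pairing (stuffle_words q (take i u) (take j v)) P *
       pairing (stuffle_words q (drop i u) (drop j v)) X)"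
proof (induction P rule: ncpoly_induct)
  case (word c w)
  show ?case
  proof (induction X rule: ncpoly_induct)
    case (word d x)
    show ?case
      by (simp add: scl_mult_left scl_mult_right pairing_simps wd_mult coeff_stuffle_words_append
          sum_distrib_left ac_simps)
  qed (simp_all add: distrib_left pairing_simps sum.distrib)
qed (simp_all add: distrib_right pairing_simps sum.distrib)

text \<open>For the coproduct dual to \<open>stuffle\<close>, whose coefficients are the pairings
  with \<open>stuffle_words q u v\<close>, this says that \<open>P\<close> goes to
  \<open>P \<otimes> 1 + 1 \<otimes> P\<close>.\<close>

definition primitive :: "'k::comm_ring_1 \<Rightarrow> 'k ncpoly \<Rightarrow> bool" where
  "primitive q P \<longleftrightarrow> coeff_at P [] = 0 \<and>
     (\<forall>u v. u \<noteq> [] \<longrightarrow> v \<noteq> [] \<longrightarrow> pairing (stuffle_words q u v) P = 0)"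

text \<open>All ways to distribute a list over two complementary subsequences. They index the
  coproduct of a product of primitive elements, each factor going to the left or to the
  right.\<close>

fun splits :: "'a list \<Rightarrow> ('a list \<times> 'a list) list" where
  "splits [] = [([], [])]"
| "splits (x # xs) = map (\<lambda>(S, T). (x # S, T)) (splits xs) @ map (\<lambda>(S, T). (S, x # T)) (splits xs)"

lemma primitive_pairing:
  assumes "primitive q P"
  shows "pairing (stuffle_words q s t) P =
    (if t = [] then coeff_at P s else 0) + (if s = [] then coeff_at P t else 0)"
  using assms by (cases "s = []"; cases "t = []") (auto simp: primitive_def pairing_simps)

lemma pairing_stuffle_words_primitive_mult:
  assumes "primitive q P"
  shows "pairing (stuffle_words q u v) (P * X) =
    (\<Sum>i\<le>length u. coeff_at P (take i u) * pairing (stuffle_words q (drop i u) v) X) +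
    (\<Sum>j\<le>length v. coeff_at P (take j v) * pairing (stuffle_words q u (drop j v)) X)"
proof -
  let ?p = "\<lambda>i j. pairing (stuffle_words q (drop i u) (drop j v)) X"
  \<comment> \<open>By primitivity only the cuts with one of the two prefixes empty survive. The cut
    with both empty is counted twice, harmlessly, since \<open>coeff_at P []\<close>
    vanishes.\<close>
  have "pairing (stuffle_words q u v) (P * X) =
    (\<Sum>i\<le>length u. \<Sum>j\<le>length v. (if j = 0 then coeff_at P (take i u) * ?p i j else 0) +
       (if i = 0 then coeff_at P (take j v) * ?p i j else 0))"
    unfolding pairing_stuffle_words_mult primitive_pairing[OF assms]
    by (intro sum.cong refl) (auto simp: distrib_right)
  also have "\<dots> = (\<Sum>i\<le>length u. \<Sum>j\<le>length v. if j = 0 then coeff_at P (take i u) * ?p i j else 0) +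
    (\<Sum>j\<le>length v. \<Sum>i\<le>length u. if i = 0 then coeff_at P (take j v) * ?p i j else 0)"
    unfolding sum.distrib by (subst (3) sum.swap) (rule refl)
  finally show ?thesis by simp
qed

lemma pairing_stuffle_words_prod_list:
  assumes "\<And>P. P \<in> set Ps \<Longrightarrow> primitive q P"
  shows "pairing (stuffle_words q u v) (prod_list Ps) =
    (\<Sum>(S, T)\<leftarrow>splits Ps. coeff_at (prod_list S) u * coeff_at (prod_list T) v)"
  using assms
proof (induction Ps arbitrary: u v)
  case Nil
  then show ?case by (auto simp: wd_Nil[symmetric] pairing_wd_right coeff_stuffle_words_Nil coeff_wd)
next
  case (Cons P Ps)
  have IH: "pairing (stuffle_words q u v) (prod_list Ps) =
    (\<Sum>(S, T)\<leftarrow>splits Ps. coeff_at (prod_list S) u * coeff_at (prod_list T) v)" for u v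
    using Cons by auto
  have swap: "(\<Sum>i\<in>A. c i * (\<Sum>(S, T)\<leftarrow>xs. f i S T)) = (\<Sum>(S, T)\<leftarrow>xs. \<Sum>i\<in>A. c i * f i S T)"
    for A :: "nat set" and c :: "nat \<Rightarrow> 'a" and f :: "nat \<Rightarrow> 'a ncpoly list \<Rightarrow> 'a ncpoly list \<Rightarrow> 'a" and xs
    by (induction xs) (auto simp: distrib_left sum.distrib)
  have "pairing (stuffle_words q u v) (prod_list (P # Ps)) =
    (\<Sum>(S, T)\<leftarrow>splits Ps. coeff_at (P * prod_list S) u * coeff_at (prod_list T) v) +
    (\<Sum>(S, T)\<leftarrow>splits Ps. coeff_at (prod_list S) u * coeff_at (P * prod_list T) v)"
    using Cons.prems
    by (simp add: pairing_stuffle_words_primitive_mult IH swap)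
      (simp add: coeff_mult sum_distrib_left sum_distrib_right ac_simps)
  also have "\<dots> = (\<Sum>(S, T)\<leftarrow>splits (P # Ps). coeff_at (prod_list S) u * coeff_at (prod_list T) v)"
    by (simp add: case_prod_unfold o_def)
  finally show ?case .
qed

lemma pairing_stuffle_prod_list:
  fixes A B :: "'k::comm_ring_1 ncpoly"
  assumes "\<And>P. P \<in> set Ps \<Longrightarrow> primitive q P"
  shows "pairing (stuffle q A B) (prod_list Ps) =
    (\<Sum>(S, T)\<leftarrow>splits Ps. pairing A (prod_list S) * pairing B (prod_list T))"
proof (induction A rule: ncpoly_induct)
  case (word c u)
  show ?case
  proof (induction B rule: ncpoly_induct)
    case (word d v)
    have "pairing (stuffle q (wd u) (wd v)) (prod_list Ps) =
        (\<Sum>p\<leftarrow>splits Ps. coeff_at (prod_list (fst p)) u * coeff_at (prod_list (snd p)) v)"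
      using pairing_stuffle_words_prod_list[OF assms] by (simp add: stuffle_wd case_prod_unfold)
    then show ?case
      by (simp add: stuffle_scl_left stuffle_scl_right pairing_scl_left pairing_wd_left case_prod_unfold
          mult.assoc mult.left_commute[of _ d] flip: sum_list_const_mult)
  qed (simp_all add: stuffle_add_right pairing_add_left distrib_left case_prod_unfold sum_list_addf)
qed (simp_all add: stuffle_add_left pairing_add_left distrib_right case_prod_unfold sum_list_addf)

lemma primitive_zero: "primitive q 0"
  by (simp add: primitive_def)

lemma primitive_add: "primitive q P \<Longrightarrow> primitive q Q \<Longrightarrow> primitive q (P + Q)"
  by (simp add: primitive_def lookup_add pairing_simps)

lemma primitive_scl: "primitive q P \<Longrightarrow> primitive q (scl c P)"
  by (simp add: primitive_def lookup_scl pairing_simps)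

text \<open>The coproducts of \<open>P * Q\<close> and \<open>Q * P\<close> have the same mixed
  part, \<open>P \<otimes> Q + Q \<otimes> P\<close>, which cancels in the commutator.\<close>

lemma primitive_bracket:
  assumes "primitive q P" "primitive q Q"
  shows "primitive q (P * Q - Q * P)"
  unfolding primitive_def
proof (intro conjI allI impI)
  show "coeff_at (P * Q - Q * P) [] = 0"
    by (simp add: lookup_minus coeff_mult mult.commute)
  have prim: "R \<in> set [P, Q] \<Longrightarrow> primitive q R" "R \<in> set [Q, P] \<Longrightarrow> primitive q R" for R
    using assms by auto
  fix u v :: word assume "u \<noteq> []" "v \<noteq> []"
  then show "pairing (stuffle_words q u v) (P * Q - Q * P) = 0"
    using pairing_stuffle_words_prod_list[where Ps = "[P, Q]" and u = u and v = v, OF prim(1)]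
      pairing_stuffle_words_prod_list[where Ps = "[Q, P]" and u = u and v = v, OF prim(2)]
    by (auto simp: pairing_simps coeff_one mult.commute add.commute)
qed

lemma primitive_pairing_stuffle:
  assumes "primitive q P" "coeff_at A [] = 0" "coeff_at B [] = 0"
  shows "pairing (stuffle q A B) P = 0"
  using pairing_stuffle_prod_list[of "[P]" q A B] assms
  by (simp add: coeff_one pairing_commute[of _ 1] pairing_one)

subsection \<open>Primitivity of the letters' images\<close>

text \<open>
  If a functional takes the value \<open>h n\<close> on every word of length \<open>n\<close>, then \<open>stuffle_sum h r s\<close> is
  its value at the stuffle product, for \<open>q = 1\<close>, of two words of lengths \<open>r\<close> and \<open>s\<close>.
\<close>

fun stuffle_sum :: "(nat \<Rightarrow> 'a::ab_semigroup_add) \<Rightarrow> nat \<Rightarrow> nat \<Rightarrow> 'a" where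
  "stuffle_sum h r 0 = h r"
| "stuffle_sum h 0 s = h s"
| "stuffle_sum h (Suc r) (Suc s) =
     stuffle_sum (h \<circ> Suc) r (Suc s) + stuffle_sum (h \<circ> Suc) (Suc r) s + stuffle_sum (h \<circ> Suc) r s"

lemma stuffle_sum_0_left [simp]: "stuffle_sum h 0 s = h s"
  by (cases s) auto

lemma stuffle_sum_hom:
  assumes "\<And>x z. f (x + z) = f x + f z"
  shows "f (stuffle_sum h r s) = stuffle_sum (f \<circ> h) r s"
  by (induction h r s rule: stuffle_sum.induct)
    (simp_all add: assms, simp_all add: o_def)

lemma stuffle_sum_add:
  "stuffle_sum (\<lambda>n. h n + g n) r s = stuffle_sum h r s + stuffle_sum g r s"
proof (induction h r s arbitrary: g rule: stuffle_sum.induct)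
  case (3 h r s)
  from 3[of "g \<circ> Suc"] show ?case by (simp add: o_def ac_simps)
qed simp_all

lemma stuffle_sum_zero: "stuffle_sum (\<lambda>_. 0 :: 'a::comm_monoid_add) r s = 0"
proof -
  have "h = (\<lambda>_. 0) \<Longrightarrow> stuffle_sum h r s = 0" for h :: "nat \<Rightarrow> 'a"
    by (induction h r s rule: stuffle_sum.induct) (auto simp: o_def)
  then show ?thesis by blast
qed

text \<open>An \<open>r\<close>-subset and an \<open>s\<close>-subset of an \<open>m\<close>-set
  amount to their union with a label on each element: first only, second only, or both. Read in
  order, the labels are the three kinds of steps in the recursion. The induction on \<open>m\<close>
  uses Pascal's rule to split the shifted sequence.\<close>

lemma stuffle_sum_binomial: "stuffle_sum ((choose) m) r s = (m choose r) * (m choose s)"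
proof (induction m arbitrary: r s)
  case 0
  have "(choose) 0 \<circ> Suc = (\<lambda>_. 0)" by auto
  then show ?case by (cases r; cases s) (simp_all add: stuffle_sum_zero)
next
  case (Suc m)
  have Pascal: "(choose) (Suc m) \<circ> Suc = (\<lambda>n. (m choose n) + ((choose) m \<circ> Suc) n)" by auto
  show ?case
  proof (cases r; cases s)
    fix r' s' assume rs: "r = Suc r'" "s = Suc s'"
    have "stuffle_sum ((choose) (Suc m)) r s =
      (stuffle_sum ((choose) m) r' (Suc s') + stuffle_sum ((choose) m) (Suc r') s' +
       stuffle_sum ((choose) m) r' s') + stuffle_sum ((choose) m) (Suc r') (Suc s')"
      by (simp only: rs stuffle_sum.simps(3) Pascal stuffle_sum_add ac_simps)
    also have "\<dots> = (Suc m choose r) * (Suc m choose s)"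
      unfolding Suc rs by (simp add: algebra_simps)
    finally show ?case .
  qed simp_all
qed

primrec binom_poly :: "nat \<Rightarrow> rat poly" where
  "binom_poly 0 = 1"
| "binom_poly (Suc n) = smult (1 / of_nat (Suc n)) ([:- of_nat n, 1:] * binom_poly n)"

lemma poly_binom_poly: "poly (binom_poly n) (of_nat m) = of_nat (m choose n)"
proof -
  have "poly (binom_poly n) x = (x gchoose n)" for x
  proof (induction n)
    case (Suc n)
    have "(x gchoose Suc n) = (x - of_nat n) / of_nat (Suc n) * (x gchoose n)"
      by (simp add: gbinomial_prod_rev field_simps del: of_nat_Suc)
    then show ?case using Suc by (simp add: field_simps)
  qed simp
  then show ?thesis by (simp add: binomial_gbinomial)
qed

text \<open>Both sides agree at every natural number by the previous count, and rational polynomials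
  that agree at infinitely many points coincide.\<close>

lemma stuffle_sum_binom_poly: "stuffle_sum binom_poly r s = binom_poly r * binom_poly s"
proof (rule ccontr)
  let ?p = "stuffle_sum binom_poly r s - binom_poly r * binom_poly s"
  assume "\<not> ?thesis"
  then have "finite {x. poly ?p x = 0}" by (intro poly_roots_finite) simp
  moreover have "range of_nat \<subseteq> {x. poly ?p x = 0}"
  proof safe
    fix m :: nat
    have "poly (stuffle_sum binom_poly r s) (of_nat m) =
        stuffle_sum ((\<lambda>p. poly p (of_nat m)) \<circ> binom_poly) r s"
      by (rule stuffle_sum_hom) simp
    also have "\<dots> = stuffle_sum (of_nat \<circ> (choose) m) r s"
      by (simp add: o_def poly_binom_poly)
    also have "\<dots> = of_nat ((m choose r) * (m choose s))"
      by (subst stuffle_sum_hom[symmetric]) (simp_all add: stuffle_sum_binomial)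
    finally show "poly ?p (of_nat m) = 0" by (simp add: poly_binom_poly)
  qed
  ultimately have "finite (range (of_nat :: nat \<Rightarrow> rat))" by (rule rev_finite_subset)
  then show False using finite_imageD[of "of_nat :: nat \<Rightarrow> rat" UNIV] by (simp add: inj_def)
qed

definition log_coeff :: "nat \<Rightarrow> rat" where
  "log_coeff n = (if n = 0 then 0 else (- 1) ^ (n - 1) / of_nat n)"

lemma coeff_binom_poly:
  "poly.coeff (binom_poly (Suc n)) 0 = 0" "poly.coeff (binom_poly n) (Suc 0) = log_coeff n"
proof -
  have 0: "poly.coeff (binom_poly (Suc n)) 0 = 0" for n
    by (induction n) auto
  then show "poly.coeff (binom_poly (Suc n)) 0 = 0" .
  have "poly.coeff (binom_poly (Suc n)) (Suc 0) = log_coeff (Suc n)" for n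
  proof (induction n)
    case (Suc n)
    have "poly.coeff (binom_poly (Suc (Suc n))) (Suc 0) =
      - of_nat (Suc n) / of_nat (Suc (Suc n)) * poly.coeff (binom_poly (Suc n)) (Suc 0)"
      using 0[of n] unfolding binom_poly.simps(2)[of "Suc n"]
      by (simp del: binom_poly.simps of_nat_Suc)
    then show ?case unfolding Suc by (simp add: log_coeff_def del: of_nat_Suc)
  qed (simp add: log_coeff_def)
  then show "poly.coeff (binom_poly n) (Suc 0) = log_coeff n"
    by (cases n) (simp_all add: log_coeff_def del: binom_poly.simps(2))
qed

text \<open>\<open>log_coeff n\<close>, the coefficient of \<open>t^n\<close> in
  \<open>log (1 + t)\<close>, is the linear coefficient of \<open>binom_poly n\<close>. The product
  of two polynomials without constant term has no linear coefficient.\<close>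

lemma stuffle_sum_log_coeff: "stuffle_sum log_coeff (Suc r) (Suc s) = 0"
proof -
  have "stuffle_sum log_coeff (Suc r) (Suc s) = stuffle_sum ((\<lambda>p. poly.coeff p (Suc 0)) \<circ> binom_poly) (Suc r) (Suc s)"
    by (simp only: o_def coeff_binom_poly)
  also have "\<dots> = poly.coeff (binom_poly (Suc r) * binom_poly (Suc s)) (Suc 0)"
    by (subst stuffle_sum_hom[symmetric]) (simp_all only: coeff_add stuffle_sum_binom_poly)
  also have "\<dots> = 0"
    unfolding Polynomial.coeff_mult by (simp add: coeff_binom_poly del: binom_poly.simps)
  finally show ?thesis .
qed

lemma extend_linear_letter_mult: "extend_linear g (wd [a] * P) = extend_linear (\<lambda>w. g (a # w)) P"
  by (induction P rule: ncpoly_induct)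
    (simp_all add: extend_linear_add extend_linear_scl extend_linear_wd distrib_left
      scl_mult_right wd_mult, simp add: extend_linear_def)

lemma extend_linear_cong:
  "(\<And>w. coeff_at P w \<noteq> 0 \<Longrightarrow> g w = h w) \<Longrightarrow> extend_linear g P = extend_linear h P"
  unfolding extend_linear_def by (intro sum.cong) (auto simp: in_keys_iff)

text \<open>Every contraction of two letters loses one letter and contributes one factor
  \<open>q\<close>. With \<open>q ^ length w\<close> put into the functional, all terms carry the
  same total power, and only the count for \<open>q = 1\<close> remains. The offset \<open>e\<close>
  absorbs letters already removed.\<close>

lemma extend_linear_stuffle_words:
  fixes q :: "'k::rat_comm_algebra_1"
  shows "extend_linear (\<lambda>w. of_Q (G (length w)) * q ^ (e + length w)) (stuffle_words q u v) =
    of_Q (stuffle_sum G (length u) (length v)) * q ^ (e + length u + length v)"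
proof (induction q u v arbitrary: G e rule: stuffle_words.induct)
  case (3 q a u b v)
  have IH: "extend_linear (\<lambda>w. of_Q (G (length (c # w))) * q ^ (e + length (c # w))) (stuffle_words q u' v') =
    of_Q (stuffle_sum (G \<circ> Suc) (length u') (length v')) * q ^ (Suc e + length u' + length v')"
    if "\<And>G e. extend_linear (\<lambda>w. of_Q (G (length w)) * q ^ (e + length w)) (stuffle_words q u' v') =
      of_Q (stuffle_sum G (length u') (length v')) * q ^ (e + length u' + length v')" for u' v' c
    using that[of "G \<circ> Suc" "Suc e"] by simp
  show ?case
    unfolding stuffle_words.simps extend_linear_add extend_linear_scl extend_linear_letter_mult
      IH[OF 3(1)] IH[OF 3(2)] IH[OF 3(3)]
    by (simp add: of_Q_add algebra_simps)
qed (simp_all add: extend_linear_wd)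

lemma coeff_stuffle_list_Nil:
  "[] \<notin> set us \<Longrightarrow> coeff_at (stuffle_list q (map wd us)) [] = (if us = [] then 1 else 0)"
  by (cases us) (auto simp: stuffle_list_def coeff_stuffle_Nil coeff_wd)

text \<open>A single letter arises from \<open>u\<close> alone or by contracting the letter
  \<open>u\<close> with a letter of \<open>R\<close>; the condition
  \<open>weight u < index a\<close> keeps the remaining index positive, as \<open>y\<close>
  requires.\<close>

lemma coeff_stuffle_wd_letter:
  assumes "u \<noteq> []"
  shows "coeff_at (stuffle q (wd u) R) [a] =
    (if u = [a] then coeff_at R [] else 0) +
    (if length u = 1 \<and> weight u < index a then q * coeff_at R [y (index a - weight u)] else 0)"
proof (induction R rule: ncpoly_induct)
  case (word c v)
  obtain b u' where u: "u = b # u'" using assms by (cases u) auto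
  have "coeff_at (stuffle_words q u v) [a] = (if u = [a] then coeff_at (wd v) [] else 0) +
    (if length u = 1 \<and> weight u < index a then q * coeff_at (wd v) [y (index a - weight u)] else 0)"
  proof (cases v)
    case Nil
    then show ?thesis by (auto simp: u coeff_wd)
  next
    case (Cons d v')
    have "y (index b + index d) = a \<longleftrightarrow> index b < index a \<and> d = y (index a - index b)"
      by (metis add_diff_cancel_left' add_diff_inverse_nat add_gr_0 index_pos index_y less_add_same_cancel1
          less_imp_not_less y_index)
    then show ?thesis
      by (auto simp: u Cons coeff_stuffle_words_Cons coeff_stuffle_words_Nil coeff_wd
          simp del: stuffle_words.simps)
  qed
  then show ?case
    by (simp add: stuffle_scl_right stuffle_wd lookup_scl algebra_simps)
qed (auto simp: stuffle_add_right lookup_add algebra_simps)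

text \<open>For nonempty factors to leave a single letter, each of them must be a letter and all
  must be contracted together, which takes \<open>length us - 1\<close> contractions.\<close>

lemma coeff_stuffle_list_letter:
  "[] \<notin> set us \<Longrightarrow> coeff_at (stuffle_list q (map wd us)) [a] =
    (if us \<noteq> [] \<and> (\<forall>u\<in>set us. length u = 1) \<and> weight (concat us) = index a
     then q ^ (length us - 1) else 0)"
proof (induction us arbitrary: a)
  case Nil
  then show ?case by (simp add: stuffle_list_def coeff_wd)
next
  case (Cons u us)
  have "u \<noteq> []" "[] \<notin> set us" using Cons.prems by auto
  have wpos: "0 < weight (concat us)" if "us \<noteq> []"
    using that \<open>[] \<notin> set us\<close> by (cases us; cases "hd us") auto
  have s: "stuffle_list q (map wd (u # us)) = stuffle q (wd u) (stuffle_list q (map wd us))"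
    by (simp add: stuffle_list_def)
  have u1: "u = [a] \<longleftrightarrow> length u = 1 \<and> weight u = index a"
    by (auto simp: length_Suc_conv index_inject)
  show ?case
    unfolding s coeff_stuffle_wd_letter[OF \<open>u \<noteq> []\<close>] Cons.IH[OF \<open>[] \<notin> set us\<close>]
      coeff_stuffle_list_Nil[OF \<open>[] \<notin> set us\<close>] u1
    using wpos by (cases us) (auto simp: index_y power_Suc[symmetric] simp del: power_Suc)
qed

lemma inner_sum_pi1_letter:
  fixes q :: "'k::comm_ring_1"
  assumes "1 \<le> k"
  shows "Sum_any (\<lambda>us. scl (coeff_at (stuffle_list q (map wd us)) [a]) (wd (concat us))
      when length us = k \<and> [] \<notin> set us) =
    (\<Sum>v\<in>{v\<in>words_of_weight (index a). length v = k}. scl (q ^ (k - 1)) (wd v))"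
proof -
  let ?f = "\<lambda>us. scl (coeff_at (stuffle_list q (map wd us)) [a]) (wd (concat us))
      when length us = k \<and> [] \<notin> set us"
  let ?W = "{v\<in>words_of_weight (index a). length v = k}"
  let ?g = "map (\<lambda>b. [b]) :: word \<Rightarrow> word list"
  have cc: "concat (?g v) = v" for v by (induction v) auto
  have inj: "inj_on ?g ?W" by (rule inj_onI) (metis cc)
  have f: "?f (?g v) = scl (q ^ (k - 1)) (wd v)" if "v \<in> ?W" for v
  proof -
    have "[] \<notin> set (?g v)" by auto
    then show ?thesis
      unfolding coeff_stuffle_list_letter[OF \<open>[] \<notin> set (?g v)\<close>] cc using that assms by (auto simp: when_def)
  qed
  have supp: "us \<in> ?g ` ?W" if "?f us \<noteq> 0" for us
  proof -
    have us: "length us = k" "[] \<notin> set us" "coeff_at (stuffle_list q (map wd us)) [a] \<noteq> 0"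
      using that by (auto simp: when_def split: if_splits)
    then have "\<forall>u\<in>set us. length u = 1" "weight (concat us) = index a"
      by (auto simp: coeff_stuffle_list_letter split: if_splits)
    moreover from this(1) have "us = ?g (concat us)"
      by (induction us) (auto simp: length_Suc_conv)
    moreover from this have "length us = length (concat us)" by (metis length_map)
    ultimately show ?thesis using us(1) by (intro image_eqI[of _ _ "concat us"]) auto
  qed
  have "Sum_any ?f = sum ?f (?g ` ?W)"
  proof (rule Sum_any.expand_superset)
    show "finite (?g ` ?W)" by (intro finite_imageI finite_Collect_conjI) (simp add: words_of_weight_def[symmetric])
    show "{us. ?f us \<noteq> 0} \<subseteq> ?g ` ?W" using supp by blast
  qed
  also have "\<dots> = (\<Sum>v\<in>?W. scl (q ^ (k - 1)) (wd v))"
    by (subst sum.reindex[OF inj]) (intro sum.cong, auto simp only: o_apply f)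
  finally show ?thesis .
qed

text \<open>The inner sum in \<open>pi1\<close> collapses to words of length \<open>k\<close> cut
  into letters, so the index of the logarithm becomes the word length.\<close>

lemma coeff_pi1_letter:
  fixes q :: "'k::rat_comm_algebra_1"
  shows "coeff_at (pi1 q [a]) v =
    (if weight v = index a then of_Q (log_coeff (length v)) * q ^ (length v - 1) else 0)"
proof -
  define h where "h k = (\<Sum>v\<in>{v\<in>words_of_weight (index a). length v = k}. scl (q ^ (k - 1)) (wd v))"
    for k
  have h0: "h k = 0" if "k > index a" for k
  proof -
    have "length v \<noteq> k" if "v \<in> words_of_weight (index a)" for v
      using \<open>k > index a\<close> that length_le_weight[of v] by auto
    then have "{v\<in>words_of_weight (index a). length v = k} = {}" by blast
    then show ?thesis unfolding h_def by (simp only: sum.empty)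
  qed
  have fin: "finite {v. weight v = index a \<and> length v = k}" for k
    by (rule finite_subset[OF _ finite_words_of_weight[of "index a"]]) auto
  have ch: "coeff_at (h k) v = (if weight v = index a \<and> length v = k then q ^ (k - 1) else 0)" for k
    using fin by (auto simp: h_def lookup_sum lookup_scl coeff_wd if_distrib cong: if_cong)
  have "pi1 q [a] = wd [a] + Sum_any (\<lambda>k. scl (of_Q ((- 1) ^ (k - 1) / of_nat k)) (h k) when 2 \<le> k)"
    unfolding pi1_def h_def
    by (intro arg_cong2[where f = "(+)"] arg_cong[where f = Sum_any] refl ext when_cong
        arg_cong2[where f = scl] inner_sum_pi1_letter) auto
  also have "Sum_any (\<lambda>k. scl (of_Q ((- 1) ^ (k - 1) / of_nat k)) (h k) when 2 \<le> k) =
    (\<Sum>k\<in>{2..index a}. scl (of_Q ((- 1) ^ (k - 1) / of_nat k)) (h k) when 2 \<le> k)"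
  proof (rule Sum_any.expand_superset)
    have "k \<in> {2..index a}" if "(scl (of_Q ((- 1) ^ (k - 1) / of_nat k)) (h k) when 2 \<le> k) \<noteq> 0" for k
      using that h0[of k] by (cases "2 \<le> k"; cases "index a < k") auto
    then show "{k. (scl (of_Q ((- 1) ^ (k - 1) / of_nat k)) (h k) when 2 \<le> k) \<noteq> 0} \<subseteq> {2..index a}"
      by blast
  qed simp
  also have "\<dots> = (\<Sum>k\<in>{2..index a}. scl (of_Q ((- 1) ^ (k - 1) / of_nat k)) (h k))"
    by (intro sum.cong) auto
  finally have "coeff_at (pi1 q [a]) v = coeff_at (wd [a]) v +
    (\<Sum>k\<in>{2..index a}. of_Q ((- 1) ^ (k - 1) / of_nat k) * coeff_at (h k) v)"
    by (simp add: lookup_add lookup_sum lookup_scl)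
  also have "\<dots> = coeff_at (wd [a]) v + (\<Sum>k\<in>{2..index a}. if k = length v then
      (if weight v = index a then of_Q (log_coeff (length v)) * q ^ (length v - 1) else 0) else 0)"
    by (intro arg_cong2[where f = "(+)"] refl sum.cong) (auto simp: ch log_coeff_def)
  also have "\<dots> = (if weight v = index a then of_Q (log_coeff (length v)) * q ^ (length v - 1) else 0)"
  proof (cases "length v" rule: linorder_cases[of _ 1])
    case less
    then show ?thesis by (auto simp: coeff_wd log_coeff_def)
  next
    case equal
    then show ?thesis by (auto simp: coeff_wd log_coeff_def length_Suc_conv index_inject)
  next
    case greater
    then show ?thesis using length_le_weight[of v] by (auto simp: coeff_wd)
  qed
  finally show ?thesis .
qed

lemma primitive_pi1_letter:
  fixes q :: "'k::rat_comm_algebra_1"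
  shows "primitive q (pi1 q [a])"
  unfolding primitive_def
proof (intro conjI allI impI)
  show "coeff_at (pi1 q [a]) [] = 0" by (simp add: coeff_pi1_letter log_coeff_def)
  fix u v :: word assume "u \<noteq> []" "v \<noteq> []"
  then obtain b u' c v' where uv: "u = b # u'" "v = c # v'" by (metis neq_Nil_conv)
  let ?g = "\<lambda>w. of_Q (log_coeff (length w)) * q ^ (length w - 1)"
  have "pairing (stuffle_words q u v) (pi1 q [a]) =
      extend_linear (coeff_at (pi1 q [a])) (stuffle_words q u v)"
    by (rule pairing_eq_extend_linear)
  also have "\<dots> = (if weight u + weight v = index a then extend_linear ?g (stuffle_words q u v) else 0)"
  proof (cases "weight u + weight v = index a")
    case True
    then show ?thesis using homogeneousD[OF homogeneous_stuffle_words, of q u v]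
      by (auto simp: coeff_pi1_letter intro!: extend_linear_cong)
  next
    case False
    then have "extend_linear (coeff_at (pi1 q [a])) (stuffle_words q u v) =
        extend_linear (\<lambda>w. 0) (stuffle_words q u v)"
      using homogeneousD[OF homogeneous_stuffle_words, of q u v]
      by (auto simp: coeff_pi1_letter intro!: extend_linear_cong)
    then show ?thesis using False by (simp add: extend_linear_def)
  qed
  also have "extend_linear ?g (stuffle_words q u v) = 0"
  proof -
    \<comment> \<open>The exponent \<open>length w - 1\<close> is truncated at the empty word, so
      the general lemma is applied after splitting off the leading letter, where the exponent is the
      length of the tail.\<close>
    have L: "extend_linear (\<lambda>w. ?g (d # w)) (stuffle_words q s t) =
      of_Q (stuffle_sum (log_coeff \<circ> Suc) (length s) (length t)) * q ^ (length s + length t)" for s t d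
      using extend_linear_stuffle_words[of "log_coeff \<circ> Suc" q 0 s t] by simp
    have "extend_linear ?g (stuffle_words q u v) =
        of_Q (stuffle_sum log_coeff (length u) (length v)) * q ^ (length u' + length v' + 1)"
      unfolding uv stuffle_words.simps extend_linear_add extend_linear_scl extend_linear_letter_mult L
      by (simp add: of_Q_add algebra_simps)
    then show ?thesis by (simp only: uv list.size add_0_right add_Suc_right stuffle_sum_log_coeff) simp
  qed
  finally show "pairing (stuffle_words q u v) (pi1 q [a]) = 0" by simp
qed

section \<open>The bases \<open>\<Pi>\<close> and \<open>\<Sigma>\<close>\<close>

lemma Pi_lyndon_letter: "Pi_lyndon q [a] = pi1 q [a]"
  by (simp add: Pi_lyndon.simps)

lemma lyndon_induct [consumes 1, case_names letter split]:
  assumes "lyndon l" "\<And>a. P [a]"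
    "\<And>l s r. lyndon l \<Longrightarrow> 2 \<le> length l \<Longrightarrow> s = take (std_split l) l \<Longrightarrow> r = drop (std_split l) l \<Longrightarrow>
      lyndon s \<Longrightarrow> lyndon r \<Longrightarrow> s < r \<Longrightarrow> l = s @ r \<Longrightarrow> P s \<Longrightarrow> P r \<Longrightarrow> P l"
  shows "P l"
  using assms(1)
proof (induction "length l" arbitrary: l rule: less_induct)
  case less
  show ?case
  proof (cases "length l < 2")
    case True
    then have "length l = 1" using lyndon_not_Nil[OF less.prems] by (cases l) auto
    then obtain a where "l = [a]" by (auto simp: length_Suc_conv)
    then show ?thesis using assms(2) by simp
  next
    case False
    then have len: "2 \<le> length l" by simp
    show ?thesis
      using std_split_bounds[OF len] lyndon_std_left[OF less.prems len] lyndon_std_right[OF less.prems len]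
        std_less[OF less.prems len] less.prems len
      by (intro assms(3)[OF less.prems len refl refl]) (auto intro!: less.hyps)
  qed
qed

lemma Pi_lyndon_split:
  assumes "2 \<le> length l" "s = take (std_split l) l" "r = drop (std_split l) l"
  shows "Pi_lyndon q l = Pi_lyndon q s * Pi_lyndon q r - Pi_lyndon q r * Pi_lyndon q s"
  using assms by (subst Pi_lyndon.simps) simp

lemma primitive_Pi_lyndon: "lyndon l \<Longrightarrow> primitive q (Pi_lyndon q l)"
proof (induction l rule: lyndon_induct)
  case (letter a)
  show ?case by (simp add: Pi_lyndon_letter primitive_pi1_letter)
next
  case (split l s r)
  show ?case
    unfolding Pi_lyndon_split[OF split.hyps(2,3,4)] by (intro primitive_bracket split.IH)
qed

lemma prod_list_powers: "prod_list (map (\<lambda>(l, i). f l ^ i) fs) = prod_list (map f (expand fs))"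
  by (induction fs) (auto simp: prod_list_replicate)

lemma Pi_word_eq: "Pi_word q w = prod_list (map (Pi_lyndon q) (fac w))"
  by (simp add: Pi_word_def prod_list_powers expand_lyndon_factorization)

lemma Pi_word_concat: "declyn ls \<Longrightarrow> Pi_word q (concat ls) = prod_list (map (Pi_lyndon q) ls)"
  by (simp add: Pi_word_eq fac_concat)

lemma Pi_word_lyndon: "lyndon l \<Longrightarrow> Pi_word q l = Pi_lyndon q l"
  by (simp add: Pi_word_eq fac_lyndon)

section \<open>Unitriangularity of Pi over words\<close>

definition upper :: "word \<Rightarrow> 'k::comm_ring_1 ncpoly \<Rightarrow> bool" where
  "upper w P \<longleftrightarrow> weight_homogeneous (weight w) P \<and> coeff_at P w = 1 \<and>
     (\<forall>v. coeff_at P v \<noteq> 0 \<longrightarrow> w \<le> v)"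

lemma upperD:
  "upper w P \<Longrightarrow> weight_homogeneous (weight w) P" "upper w P \<Longrightarrow> coeff_at P w = 1"
  "upper w P \<Longrightarrow> coeff_at P v \<noteq> 0 \<Longrightarrow> w \<le> v"
  by (auto simp: upper_def)

lemma less_append_of_weight:
  assumes "u < v" "weight u = weight v"
  shows "u @ x < v @ z"
proof (rule less_append_of_not_prefix[OF assms(1)])
  fix z show "v \<noteq> u @ z"
    using assms by (cases z) auto
qed

text \<open>Weights locate the cut: only cutting \<open>u @ v\<close> after \<open>u\<close> leaves
  a prefix of the weight of \<open>u\<close>. For the order, words of equal weight are never proper
  prefixes of each other, so a strict inequality between the first factors persists whatever
  follows.\<close>

lemma upper_mult:
  assumes P: "upper u P" and Q: "upper v Q"
  shows "upper (u @ v) (P * Q)"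
  unfolding upper_def
proof (intro conjI allI impI)
  show "weight_homogeneous (weight (u @ v)) (P * Q)"
    using homogeneous_mult[OF upperD(1)[OF P] upperD(1)[OF Q]] by simp
  show "coeff_at (P * Q) (u @ v) = 1"
  proof -
    have "coeff_at (P * Q) (u @ v) =
        (\<Sum>k\<le>length (u @ v). if k = length u then 1 else 0)"
      unfolding coeff_mult
    proof (intro sum.cong refl)
      fix k assume k: "k \<in> {..length (u @ v)}"
      show "coeff_at P (take k (u @ v)) * coeff_at Q (drop k (u @ v)) = (if k = length u then 1 else 0)"
      proof (cases "k = length u")
        case True
        then show ?thesis using upperD(2)[OF P] upperD(2)[OF Q] by simp
      next
        case False
        have "weight (take k (u @ v)) \<noteq> weight u"
        proof (cases "k < length u")
          case True
          then have "u = take k u @ drop k u" "drop k u \<noteq> []" by auto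
          then show ?thesis using True weight_append[of "take k u" "drop k u"] by auto
        next
          case ge: False
          then have "take (k - length u) v \<noteq> []" using False k by auto
          then show ?thesis using ge by auto
        qed
        then show ?thesis using homogeneous_coeff_0[OF upperD(1)[OF P]] False by simp
      qed
    qed
    then show ?thesis by (simp del: length_append) simp
  qed
  fix x assume "coeff_at (P * Q) x \<noteq> 0"
  then obtain k where "coeff_at P (take k x) * coeff_at Q (drop k x) \<noteq> 0"
    unfolding coeff_mult by (meson sum.neutral)
  then have nz: "coeff_at P (take k x) \<noteq> 0" "coeff_at Q (drop k x) \<noteq> 0" by auto
  have "u \<le> take k x" "v \<le> drop k x" "weight (take k x) = weight u"
    using upperD(3)[OF P] upperD(3)[OF Q] homogeneousD[OF upperD(1)[OF P]] nz by auto
  then have "u @ v \<le> take k x @ drop k x"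
    by (metis le_append_left less_append_of_weight order.order_iff_strict)
  then show "u @ v \<le> x" by simp
qed

text \<open>Since \<open>s @ r < r @ s\<close>, the second product lives strictly above
  \<open>s @ r\<close> and leaves the leading term of the first untouched.\<close>

lemma upper_bracket:
  assumes "upper s P" "upper r Q" "s @ r < r @ s"
  shows "upper (s @ r) (P * Q - Q * P)"
proof -
  have u: "upper (s @ r) (P * Q)" "upper (r @ s) (Q * P)"
    using assms by (auto intro: upper_mult)
  have "weight_homogeneous (weight (s @ r)) (Q * P)"
    using upperD(1)[OF u(2)] by (simp add: add.commute)
  moreover have "coeff_at (Q * P) (s @ r) = 0"
    using upperD(3)[OF u(2), of "s @ r"] assms(3) by (auto simp: not_le[symmetric])
  moreover have "s @ r \<le> v" if "coeff_at (P * Q - Q * P) v \<noteq> 0" for v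
  proof -
    have "coeff_at (P * Q) v \<noteq> 0 \<or> coeff_at (Q * P) v \<noteq> 0" using that by (auto simp: lookup_minus)
    then show ?thesis using upperD(3)[OF u(1)] upperD(3)[OF u(2)] assms(3)
      by (meson less_imp_le order_trans)
  qed
  ultimately show ?thesis
    using u(1) unfolding upper_def by (auto simp: homogeneous_minus lookup_minus)
qed

text \<open>Any other word of weight \<open>index a\<close> begins with a letter of smaller index,
  which is a larger letter of the alphabet.\<close>

lemma upper_pi1_letter: "upper [a] (pi1 q [a])"
  unfolding upper_def
proof (intro conjI allI impI)
  show "weight_homogeneous (weight [a]) (pi1 q [a])"
    by (rule homogeneousI) (simp add: coeff_pi1_letter split: if_splits)
  show "coeff_at (pi1 q [a]) [a] = 1" by (simp add: coeff_pi1_letter log_coeff_def)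
  fix v assume "coeff_at (pi1 q [a]) v \<noteq> 0"
  then have w: "weight v = index a" by (auto simp: coeff_pi1_letter split: if_splits)
  then obtain b v' where v: "v = b # v'" by (cases v) auto
  show "[a] \<le> v"
  proof (cases v')
    case Nil
    then show ?thesis using w v by (simp add: index_inject)
  next
    case (Cons c v'')
    then have "index b < index a" using w v index_pos[of c] by (simp del: index_pos)
    then show ?thesis using v by (simp add: less_letter_def)
  qed
qed

lemma upper_Pi_lyndon: "lyndon l \<Longrightarrow> upper l (Pi_lyndon q l)"
proof (induction l rule: lyndon_induct)
  case (letter a)
  show ?case by (simp add: Pi_lyndon_letter upper_pi1_letter)
next
  case (split l s r)
  have "lyndon (s @ r)" using split.hyps(1) unfolding split.hyps(8) .
  then have "s @ r < r" using lyndon_suffix[of s r] split.hyps(5,6) lyndon_not_Nil by blast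
  also have "r \<le> r @ s" by (rule prefix_le)
  finally have "upper (s @ r) (Pi_lyndon q s * Pi_lyndon q r - Pi_lyndon q r * Pi_lyndon q s)"
    by (intro upper_bracket split.IH)
  then show ?case unfolding Pi_lyndon_split[OF split.hyps(2,3,4)] split.hyps(8)[symmetric] .
qed

lemma upper_Pi_word: "upper w (Pi_word q w)"
proof -
  have "upper (concat ls) (prod_list (map (Pi_lyndon q) ls))" if "\<forall>l\<in>set ls. lyndon l" for ls
    using that
  proof (induction ls)
    case Nil
    then show ?case by (auto simp: upper_def coeff_one intro!: homogeneousI split: if_splits)
  qed (auto intro: upper_mult upper_Pi_lyndon)
  from this[of "fac w"] show ?thesis by (simp add: Pi_word_eq lyndon_of_mem_fac)
qed

lemma dual_bases_of_upper: "(\<And>w. upper w (B w)) \<Longrightarrow> \<exists>S. dual_bases B S"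
  by (rule dual_bases_of_triangular[where R = "(>)"])
    (auto simp: upper_def transp_def irreflp_def order.order_iff_strict)

lemma dual_bases_Pi_Sigma: "dual_bases (Pi_word q) (Sigma_word q)"
proof -
  from dual_bases_of_upper[OF upper_Pi_word[of _ q]] obtain S where S: "dual_bases (Pi_word q) S" ..
  then show ?thesis unfolding Sigma_word_def dual_family_eq[OF S] .
qed

lemmas pairing_Sigma_Pi = dual_basesD(3)[OF dual_bases_Pi_Sigma]

lemma Sigma_Nil: "Sigma_word q [] = 1"
proof (rule dual_bases_ext[OF dual_bases_Pi_Sigma])
  fix w
  have "coeff_at (Pi_word q w) [] = (if w = [] then 1 else 0)"
    using upperD(2)[OF upper_Pi_word[of w q]] homogeneous_coeff_0[OF upperD(1)[OF upper_Pi_word[of w q]], of "[]"]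
    by auto
  then show "pairing (Sigma_word q []) (Pi_word q w) = pairing 1 (Pi_word q w)"
    by (simp add: pairing_Sigma_Pi pairing_one)
qed

subsection \<open>Multiplication of the dual basis\<close>

definition mfact :: "'a multiset \<Rightarrow> nat" where
  "mfact M = (\<Prod>l\<in>set_mset M. fact (count M l))"

lemma mfact_empty [simp]: "mfact {#} = 1"
  by (simp add: mfact_def)

lemma mfact_pos: "0 < mfact M"
  by (simp add: mfact_def prod_pos)

lemma mfact_add_mset: "mfact (add_mset l M) = Suc (count M l) * mfact M"
proof -
  have "mfact N = fact (count N l) * (\<Prod>x\<in>set_mset N - {l}. fact (count N x))" for N
    unfolding mfact_def by (cases "l \<in># N") (auto simp: prod.remove not_in_iff)
  note this[of "add_mset l M"] this[of M]
  moreover have "(\<Prod>x\<in>set_mset (add_mset l M) - {l}. fact (count (add_mset l M) x)) =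
      (\<Prod>x\<in>set_mset M - {l}. fact (count M x) :: nat)"
    by (intro prod.cong) auto
  ultimately show ?thesis by (simp add: algebra_simps)
qed

lemma mfact_remove: "l \<in># M \<Longrightarrow> mfact M = count M l * mfact (M - {#l#})"
  using mfact_add_mset[of l "M - {#l#}"] by (simp add: count_greater_zero_iff[symmetric] del: count_greater_zero_iff)

definition split_count :: "'a list \<Rightarrow> 'a multiset \<Rightarrow> 'a multiset \<Rightarrow> nat" where
  "split_count ls M N = length (filter (\<lambda>(S, T). mset S = M \<and> mset T = N) (splits ls))"

lemma split_count_Cons:
  "split_count (l # ls) M N =
    (if l \<in># M then split_count ls (M - {#l#}) N else 0) +
    (if l \<in># N then split_count ls M (N - {#l#}) else 0)"
proof -
  have 1: "length (filter (\<lambda>(S, T). add_mset l (mset S) = M \<and> mset T = N) (splits ls)) =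
      (if l \<in># M then split_count ls (M - {#l#}) N else 0)"
    by (auto simp: split_count_def filter_empty_conv intro!: arg_cong[where f = length] filter_cong)
  have 2: "length (filter (\<lambda>(S, T). mset S = M \<and> add_mset l (mset T) = N) (splits ls)) =
      (if l \<in># N then split_count ls M (N - {#l#}) else 0)"
    by (auto simp: split_count_def filter_empty_conv intro!: arg_cong[where f = length] filter_cong)
  show ?thesis
    using 1 2 by (simp add: split_count_def[of "l # ls"] filter_map o_def case_prod_unfold)
qed

text \<open>The number of splittings is a product of binomial coefficients of multiplicities, with
  the denominators moved to the left. Sending the head of the list left or right produces the two
  summands of \<open>count M l + count N l\<close>.\<close>

lemma split_count: "mfact M * mfact N * split_count ls M N = (if mset ls = M + N then mfact (M + N) else 0)"
proof (induction ls arbitrary: M N)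
  case Nil
  then show ?case by (auto simp: split_count_def)
next
  case (Cons l ls)
  have M: "mfact M * mfact N * split_count ls (M - {#l#}) N =
      count M l * (if mset (l # ls) = M + N then mfact (M + N - {#l#}) else 0)" if l: "l \<in># M"
  proof -
    obtain M' where M: "M = add_mset l M'" using multi_member_split[OF l] by blast
    have "mfact M * mfact N * split_count ls (M - {#l#}) N =
        count M l * (mfact M' * mfact N * split_count ls M' N)"
      by (simp add: M mfact_add_mset ac_simps del: mult_Suc)
    then show ?thesis unfolding Cons by (simp add: M)
  qed
  have N: "mfact M * mfact N * split_count ls M (N - {#l#}) =
      count N l * (if mset (l # ls) = M + N then mfact (M + N - {#l#}) else 0)" if l: "l \<in># N"
  proof -
    obtain N' where N: "N = add_mset l N'" using multi_member_split[OF l] by blast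
    have "mfact M * mfact N * split_count ls M (N - {#l#}) =
        count N l * (mfact M * mfact N' * split_count ls M N')"
      by (simp add: N mfact_add_mset ac_simps del: mult_Suc)
    then show ?thesis unfolding Cons by (simp add: N)
  qed
  have "mfact M * mfact N * split_count (l # ls) M N =
      count M l * (if mset (l # ls) = M + N then mfact (M + N - {#l#}) else 0) +
      count N l * (if mset (l # ls) = M + N then mfact (M + N - {#l#}) else 0)"
    unfolding split_count_Cons distrib_left using M N by (auto simp: not_in_iff)
  also have "\<dots> = (if mset (l # ls) = M + N then mfact (M + N) else 0)"
  proof (cases "mset (l # ls) = M + N")
    case True
    have "l \<in># mset (l # ls)" by simp
    then have "l \<in># M + N" unfolding True .
    from mfact_remove[OF this] have "mfact (M + N) = (count M l + count N l) * mfact (M + N - {#l#})"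
      by simp
    then show ?thesis using True by (simp add: distrib_right)
  qed simp
  finally show ?case .
qed

lemma splits_map: "splits (map f xs) = map (\<lambda>(S, T). (map f S, map f T)) (splits xs)"
  by (induction xs) (auto simp: case_prod_unfold)

lemma splits_declyn: "(S, T) \<in> set (splits ls) \<Longrightarrow> declyn ls \<Longrightarrow>
    declyn S \<and> declyn T \<and> set S \<subseteq> set ls \<and> set T \<subseteq> set ls"
  by (induction ls arbitrary: S T) (fastforce simp: declyn_Cons)+

lemma sum_list_indicator:
  "(\<Sum>x\<leftarrow>xs. if P x then 1 else 0) = (of_nat (length (filter P xs)) :: 'a::comm_ring_1)"
  by (induction xs) auto

text \<open>Subsequences of a decreasing list of Lyndon words are again decreasing, so every tensor
  in the coproduct of \<open>Pi_word q x\<close> is a tensor of basis elements and the pairing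
  merely counts splittings.\<close>

lemma pairing_stuffle_Sigma_Pi:
  fixes q :: "'k::rat_comm_algebra_1"
  shows "pairing (stuffle q (Sigma_word q u) (Sigma_word q v)) (Pi_word q x) =
    of_nat (split_count (fac x) (facm u) (facm v))"
proof -
  have prim: "P \<in> set (map (Pi_lyndon q) (fac x)) \<Longrightarrow> primitive q P" for P
    using lyndon_of_mem_fac primitive_Pi_lyndon by auto
  have val: "pairing (Sigma_word q u) (prod_list (map (Pi_lyndon q) S)) = (if mset S = facm u then 1 else 0)"
    if "declyn S" for S u
  proof -
    have "concat S = u \<longleftrightarrow> mset S = facm u"
      using fac_concat[OF that] declyn_mset_eq[OF that declyn_fac[of u]] by auto
    then show ?thesis using pairing_Sigma_Pi[of q u "concat S"] that by (simp add: Pi_word_concat)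
  qed
  have "pairing (stuffle q (Sigma_word q u) (Sigma_word q v)) (Pi_word q x) =
    (\<Sum>(S, T)\<leftarrow>splits (fac x). pairing (Sigma_word q u) (prod_list (map (Pi_lyndon q) S)) *
       pairing (Sigma_word q v) (prod_list (map (Pi_lyndon q) T)))"
    unfolding Pi_word_eq
    by (subst pairing_stuffle_prod_list) (use prim in \<open>simp_all add: splits_map o_def case_prod_unfold\<close>)
  also have "\<dots> = (\<Sum>p\<leftarrow>splits (fac x). if (case p of (S, T) \<Rightarrow> mset S = facm u \<and> mset T = facm v) then 1 else 0)"
    using splits_declyn[of _ _ "fac x"]
    by (intro arg_cong[where f = sum_list] map_cong) (auto simp: val split: if_splits)
  also have "\<dots> = of_nat (split_count (fac x) (facm u) (facm v))"
    unfolding sum_list_indicator split_count_def ..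
  finally show ?thesis .
qed

text \<open>\<open>Sigma_word\<close> behaves like divided powers under \<open>stuffle\<close>; the
  factorials turn it into ordinary monomials, which multiply by \<open>merge\<close> without
  coefficients.\<close>

definition sigma :: "'k::rat_comm_algebra_1 \<Rightarrow> word \<Rightarrow> 'k ncpoly" where
  "sigma q w = scl (of_nat (mfact (facm w))) (Sigma_word q w)"

lemma stuffle_sigma: "stuffle q (sigma q u) (sigma q v) = sigma q (merge u v)"
proof (rule dual_bases_ext[OF dual_bases_Pi_Sigma])
  fix x
  let ?M = "facm u" and ?N = "facm v"
  have eq: "x = merge u v \<longleftrightarrow> facm x = ?M + ?N"
    by (metis facm_inject facm_merge)
  have "pairing (stuffle q (sigma q u) (sigma q v)) (Pi_word q x) =
    of_nat (mfact ?M * mfact ?N * split_count (fac x) ?M ?N)"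
    by (simp add: sigma_def stuffle_scl_left stuffle_scl_right pairing_scl_left
        pairing_stuffle_Sigma_Pi mult.assoc)
  also have "\<dots> = (if x = merge u v then of_nat (mfact (?M + ?N)) else 0)"
    unfolding split_count eq by simp
  also have "\<dots> = pairing (sigma q (merge u v)) (Pi_word q x)"
    by (simp add: sigma_def pairing_scl_left pairing_Sigma_Pi facm_merge)
  finally show "pairing (stuffle q (sigma q u) (sigma q v)) (Pi_word q x) =
    pairing (sigma q (merge u v)) (Pi_word q x)" .
qed

lemma of_Q_of_nat: "of_Q (of_nat n) = of_nat n"
  by (induction n) (simp_all add: of_Q_add)

lemma of_Q_inverse_of_nat:
  assumes "0 < n"
  shows "of_Q (1 / of_nat n) * of_nat n = (1 :: 'k::rat_comm_algebra_1)"
proof -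
  have "of_Q (1 / of_nat n) * of_nat n = (of_Q (1 / of_nat n * of_nat n) :: 'k)"
    unfolding of_Q_mult of_Q_of_nat ..
  then show ?thesis using assms by simp
qed

lemma scl_scl: "scl a (scl b P) = scl (a * b) P"
  by (rule ncp.scale_scale)

lemma Sigma_eq_sigma: "Sigma_word q w = scl (of_Q (1 / of_nat (mfact (facm w)))) (sigma q w)"
  by (simp add: sigma_def of_Q_inverse_of_nat mfact_pos)

lemma sigma_induct [case_names zero sigma add]:
  assumes "Q 0" "\<And>c w. Q (scl c (sigma q w))" "\<And>A B. Q A \<Longrightarrow> Q B \<Longrightarrow> Q (A + B)"
  shows "Q P"
proof -
  have S: "Q (scl c (Sigma_word q w))" for c w
    unfolding Sigma_eq_sigma using assms(2) by simp
  show ?thesis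
    by (rule dual_bases_induct[OF dual_bases_sym[OF dual_bases_Pi_Sigma]]) (auto intro: assms S)
qed

lemma merge_commute: "merge u v = merge v u"
  by (simp add: merge_def add.commute)

lemma merge_assoc: "merge (merge u v) w = merge u (merge v w)"
  by (rule facm_inject[THEN iffD1]) (simp add: facm_merge add.assoc)

text \<open>Inherited from \<open>merge\<close> through the spanning family \<open>sigma\<close>,
  instead of by a recursion on words; associativity is obtained in the same way.\<close>

lemma stuffle_commute:
  fixes q :: "'k::rat_comm_algebra_1"
  shows "stuffle q A B = stuffle q B A"
proof (induction A rule: sigma_induct[where q = q])
  case (sigma c u)
  show ?case
    by (induction B rule: sigma_induct[where q = q])
      (simp_all add: stuffle_add_left stuffle_add_right stuffle_scl_left stuffle_scl_right
        stuffle_sigma merge_commute mult.commute ncp.scale_right_distrib)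
qed (simp_all add: stuffle_add_left stuffle_add_right)

lemma stuffle_assoc:
  fixes q :: "'k::rat_comm_algebra_1"
  shows "stuffle q (stuffle q A B) C = stuffle q A (stuffle q B C)"
proof (induction A rule: sigma_induct[where q = q])
  case (sigma c u)
  show ?case
  proof (induction B rule: sigma_induct[where q = q])
    case (sigma d v)
    show ?case
      by (induction C rule: sigma_induct[where q = q])
        (simp_all add: stuffle_add_left stuffle_add_right stuffle_scl_left stuffle_scl_right
          stuffle_sigma merge_assoc ac_simps ncp.scale_right_distrib)
  qed (simp_all add: stuffle_add_left stuffle_add_right)
qed (simp_all add: stuffle_add_left stuffle_add_right)

section \<open>The basis \<open>\<chi>\<close>\<close>

lemma stuffle_one_left [simp]: "stuffle q (wd []) A = A"
  by (induction A rule: ncpoly_induct) (simp_all add: stuffle_add_right stuffle_scl_right stuffle_wd)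

lemma stuffle_one_right [simp]: "stuffle q A (wd []) = A"
  by (induction A rule: ncpoly_induct) (simp_all add: stuffle_add_left stuffle_scl_left stuffle_wd)

lemma stuffle_list_Nil [simp]: "stuffle_list q [] = wd []"
  and stuffle_list_Cons [simp]: "stuffle_list q (A # As) = stuffle q A (stuffle_list q As)"
  by (simp_all add: stuffle_list_def)

lemma stuffle_list_append:
  "stuffle_list q (As @ Bs) = stuffle q (stuffle_list q As) (stuffle_list q (Bs :: 'k::rat_comm_algebra_1 ncpoly list))"
  by (induction As) (simp_all add: stuffle_assoc)

lemma stuffle_list_remove1:
  fixes A :: "'k::rat_comm_algebra_1 ncpoly"
  shows "A \<in> set As \<Longrightarrow> stuffle_list q As = stuffle q A (stuffle_list q (remove1 A As))"
proof (induction As)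
  case (Cons B As)
  show ?case
  proof (cases "A = B")
    case False
    then have "stuffle_list q (B # As) = stuffle q (stuffle q B A) (stuffle_list q (remove1 A As))"
      using Cons by (simp add: stuffle_assoc)
    also have "\<dots> = stuffle q A (stuffle_list q (remove1 A (B # As)))"
      using False by (simp add: stuffle_commute[of q B A] stuffle_assoc)
    finally show ?thesis .
  qed simp
qed simp

lemma stuffle_list_mset:
  fixes As :: "'k::rat_comm_algebra_1 ncpoly list"
  shows "mset As = mset Bs \<Longrightarrow> stuffle_list q As = stuffle_list q Bs"
proof (induction As arbitrary: Bs)
  case (Cons A As)
  have "A \<in> set Bs" using Cons.prems by (metis list.set_intros(1) mset_eq_setD)
  moreover have "mset As = mset (remove1 A Bs)" using Cons.prems by (metis add_mset_remove_trivial mset.simps(2) mset_remove1)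
  ultimately show ?case using Cons.IH[of "remove1 A Bs"] stuffle_list_remove1[of A Bs q] by simp
qed simp

definition lyndon_product :: "'k::comm_ring_1 \<Rightarrow> word \<Rightarrow> 'k ncpoly" where
  "lyndon_product q w = stuffle_list q (map wd (fac w))"

lemma stuffle_lyndon_product:
  fixes q :: "'k::rat_comm_algebra_1"
  shows "stuffle q (lyndon_product q u) (lyndon_product q v) = lyndon_product q (merge u v)"
proof -
  have "stuffle q (lyndon_product q u) (lyndon_product q v) = stuffle_list q (map wd (fac u @ fac v))"
    by (simp add: lyndon_product_def stuffle_list_append)
  also have "\<dots> = lyndon_product q (merge u v)"
    unfolding lyndon_product_def by (rule stuffle_list_mset) (simp add: facm_merge)
  finally show ?thesis .
qed

lemma stuffle_list_powers:
  "stuffle_list q (map (\<lambda>(l, i). stuffle_pow q (f l) i) fs) =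
    stuffle_list q (map f (expand fs) :: 'k::rat_comm_algebra_1 ncpoly list)"
  by (induction fs) (auto simp: stuffle_pow_def stuffle_list_append map_replicate)

lemma mfact_replicate: "l \<notin># N \<Longrightarrow> mfact (replicate_mset i l + N) = fact i * mfact N"
  by (induction i) (simp_all add: mfact_add_mset not_in_iff algebra_simps)

lemma mfact_expand: "grouped fs \<Longrightarrow> mfact (mset (expand fs)) = (\<Prod>(l, i)\<leftarrow>fs. fact i)"
proof (induction fs)
  case (Cons p fs)
  have "fst p \<notin> set (expand fs)" using Cons.prems set_expand[of fs] by (auto simp: grouped_Cons)
  then have "mfact (mset (expand (p # fs))) = fact (snd p) * mfact (mset (expand fs))"
    using mfact_replicate[of "fst p" "mset (expand fs)" "snd p"] by (simp add: mset_replicate)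
  then show ?case using Cons by (simp add: grouped_Cons case_prod_unfold)
qed simp

lemma chi_eq: "chi q w = scl (of_Q (1 / of_nat (mfact (facm w)))) (lyndon_product q w)"
proof -
  have "(\<Prod>(l, i)\<leftarrow>fs. fact i :: rat) = of_nat (\<Prod>(l, i)\<leftarrow>fs. fact i)" for fs :: "(word \<times> nat) list"
    by (induction fs) (auto simp: case_prod_unfold)
  then show ?thesis
    unfolding chi_def stuffle_list_powers expand_lyndon_factorization lyndon_product_def
    using mfact_expand[OF grouped_lyndon_factorization[of w]] by (simp add: expand_lyndon_factorization)
qed

lemma lyndon_product_eq_chi: "lyndon_product q w = scl (of_nat (mfact (facm w))) (chi q w)"
  by (simp add: chi_eq mult.commute[of "of_nat _"] of_Q_inverse_of_nat mfact_pos)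

lemma sum_list_neq_0: "(\<Sum>x\<leftarrow>xs. f x) \<noteq> 0 \<Longrightarrow> \<exists>x\<in>set xs. f x \<noteq> 0"
  by (induction xs) auto

text \<open>The coproduct of \<open>Pi_word q x\<close> is supported on pairs whose Lyndon factors
  together are those of \<open>x\<close>. Hence the \<open>Sigma\<close>-coordinates of a product
  are controlled by those of its factors.\<close>

lemma pairing_stuffle_Pi_neq_0:
  fixes q :: "'k::rat_comm_algebra_1"
  assumes "pairing (stuffle q A B) (Pi_word q x) \<noteq> 0"
  shows "\<exists>u v. x = merge u v \<and> pairing A (Pi_word q u) \<noteq> 0 \<and> pairing B (Pi_word q v) \<noteq> 0"
proof -
  have "pairing (stuffle q A B) (Pi_word q x) =
    (\<Sum>(S, T)\<leftarrow>splits (fac x). pairing A (prod_list (map (Pi_lyndon q) S)) *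
       pairing B (prod_list (map (Pi_lyndon q) T)))"
    unfolding Pi_word_eq
    by (subst pairing_stuffle_prod_list)
      (auto simp: splits_map o_def case_prod_unfold lyndon_of_mem_fac primitive_Pi_lyndon)
  then have "\<exists>p\<in>set (splits (fac x)). (case p of (S, T) \<Rightarrow> pairing A (prod_list (map (Pi_lyndon q) S)) *
       pairing B (prod_list (map (Pi_lyndon q) T))) \<noteq> 0"
    using assms by (intro sum_list_neq_0) simp
  then obtain S T where ST: "(S, T) \<in> set (splits (fac x))"
    "pairing A (prod_list (map (Pi_lyndon q) S)) * pairing B (prod_list (map (Pi_lyndon q) T)) \<noteq> 0"
    by auto
  have mset: "mset xs = mset S + mset T" if "(S, T) \<in> set (splits xs)" for xs S T and f :: "word list"
    using that by (induction xs arbitrary: S T) auto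
  have d: "declyn S" "declyn T" using splits_declyn[OF ST(1)] by auto
  have "facm x = facm (merge (concat S) (concat T))"
    using mset[OF ST(1)] d by (simp add: facm_merge fac_concat)
  then have "x = merge (concat S) (concat T)" by (simp add: facm_inject)
  moreover have "pairing A (Pi_word q (concat S)) \<noteq> 0" "pairing B (Pi_word q (concat T)) \<noteq> 0"
    using ST(2) d by (auto simp: Pi_word_concat)
  ultimately show ?thesis by blast
qed

lemma sigma_lyndon: "lyndon l \<Longrightarrow> sigma q l = Sigma_word q l"
  by (simp add: sigma_def fac_lyndon mfact_add_mset)

lemma pairing_sigma_Pi: "pairing (sigma q v) (Pi_word q u) = (if u = v then of_nat (mfact (facm u)) else 0)"
  by (simp add: sigma_def pairing_scl_left pairing_Sigma_Pi)

lemma sigma_Cons: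
  assumes "fac w = l # ls"
  shows "sigma q w = stuffle q (Sigma_word q l) (sigma q (concat ls))" "w = l @ concat ls" "lyndon l"
proof -
  have d: "declyn ls" "lyndon l" "\<And>m. m \<in> set ls \<Longrightarrow> m \<le> l"
    using declyn_fac[of w] assms by (auto simp: declyn_Cons)
  show "w = l @ concat ls" using concat_fac[of w] assms by simp
  then have "merge l (concat ls) = w" using merge_Cons_max[of l "concat ls"] d by (simp add: fac_concat)
  then show "sigma q w = stuffle q (Sigma_word q l) (sigma q (concat ls))"
    using d(2) by (simp add: stuffle_sigma sigma_lyndon[symmetric])
  show "lyndon l" by fact
qed

text \<open>In \<open>Sigma\<close>-coordinates \<open>wd l\<close> is \<open>Sigma_word q l\<close>
  plus smaller terms, because no word below \<open>v\<close> occurs in \<open>Pi_word q v\<close>.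
  The estimate is carried through products by \<open>merge_le\<close>.\<close>

lemma lyndon_product_triangular:
  fixes q :: "'k::rat_comm_algebra_1"
  assumes "declyn ls"
  shows "pairing (lyndon_product q (concat ls)) (Pi_word q (concat ls)) = of_nat (mfact (mset ls)) \<and>
    (\<forall>v. pairing (lyndon_product q (concat ls)) (Pi_word q v) \<noteq> 0 \<longrightarrow> v \<le> concat ls)"
  using assms
proof (induction ls)
  case Nil
  have "coeff_at (Pi_word q v) [] = (if v = [] then 1 else 0)" for v
    using pairing_Sigma_Pi[of q "[]" v] by (simp add: Sigma_Nil pairing_one)
  then show ?case by (auto simp: lyndon_product_def pairing_wd_left)
next
  case (Cons l ls)
  then have l: "lyndon l" "declyn ls" "\<And>m. m \<in> set ls \<Longrightarrow> m \<le> l" by (auto simp: declyn_Cons)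
  let ?w = "concat ls" and ?X = "lyndon_product q (concat ls)"
  have fl: "fac ?w = ls" "fac (l @ ?w) = l # ls"
    using fac_concat[OF l(2)] fac_concat[OF Cons.prems] by simp_all
  have X: "lyndon_product q (concat (l # ls)) = stuffle q (wd l) ?X"
    by (simp add: lyndon_product_def fl)
  note IH = Cons.IH[OF l(2)]
  \<comment> \<open>\<open>R\<close> and \<open>R'\<close> are the strictly lower parts of the two
    factors; by \<open>merge_le\<close> no product involving them reaches the coordinate
    \<open>l @ concat ls\<close>.\<close>
  define R where "R = wd l - Sigma_word q l"
  define R' where "R' = ?X - sigma q ?w"
  have Xl: "v \<le> l" if "pairing (wd l) (Pi_word q v) \<noteq> 0" for v
    using upperD(3)[OF upper_Pi_word[of v q]] that by (simp add: pairing_wd_left)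
  have R: "v < l" if "pairing R (Pi_word q v) \<noteq> 0" for v
  proof -
    have "v \<noteq> l" using that upperD(2)[OF upper_Pi_word[of l q]]
      by (auto simp: R_def pairing_simps pairing_Sigma_Pi)
    then show ?thesis using that Xl[of v] by (auto simp: R_def pairing_minus_left pairing_Sigma_Pi)
  qed
  have R': "v < ?w" if "pairing R' (Pi_word q v) \<noteq> 0" for v
  proof -
    have "v \<noteq> ?w" using that IH by (auto simp: R'_def pairing_minus_left pairing_sigma_Pi fl)
    then show ?thesis using that IH by (force simp: R'_def pairing_minus_left pairing_sigma_Pi)
  qed
  have fm: "\<And>m. m \<in># facm ?w \<Longrightarrow> m \<le> l" using l fl by simp
  have z1: "pairing (stuffle q R ?X) (Pi_word q (l @ ?w)) = 0"
  proof (rule ccontr)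
    assume "\<not> ?thesis"
    from pairing_stuffle_Pi_neq_0[OF this] obtain u v where uv: "l @ ?w = merge u v" "u < l" "v \<le> ?w"
      using R IH by blast
    have "merge u v < l @ ?w" using uv fm by (intro merge_le l(1)) auto
    then show False using uv by simp
  qed
  have z2: "pairing (stuffle q (Sigma_word q l) R') (Pi_word q (l @ ?w)) = 0"
  proof (rule ccontr)
    assume "\<not> ?thesis"
    from pairing_stuffle_Pi_neq_0[OF this] obtain u v where uv: "l @ ?w = merge u v" "u = l" "v < ?w"
      using R' by (auto simp: pairing_Sigma_Pi split: if_splits)
    have "merge u v < l @ ?w" using uv fm by (intro merge_le l(1)) auto
    then show False using uv by simp
  qed
  have "stuffle q (wd l) ?X = stuffle q R ?X + (stuffle q (Sigma_word q l) R' + stuffle q (Sigma_word q l) (sigma q ?w))"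
    by (simp add: R_def R'_def stuffle_add_left[symmetric] stuffle_add_right[symmetric])
  then have "pairing (stuffle q (wd l) ?X) (Pi_word q (l @ ?w)) =
      pairing (stuffle q (Sigma_word q l) (sigma q ?w)) (Pi_word q (l @ ?w))"
    using z1 z2 by (simp add: pairing_add_left)
  also have "\<dots> = of_nat (mfact (mset (l # ls)))"
    using sigma_Cons(1)[OF fl(2), of q] by (metis pairing_sigma_Pi fl(2))
  finally have one: "pairing (stuffle q (wd l) ?X) (Pi_word q (l @ ?w)) = of_nat (mfact (mset (l # ls)))" .
  have "v \<le> l @ ?w" if "pairing (stuffle q (wd l) ?X) (Pi_word q v) \<noteq> 0" for v
  proof -
    from pairing_stuffle_Pi_neq_0[OF that] obtain a b where ab: "v = merge a b" "a \<le> l" "b \<le> ?w"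
      using Xl IH by blast
    show ?thesis
    proof (cases "(a, b) = (l, ?w)")
      case True
      then show ?thesis using merge_Cons_max[of l ?w] l(1) fm ab by simp
    next
      case False
      then have "merge a b < l @ ?w" using ab fm by (intro merge_le l(1)) auto
      then show ?thesis using ab by simp
    qed
  qed
  then show ?case using one X by simp
qed

lemma homogeneous_stuffle_list:
  "weight_homogeneous (weight (concat ls)) (stuffle_list q (map wd ls))"
  by (induction ls) (use homogeneous_wd[of "[]"] in \<open>auto intro: homogeneous_stuffle homogeneous_wd\<close>)

lemma homogeneous_chi: "weight_homogeneous (weight w) (chi q w)"
  unfolding chi_eq lyndon_product_def
  using homogeneous_stuffle_list[of "fac w" q] by (simp add: homogeneous_scl)

section \<open>Unitriangularity of Sigma and chi over words\<close>

definition lower :: "word \<Rightarrow> 'k::comm_ring_1 ncpoly \<Rightarrow> bool" where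
  "lower w P \<longleftrightarrow> weight_homogeneous (weight w) P \<and> coeff_at P w = 1 \<and>
     (\<forall>v. coeff_at P v \<noteq> 0 \<longrightarrow> v \<le> w)"

lemma lowerD:
  "lower w P \<Longrightarrow> weight_homogeneous (weight w) P" "lower w P \<Longrightarrow> coeff_at P w = 1"
  "lower w P \<Longrightarrow> coeff_at P v \<noteq> 0 \<Longrightarrow> v \<le> w"
  by (auto simp: lower_def)

lemma dual_bases_of_lower: "(\<And>w. lower w (B w)) \<Longrightarrow> \<exists>S. dual_bases B S"
  by (rule dual_bases_of_triangular[where R = "(<)"])
    (auto simp: lower_def transp_def irreflp_def order.order_iff_strict)

lemma homogeneous_Sigma: "weight_homogeneous (weight w) (Sigma_word q w)"
  by (rule dual_basesD(2)[OF dual_bases_Pi_Sigma])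

lemma expand_Sigma:
  "weight_homogeneous n P \<Longrightarrow>
    P = (\<Sum>u\<in>words_of_weight n. scl (pairing P (Pi_word q u)) (Sigma_word q u))"
  using dual_bases_expand_homogeneous[OF dual_bases_sym[OF dual_bases_Pi_Sigma]]
  by (simp add: pairing_commute[of P])

lemma lower_sum_Sigma:
  assumes P: "weight_homogeneous (weight w) P" "pairing P (Pi_word q w) = 1"
    "\<And>v. pairing P (Pi_word q v) \<noteq> 0 \<Longrightarrow> v \<le> w"
    and S: "\<And>v. v \<le> w \<Longrightarrow> lower v (Sigma_word q v)"
  shows "lower w P"
  unfolding lower_def
proof (intro conjI allI impI)
  have c: "coeff_at P x = (\<Sum>u\<in>words_of_weight (weight w). pairing P (Pi_word q u) * coeff_at (Sigma_word q u) x)"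
    for x
    by (subst expand_Sigma[OF P(1), of q]) (simp add: lookup_sum lookup_scl)
  show "v \<le> w" if "coeff_at P v \<noteq> 0" for v
  proof -
    have "\<exists>u\<in>words_of_weight (weight w). pairing P (Pi_word q u) * coeff_at (Sigma_word q u) v \<noteq> 0"
      using that unfolding c by (meson sum.neutral)
    then obtain u where u: "pairing P (Pi_word q u) \<noteq> 0" "coeff_at (Sigma_word q u) v \<noteq> 0"
      by (metis mult_zero_left mult_zero_right)
    then show ?thesis using P(3)[of u] lowerD(3)[OF S, of u v] by auto
  qed
  have "coeff_at P w = (\<Sum>u\<in>words_of_weight (weight w). if u = w then 1 else 0)"
    unfolding c
  proof (intro sum.cong refl)
    fix u
    show "pairing P (Pi_word q u) * coeff_at (Sigma_word q u) w = (if u = w then 1 else 0)"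
    proof (cases "u = w")
      case True
      then show ?thesis using P(2) lowerD(2)[OF S, of w] by simp
    next
      case False
      have "pairing P (Pi_word q u) = 0 \<or> coeff_at (Sigma_word q u) w = 0"
        using P(3)[of u] lowerD(3)[OF S, of u w] False by fastforce
      then show ?thesis using False by auto
    qed
  qed
  then show "coeff_at P w = 1" by simp
qed (rule P(1))

text \<open>The coefficient of \<open>Sigma_word q u\<close> in the word \<open>w\<close> is that of
  \<open>w\<close> in \<open>Pi_word q u\<close>, hence 0 unless \<open>u \<le> w\<close>, and 1 for
  \<open>u = w\<close>. Solving for \<open>Sigma_word q w\<close> expresses it by \<open>w\<close>
  and members with smaller index of the same weight.\<close>

lemma lower_Sigma: "lower w (Sigma_word q w)"
proof (induction "card {x\<in>words_of_weight (weight w). x < w}" arbitrary: w rule: less_induct)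
  case less
  let ?W = "words_of_weight (weight w)"
  have IH: "lower u (Sigma_word q u)" if "u < w" "weight u = weight w" for u
    using less card_less_of_transp[of "(<)" u w] that by (auto simp: transp_def irreflp_def)
  have pu: "coeff_at (Pi_word q u) w = 0" if "\<not> u \<le> w" for u
    using upperD(3)[OF upper_Pi_word[of u q], of w] that by blast
  have "wd w = (\<Sum>u\<in>?W. scl (coeff_at (Pi_word q u) w) (Sigma_word q u))"
    using expand_Sigma[OF homogeneous_wd[of w], of q] by (simp add: pairing_wd_left)
  also have "\<dots> = Sigma_word q w + (\<Sum>u\<in>?W - {w}. scl (coeff_at (Pi_word q u) w) (Sigma_word q u))"
    by (subst sum.remove[of _ w]) (simp_all add: upperD(2)[OF upper_Pi_word])
  finally have S: "Sigma_word q w = wd w - (\<Sum>u\<in>?W - {w}. scl (coeff_at (Pi_word q u) w) (Sigma_word q u))"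
    unfolding eq_diff_eq by (rule sym)
  have c: "coeff_at (Sigma_word q w) x = coeff_at (wd w) x -
      (\<Sum>u\<in>?W - {w}. coeff_at (Pi_word q u) w * coeff_at (Sigma_word q u) x)" for x
    by (subst S) (simp add: lookup_minus lookup_sum lookup_scl)
  have z: "(\<Sum>u\<in>?W - {w}. coeff_at (Pi_word q u) w * coeff_at (Sigma_word q u) x) = 0" if "\<not> x < w" for x
  proof (intro sum.neutral ballI)
    fix u assume u: "u \<in> ?W - {w}"
    show "coeff_at (Pi_word q u) w * coeff_at (Sigma_word q u) x = 0"
    proof (cases "u < w")
      case True
      then have "lower u (Sigma_word q u)" using IH u by auto
      then have "coeff_at (Sigma_word q u) x = 0" using lowerD(3)[of u "Sigma_word q u" x] True that by fastforce
      then show ?thesis by simp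
    next
      case False
      then show ?thesis using pu[of u] u by auto
    qed
  qed
  show ?case
    unfolding lower_def
  proof (intro conjI allI impI)
    show "weight_homogeneous (weight w) (Sigma_word q w)" by (rule homogeneous_Sigma)
    show "coeff_at (Sigma_word q w) w = 1" unfolding c using z[of w] by (simp add: coeff_wd)
    show "v \<le> w" if "coeff_at (Sigma_word q w) v \<noteq> 0" for v
      using that z[of v] unfolding c by (cases "v < w") (auto simp: coeff_wd split: if_splits)
  qed
qed

lemma lower_chi: "lower w (chi q w)"
proof (rule lower_sum_Sigma)
  have t: "pairing (lyndon_product q w) (Pi_word q w) = of_nat (mfact (facm w))"
    "\<And>v. pairing (lyndon_product q w) (Pi_word q v) \<noteq> 0 \<Longrightarrow> v \<le> w"
    using lyndon_product_triangular[OF declyn_fac[of w], of q] by auto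
  show "pairing (chi q w) (Pi_word q w) = 1"
    by (simp add: chi_eq pairing_scl_left t(1) of_Q_inverse_of_nat mfact_pos)
  show "v \<le> w" if "pairing (chi q w) (Pi_word q v) \<noteq> 0" for v
    using that t(2)[of v] unfolding chi_eq pairing_scl_left by (metis mult_zero_right)
qed (rule homogeneous_chi lower_Sigma)+

lemma dual_bases_chi_xi: "dual_bases (chi q) (xi q)"
proof -
  from dual_bases_of_lower[OF lower_chi[of _ q]] obtain S where S: "dual_bases (chi q) S" ..
  then show ?thesis unfolding xi_def dual_family_eq[OF S] .
qed

section \<open>Primitive elements\<close>

text \<open>With at least two Lyndon factors, \<open>Sigma_word q w\<close> is a rational multiple
  of a stuffle product of two polynomials without constant term, and primitive elements annihilate
  such products. The empty word tests the constant term.\<close>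

lemma primitive_orthogonal_Sigma:
  assumes "primitive q P" "\<not> lyndon w"
  shows "pairing (Sigma_word q w) P = 0"
proof (cases "fac w")
  case Nil
  then show ?thesis using assms by (simp add: Sigma_Nil pairing_one primitive_def)
next
  case (Cons l ls)
  have ne: "ls \<noteq> []" using assms(2) Cons by (auto simp: lyndon_iff_length_fac)
  note s = sigma_Cons[OF Cons]
  have "concat ls \<noteq> []"
    using ne declyn_fac[of w] Cons by (cases ls) (auto simp: declyn_Cons lyndon_not_Nil)
  then have "coeff_at (Sigma_word q l) [] = 0" "coeff_at (sigma q (concat ls)) [] = 0"
    using lyndon_not_Nil[OF s(3)]
    by (auto simp: sigma_def lookup_scl homogeneous_coeff_0[OF homogeneous_Sigma])
  then have "pairing (sigma q w) P = 0"
    unfolding s(1) by (rule primitive_pairing_stuffle[OF assms(1)])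
  then show ?thesis unfolding Sigma_eq_sigma by (simp add: pairing_scl_left)
qed

lemma primitive_orthogonal_chi:
  assumes "primitive q P" "\<not> lyndon w"
  shows "pairing (chi q w) P = 0"
proof (cases "fac w")
  case Nil
  then show ?thesis using assms
    by (simp add: chi_eq lyndon_product_def pairing_wd_left primitive_def pairing_scl_left)
next
  case (Cons l ls)
  have ne: "ls \<noteq> []" using assms(2) Cons by (auto simp: lyndon_iff_length_fac)
  have l: "l \<noteq> []" "concat ls \<noteq> []"
    using ne declyn_fac[of w] Cons by (cases ls; auto simp: declyn_Cons lyndon_not_Nil)+
  have "lyndon_product q w = stuffle q (wd l) (stuffle_list q (map wd ls))"
    by (simp add: lyndon_product_def Cons)
  moreover have "coeff_at (stuffle_list q (map wd ls)) [] = 0"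
    using l(2) by (simp add: homogeneous_coeff_0[OF homogeneous_stuffle_list])
  ultimately have "pairing (lyndon_product q w) P = 0"
    using l(1) by (simp add: primitive_pairing_stuffle[OF assms(1)] coeff_wd)
  then show ?thesis unfolding chi_eq by (simp add: pairing_scl_left)
qed

text \<open>For the converse, \<open>chi q a\<close> and \<open>chi q b\<close> with
  \<open>a\<close>, \<open>b\<close> nonempty multiply to a multiple of
  \<open>chi q (merge a b)\<close>, and \<open>merge a b\<close> has at least two Lyndon factors.
  Nonempty words are combinations of such \<open>chi q a\<close>, so the condition on words
  follows.\<close>

lemma primitive_iff_orthogonal_chi: "primitive q P \<longleftrightarrow> (\<forall>w. \<not> lyndon w \<longrightarrow> pairing (chi q w) P = 0)"
proof
  assume orth: "\<forall>w. \<not> lyndon w \<longrightarrow> pairing (chi q w) P = 0"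
  have lp: "pairing (lyndon_product q w) P = 0" if "\<not> lyndon w" for w
    using orth that by (simp add: lyndon_product_eq_chi pairing_scl_left)
  have cc: "pairing (stuffle q (chi q a) (chi q b)) P = 0" if "a \<noteq> []" "b \<noteq> []" for a b
  proof -
    have "0 < length (fac a)" "0 < length (fac b)" using that by auto
    moreover have "length (fac (merge a b)) = length (fac a) + length (fac b)"
      using facm_merge[of a b] by (metis size_mset size_union)
    ultimately have "\<not> lyndon (merge a b)" unfolding lyndon_iff_length_fac by linarith
    then show ?thesis
      by (simp add: chi_eq stuffle_scl_left stuffle_scl_right stuffle_lyndon_product pairing_scl_left lp)
  qed
  show "primitive q P"
    unfolding primitive_def
  proof (intro conjI allI impI)
    have "\<not> lyndon []" using lyndon_not_Nil by blast
    then have "pairing (lyndon_product q []) P = 0" by (rule lp)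
    then show "coeff_at P [] = 0" by (simp add: lyndon_product_def pairing_wd_left)
    fix u v :: word assume uv: "u \<noteq> []" "v \<noteq> []"
    let ?c = "\<lambda>u a. pairing (xi q a) (wd u)"
    have e: "wd u = (\<Sum>a\<in>words_of_weight (weight u). scl (?c u a) (chi q a))" for u
      by (rule dual_bases_expand_homogeneous[OF dual_bases_chi_xi homogeneous_wd])
    have "pairing (stuffle q (wd u) (wd v)) P = (\<Sum>a\<in>words_of_weight (weight u).
        \<Sum>b\<in>words_of_weight (weight v). ?c u a * (?c v b * pairing (stuffle q (chi q a) (chi q b)) P))"
      by (subst e[of u], subst e[of v], subst sum.swap)
        (simp add: stuffle_sum_left stuffle_sum_right stuffle_scl_left stuffle_scl_right pairing_sum_left
          pairing_scl_left sum_distrib_left mult.left_commute del: ncp.scale_scale)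
    also have "\<dots> = 0"
    proof (intro sum.neutral ballI)
      fix a b assume "a \<in> words_of_weight (weight u)" "b \<in> words_of_weight (weight v)"
      then have "a \<noteq> []" "b \<noteq> []" using uv by auto
      then show "?c u a * (?c v b * pairing (stuffle q (chi q a) (chi q b)) P) = 0" using cc by simp
    qed
    finally show "pairing (stuffle_words q u v) P = 0" by (simp add: stuffle_wd)
  qed
qed (use primitive_orthogonal_chi in blast)

lemma basis_family_xi_primitive: "basis_family (xi q) Lyn {P. primitive q P}"
  by (rule dual_bases_basis_family[OF dual_bases_sym[OF dual_bases_chi_xi]])
    (auto simp: primitive_iff_orthogonal_chi Lyn_def)

lemma primitive_span_Pi: "{P. primitive q P} \<subseteq> ncp.span (Pi_lyndon q ` Lyn)"
proof -
  have "Pi_lyndon q ` Lyn = Pi_word q ` Lyn" by (auto simp: Lyn_def Pi_word_lyndon)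
  then show ?thesis
    using dual_bases_span[OF dual_bases_Pi_Sigma, of q Lyn] primitive_orthogonal_Sigma[of q]
    by (auto simp: Lyn_def)
qed

section \<open>The identification map and the Lie algebra of primitive elements\<close>

abbreviation pi1_word :: "'k::rat_comm_algebra_1 \<Rightarrow> word \<Rightarrow> 'k ncpoly" where
  "pi1_word q w \<equiv> prod_list (map (\<lambda>a. pi1 q [a]) w)"

lemma lie_identification_eq_sum:
  "finite K \<Longrightarrow> supp P \<subseteq> K \<Longrightarrow>
    lie_identification q P = (\<Sum>w\<in>K. scl (coeff_at P w) (pi1_word q w))"
  unfolding lie_identification_def by (rule sum.mono_neutral_left) (auto simp: in_keys_iff)

lemma lie_identification_0 [simp]: "lie_identification q 0 = 0"
  by (simp add: lie_identification_def)

lemma lie_identification_add: "lie_identification q (P + Q) = lie_identification q P + lie_identification q Q"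
  using keys_add[of P Q]
  by (simp add: lie_identification_eq_sum[of "supp P \<union> supp Q"] lookup_add
      ncp.scale_left_distrib sum.distrib)

lemma lie_identification_scl: "lie_identification q (scl c P) = scl c (lie_identification q P)"
  using keys_scl[of c P]
  by (simp add: lie_identification_eq_sum[of "supp P"] lookup_scl ncp.scale_sum_right)

lemma lie_identification_diff: "lie_identification q (P - Q) = lie_identification q P - lie_identification q Q"
  using lie_identification_add[of q "P - Q" Q] by simp

lemma lie_identification_wd: "lie_identification q (wd w) = pi1_word q w"
  by (subst lie_identification_eq_sum[of "{w}"]) (auto simp: in_keys_iff coeff_wd split: if_splits)

lemma lie_identification_mult: "lie_identification q (P * Q) = lie_identification q P * lie_identification q Q"
proof (induction P rule: ncpoly_induct)
  case (word c u)
  show ?case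
    by (induction Q rule: ncpoly_induct)
      (simp_all add: scl_mult_left scl_mult_right lie_identification_scl lie_identification_add
        lie_identification_wd wd_mult distrib_left ncp.scale_right_distrib)
qed (simp_all add: lie_identification_add distrib_right)

lemma upper_prod_pi1: "upper w (pi1_word q w)"
proof (induction w)
  case Nil
  show ?case by (auto simp: upper_def coeff_one intro!: homogeneousI split: if_splits)
next
  case (Cons a w)
  then show ?case using upper_mult[OF upper_pi1_letter[of a q]] by simp
qed

text \<open>The images of the words are again unitriangular over words. Pairing with their dual
  family recovers the coefficients of \<open>P\<close>, and expansion along them gives
  preimages.\<close>

lemma bij_lie_identification: "bij (lie_identification q)"
proof -
  from dual_bases_of_upper[OF upper_prod_pi1[of _ q]] obtain S
    where S: "dual_bases (\<lambda>w. pi1_word q w) S" ..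
  have c: "pairing (S w) (lie_identification q P) = coeff_at P w" for w P
    by (induction P rule: ncpoly_induct)
      (simp_all add: lie_identification_scl lie_identification_add lie_identification_wd pairing_simps
        dual_basesD(3)[OF S] lookup_add lookup_scl coeff_wd)
  have "inj (lie_identification q)"
    by (rule injI) (metis c poly_mapping_eqI)
  moreover have "P \<in> range (lie_identification q)" for P
  proof -
    let ?R = "\<Sum>w\<in>words_of_weights P. scl (pairing (S w) P) (wd w)"
    have hom: "lie_identification q (sum f A) = (\<Sum>w\<in>A. lie_identification q (f w))" for f and A :: "word set"
      by (induction A rule: infinite_finite_induct) (simp_all add: lie_identification_add)
    have "lie_identification q ?R = P"
      using dual_bases_expand[OF S, of P] by (simp add: hom lie_identification_scl lie_identification_wd)
    then show ?thesis by (metis rangeI)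
  qed
  ultimately show ?thesis unfolding bij_def by blast
qed

lemma lie_identification_free_lie:
  "lie_identification q ` free_lie = lie_generated (range (\<lambda>a. pi1 q [a]))" (is "?L = ?R")
proof
  have "lie_identification q P \<in> ?R" if "P \<in> free_lie" for P
    using that unfolding free_lie_def
  proof (induction rule: lie_generated.induct)
    case (gen P)
    then show ?case by (auto simp: lie_identification_wd intro!: lie_generated.gen)
  qed (auto simp: lie_identification_add lie_identification_scl lie_identification_diff
      lie_identification_mult intro: lie_generated.intros)
  then show "?L \<subseteq> ?R" by blast
  have "\<exists>P\<in>free_lie. Q = lie_identification q P" if "Q \<in> ?R" for Q
    using that
  proof (induction rule: lie_generated.induct)
    case (gen Q)
    then obtain a where "Q = pi1 q [a]" by auto
    then have "Q = lie_identification q (wd [a])" by (simp add: lie_identification_wd)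
    then show ?case unfolding free_lie_def by (blast intro: lie_generated.gen)
  next
    case zero
    show ?case unfolding free_lie_def by (metis lie_generated.zero lie_identification_0)
  next
    case (add P Q)
    then show ?case unfolding free_lie_def by (metis lie_generated.add lie_identification_add)
  next
    case (scale P c)
    then show ?case unfolding free_lie_def by (metis lie_generated.scale lie_identification_scl)
  next
    case (bracket P Q)
    then obtain P' Q' where "P' \<in> free_lie" "P = lie_identification q P'"
      "Q' \<in> free_lie" "Q = lie_identification q Q'" by blast
    then show ?case
      by (intro bexI[of _ "P' * Q' - Q' * P'"])
        (auto simp: lie_identification_diff lie_identification_mult free_lie_def intro: lie_generated.bracket)
  qed
  then show "?R \<subseteq> ?L" by blast
qed

text \<open>A form of Friedrichs' criterion. Primitive elements lie in the span of the
  \<open>Pi_lyndon q l\<close> for \<open>l\<close> Lyndon, which are iterated brackets of the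
  generators; conversely, primitivity is preserved by brackets.\<close>

lemma primitive_eq_lie_generated: "{P. primitive q P} = lie_generated (range (\<lambda>a. pi1 q [a]))" (is "?L = ?R")
proof
  have "Pi_lyndon q l \<in> ?R" if "lyndon l" for l
    using that
  proof (induction l rule: lyndon_induct)
    case (letter a)
    show ?case by (auto simp: Pi_lyndon_letter intro: lie_generated.gen)
  next
    case (split l s r)
    show ?case
      unfolding Pi_lyndon_split[OF split.hyps(2,3,4)] by (intro lie_generated.bracket split.IH)
  qed
  moreover have "ncp.subspace ?R"
    unfolding ncp.subspace_def by (auto intro: lie_generated.intros)
  ultimately have "ncp.span (Pi_lyndon q ` Lyn) \<subseteq> ?R"
    by (intro ncp.span_minimal) (auto simp: Lyn_def)
  then show "?L \<subseteq> ?R" using primitive_span_Pi by blast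
  have "primitive q P" if "P \<in> ?R" for P
    using that
    by (induction rule: lie_generated.induct)
      (auto intro: primitive_pi1_letter primitive_zero primitive_add primitive_scl primitive_bracket)
  then show "?R \<subseteq> ?L" by blast
qed

section \<open>Positivity\<close>

text \<open>When \<open>l\<close> bounds all factors occurring in \<open>P\<close>, left
  multiplication by \<open>Pi_lyndon q l\<close> just prepends a factor in the
  \<open>Pi\<close>-expansion. The result has no Lyndon component, which is how the second term of
  the straightening is discarded.\<close>

lemma pairing_Sigma_Pi_lyndon_mult:
  assumes "lyndon l" "\<And>x. pairing (Sigma_word q x) P \<noteq> 0 \<Longrightarrow> x \<noteq> [] \<and> (\<forall>m\<in>set (fac x). m \<le> l)"
    and z: "pairing (Sigma_word q z) (Pi_lyndon q l * P) \<noteq> 0"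
  shows "2 \<le> length (fac z) \<and> (\<forall>m\<in>set (fac z). m \<le> l)"
proof -
  have "Pi_lyndon q l * P = (\<Sum>x\<in>words_of_weights P. scl (pairing (Sigma_word q x) P) (Pi_lyndon q l * Pi_word q x))"
    by (subst dual_bases_expand[OF dual_bases_Pi_Sigma, of P q])
      (simp add: sum_distrib_left scl_mult_right)
  then have "(\<Sum>x\<in>words_of_weights P. pairing (Sigma_word q x) P *
      pairing (Sigma_word q z) (Pi_lyndon q l * Pi_word q x)) \<noteq> 0"
    using z by (simp add: pairing_sum_right pairing_scl_right)
  then obtain x where x: "pairing (Sigma_word q x) P \<noteq> 0"
    "pairing (Sigma_word q z) (Pi_lyndon q l * Pi_word q x) \<noteq> 0"
    by (metis (no_types, lifting) mult_zero_left mult_zero_right sum.neutral)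
  have ne: "x \<noteq> []" and le: "\<And>m. m \<in> set (fac x) \<Longrightarrow> m \<le> l" using assms(2)[OF x(1)] by auto
  have f: "fac (l @ x) = l # fac x" using assms(1) le by (intro fac_append_max) auto
  then have "Pi_lyndon q l * Pi_word q x = Pi_word q (l @ x)" by (simp add: Pi_word_eq)
  then have "z = l @ x" using x(2) by (simp add: pairing_Sigma_Pi split: if_splits)
  then show ?thesis using f ne le by (cases "fac x") auto
qed

text \<open>
  Straightening of \<open>\<Pi>\<^sub>m \<Pi>\<^sub>v\<close>, where \<open>ls\<close> is the factorization of \<open>v\<close>: the leading factor \<open>m\<close> is
  moved to the right; at each \<open>l > m\<close> it is either absorbed into \<open>m @ l\<close>, whose standard
  factorization is \<open>(m, l)\<close>, or it passes \<open>l\<close>, and then \<open>l\<close> remains as a separate largest factor.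
\<close>

lemma straighten:
  fixes q :: "'k::rat_comm_algebra_1"
  assumes "lyndon m" "declyn ls" "2 \<le> length m \<Longrightarrow> ls \<noteq> [] \<Longrightarrow> hd ls \<le> drop (std_split m) m"
    "m \<le> c" "\<And>l. l \<in> set ls \<Longrightarrow> l \<le> c"
  defines "P \<equiv> Pi_lyndon q m * prod_list (map (Pi_lyndon q) ls)"
  shows "(\<forall>l. lyndon l \<longrightarrow> pairing (Sigma_word q l) P = (if l = m @ concat ls then 1 else 0)) \<and>
    (\<forall>x. pairing (Sigma_word q x) P \<noteq> 0 \<longrightarrow> x \<noteq> [] \<and> (\<forall>f\<in>set (fac x). f \<le> c))"
  unfolding P_def
  using assms(1-5)
proof (induction ls arbitrary: m c)
  case Nil
  then show ?case
    using pairing_Sigma_Pi[of q _ m] lyndon_not_Nil[of m] by (auto simp: Pi_word_lyndon fac_lyndon)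
next
  case (Cons l ls)
  have d: "lyndon l" "declyn ls" "\<And>x. x \<in> set ls \<Longrightarrow> x \<le> l"
    using Cons.prems(2) by (auto simp: declyn_Cons)
  show ?case
  proof (cases "m < l")
    case False
    then have "declyn (m # l # ls)" using Cons.prems(1,2) by (fastforce simp: declyn_Cons)
    then have "Pi_lyndon q m * prod_list (map (Pi_lyndon q) (l # ls)) = Pi_word q (m @ concat (l # ls))"
      "fac (m @ concat (l # ls)) = m # l # ls"
      using Pi_word_concat[of "m # l # ls" q] fac_concat[of "m # l # ls"] by simp_all
    then show ?thesis
      using Cons.prems lyndon_not_Nil[of m] by (auto simp: pairing_Sigma_Pi simp del: concat.simps)
  next
    case True
    \<comment> \<open>The hypothesis on the head of the list, here \<open>l\<close>, is exactly the
      criterion for \<open>(m, l)\<close> to be the standard factorization of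
      \<open>m @ l\<close>.\<close>
    have split: "std_split (m @ l) = length m"
      using Cons.prems d True by (intro std_split_append) auto
    have ml: "lyndon (m @ l)" using Cons.prems(1) d(1) True by (rule lyndon_append)
    have len: "2 \<le> length (m @ l)"
      using lyndon_not_Nil[OF Cons.prems(1)] lyndon_not_Nil[OF d(1)] by (cases m; cases l) auto
    have lt: "m @ l < l" using lyndon_suffix[OF ml] Cons.prems(1) d(1) lyndon_not_Nil by blast
    have br: "Pi_lyndon q m * Pi_lyndon q l = Pi_lyndon q (m @ l) + Pi_lyndon q l * Pi_lyndon q m"
      using Pi_lyndon_split[OF len refl refl, of q] by (simp add: split)
    let ?v = "prod_list (map (Pi_lyndon q) ls)"
    have P: "Pi_lyndon q m * prod_list (map (Pi_lyndon q) (l # ls)) =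
        Pi_lyndon q (m @ l) * ?v + Pi_lyndon q l * (Pi_lyndon q m * ?v)"
      by (simp add: mult.assoc[symmetric] br distrib_right)
    have hd: "hd ls \<le> l" if "ls \<noteq> []" using d(3) that by simp
    have IH1: "(\<forall>x. lyndon x \<longrightarrow> pairing (Sigma_word q x) (Pi_lyndon q (m @ l) * ?v) =
        (if x = (m @ l) @ concat ls then 1 else 0)) \<and>
      (\<forall>x. pairing (Sigma_word q x) (Pi_lyndon q (m @ l) * ?v) \<noteq> 0 \<longrightarrow> x \<noteq> [] \<and> (\<forall>f\<in>set (fac x). f \<le> c))"
      using d ml lt Cons.prems(5) hd by (intro Cons.IH) (auto simp: split intro: order_trans less_imp_le)
    \<comment> \<open>The bound \<open>c\<close> is lowered to \<open>l\<close> here, so that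
      \<open>Pi_lyndon q l\<close> may stand in front of the result.\<close>
    have IH2: "\<forall>x. pairing (Sigma_word q x) (Pi_lyndon q m * ?v) \<noteq> 0 \<longrightarrow> x \<noteq> [] \<and> (\<forall>f\<in>set (fac x). f \<le> l)"
    proof (rule Cons.IH[THEN conjunct2])
      show "hd ls \<le> drop (std_split m) m" if "2 \<le> length m" "ls \<noteq> []"
        using order_trans[OF hd[OF that(2)]] Cons.prems(3)[OF that(1)] by simp
    qed (use Cons.prems(1) d True in auto)
    have Q: "2 \<le> length (fac x) \<and> (\<forall>f\<in>set (fac x). f \<le> l)"
      if "pairing (Sigma_word q x) (Pi_lyndon q l * (Pi_lyndon q m * ?v)) \<noteq> 0" for x
      by (rule pairing_Sigma_Pi_lyndon_mult[OF d(1) _ that]) (use IH2 in blast)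
    have "l \<le> c" using Cons.prems(5) by simp
    show ?thesis
      unfolding P pairing_add_right
    proof (rule conjI; intro allI impI)
      fix x assume x: "lyndon x"
      then have "pairing (Sigma_word q x) (Pi_lyndon q l * (Pi_lyndon q m * ?v)) = 0"
        using Q[of x] by (auto simp: lyndon_iff_length_fac)
      then show "pairing (Sigma_word q x) (Pi_lyndon q (m @ l) * ?v) +
          pairing (Sigma_word q x) (Pi_lyndon q l * (Pi_lyndon q m * ?v)) =
        (if x = m @ concat (l # ls) then 1 else 0)"
        using IH1 x by simp
    next
      fix x assume "pairing (Sigma_word q x) (Pi_lyndon q (m @ l) * ?v) +
          pairing (Sigma_word q x) (Pi_lyndon q l * (Pi_lyndon q m * ?v)) \<noteq> 0"
      then consider "pairing (Sigma_word q x) (Pi_lyndon q (m @ l) * ?v) \<noteq> 0"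
        | "pairing (Sigma_word q x) (Pi_lyndon q l * (Pi_lyndon q m * ?v)) \<noteq> 0" by fastforce
      then show "x \<noteq> [] \<and> (\<forall>f\<in>set (fac x). f \<le> c)"
      proof cases
        case 1
        then show ?thesis using IH1 by blast
      next
        case 2
        then show ?thesis using Q[OF 2] \<open>l \<le> c\<close> by force
      qed
    qed
  qed
qed

text \<open>Straightening with the letter \<open>b\<close> as the moving factor, for which the
  condition on standard factorizations is vacuous: the only possible Lyndon component of
  \<open>pi1 q [b] * Pi_word q v\<close> is the one at \<open>b # v\<close>, with coefficient
  1.\<close>

lemma pairing_Sigma_lyndon_letter_mult:
  assumes "lyndon (a # u)"
  shows "pairing (Sigma_word q (a # u)) (pi1 q [b] * X) = (if a = b then pairing (Sigma_word q u) X else 0)"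
proof (induction X rule: dual_bases_induct[OF dual_bases_Pi_Sigma[of q]])
  case (2 c v)
  define C where "C = Max (insert [b] (set (fac v)))"
  have "\<forall>l. lyndon l \<longrightarrow> pairing (Sigma_word q l) (Pi_lyndon q [b] * prod_list (map (Pi_lyndon q) (fac v))) =
      (if l = [b] @ concat (fac v) then 1 else 0)"
    by (rule straighten[where c = C, THEN conjunct1]) (auto simp: C_def lyndon_letter)
  then have "pairing (Sigma_word q (a # u)) (pi1 q [b] * Pi_word q v) = (if a # u = b # v then 1 else 0)"
    using assms by (simp add: Pi_word_eq Pi_lyndon_letter)
  then show ?case by (simp add: scl_mult_right pairing_scl_right pairing_Sigma_Pi)
qed (simp_all add: distrib_left pairing_add_right)

section \<open>Functions of q given by polynomials with nonnegative rational coefficients\<close>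

definition pos_fun :: "('k::rat_comm_algebra_1 \<Rightarrow> 'k) \<Rightarrow> bool" where
  "pos_fun f \<longleftrightarrow> (\<exists>p :: rat poly. (\<forall>i. 0 \<le> poly.coeff p i) \<and> (\<forall>q. f q = poly (map_poly of_Q p) q))"

lemma poly_of_Q_pCons: "poly (map_poly of_Q (pCons a p)) q = of_Q a + q * poly (map_poly of_Q p) q"
  by (simp add: map_poly_pCons)

lemma poly_of_Q_add:
  "poly (map_poly of_Q (p + r)) q = poly (map_poly of_Q p) q + poly (map_poly of_Q r) q"
  by (induction p r rule: poly_induct2) (simp_all add: poly_of_Q_pCons of_Q_add algebra_simps)

lemma poly_of_Q_smult: "poly (map_poly of_Q (smult a p)) q = of_Q a * poly (map_poly of_Q p) q"
  by (induction p) (simp_all add: poly_of_Q_pCons of_Q_mult algebra_simps)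

lemma poly_of_Q_mult:
  "poly (map_poly of_Q (p * r)) q = poly (map_poly of_Q p) q * poly (map_poly of_Q r) q"
  by (induction p) (simp_all add: poly_of_Q_pCons poly_of_Q_add poly_of_Q_smult algebra_simps)

lemma pos_fun_const: "0 \<le> r \<Longrightarrow> pos_fun (\<lambda>_. of_Q r)"
  unfolding pos_fun_def
  by (intro exI[of _ "[:r:]"]) (auto simp: poly_of_Q_pCons coeff_pCons split: nat.splits)

lemma pos_fun_0: "pos_fun (\<lambda>_. 0)" and pos_fun_1: "pos_fun (\<lambda>_. 1)"
  using pos_fun_const[of 0] pos_fun_const[of 1] by simp_all

lemma pos_fun_id: "pos_fun (\<lambda>q. q)"
  unfolding pos_fun_def
  by (intro exI[of _ "[:0, 1:]"]) (auto simp: poly_of_Q_pCons coeff_pCons split: nat.splits)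

lemma pos_fun_add: "pos_fun f \<Longrightarrow> pos_fun g \<Longrightarrow> pos_fun (\<lambda>q. f q + g q)"
  unfolding pos_fun_def
proof (elim exE conjE)
  fix p r assume "\<forall>i. 0 \<le> poly.coeff p i" "\<forall>q. f q = poly (map_poly of_Q p) q"
    "\<forall>i. 0 \<le> poly.coeff r i" "\<forall>q. g q = poly (map_poly of_Q r) q"
  then show "\<exists>p. (\<forall>i. 0 \<le> poly.coeff p i) \<and> (\<forall>q. f q + g q = poly (map_poly of_Q p) q)"
    by (intro exI[of _ "p + r"]) (simp add: poly_of_Q_add)
qed

lemma pos_fun_mult: "pos_fun f \<Longrightarrow> pos_fun g \<Longrightarrow> pos_fun (\<lambda>q. f q * g q)"
  unfolding pos_fun_def
proof (elim exE conjE)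
  fix p r assume "\<forall>i. 0 \<le> poly.coeff p i" "\<forall>q. f q = poly (map_poly of_Q p) q"
    "\<forall>i. 0 \<le> poly.coeff r i" "\<forall>q. g q = poly (map_poly of_Q r) q"
  then show "\<exists>p. (\<forall>i. 0 \<le> poly.coeff p i) \<and> (\<forall>q. f q * g q = poly (map_poly of_Q p) q)"
    by (intro exI[of _ "p * r"]) (simp add: poly_of_Q_mult Polynomial.coeff_mult sum_nonneg)
qed

lemma pos_fun_power: "pos_fun f \<Longrightarrow> pos_fun (\<lambda>q. f q ^ n)"
  by (induction n) (auto intro: pos_fun_1 pos_fun_mult)

lemma pos_fun_sum: "(\<And>i. i \<in> A \<Longrightarrow> pos_fun (f i)) \<Longrightarrow> pos_fun (\<lambda>q. \<Sum>i\<in>A. f i q)"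
  by (induction A rule: infinite_finite_induct) (auto intro: pos_fun_0 pos_fun_add)

lemma pos_fun_sum_list: "(\<And>x. x \<in> set xs \<Longrightarrow> pos_fun (f x)) \<Longrightarrow> pos_fun (\<lambda>q. \<Sum>x\<leftarrow>xs. f x q)"
  by (induction xs) (auto intro: pos_fun_0 pos_fun_add)

lemma pos_fun_if: "(b \<Longrightarrow> pos_fun f) \<Longrightarrow> (\<not> b \<Longrightarrow> pos_fun g) \<Longrightarrow> pos_fun (\<lambda>q. if b then f q else g q)"
  by (cases b) auto

lemma rational_positive_iff: "rational_positive F \<longleftrightarrow> (\<forall>v. pos_fun (\<lambda>q. coeff_at (F q) v))"
  by (simp add: rational_positive_def pos_fun_def)

text \<open>For Lyndon \<open>w\<close> the leading letter is stripped from both sides. Otherwise,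
  if \<open>w\<close> is nonempty, \<open>Sigma_word q w\<close> is a positive rational multiple of
  a stuffle product of two others, over which the primitive factors \<open>pi1 q [a]\<close> are
  distributed by \<open>splits\<close>.\<close>

lemma pos_fun_pairing_Sigma_prod_pi1:
  "pos_fun (\<lambda>q. pairing (Sigma_word q w) (pi1_word q K))"
proof (induction "length K" arbitrary: w K rule: less_induct)
  case less
  have Nil: "pairing (Sigma_word q w) (pi1_word q []) = (if w = [] then 1 else 0)"
    for w and q :: 'a
    using pairing_Sigma_Pi[of q w "[]"] by (auto simp: Pi_word_eq)
  show ?case
  proof (cases K)
    case Nil': Nil
    then show ?thesis using Nil[of _ w] by (auto intro: pos_fun_0 pos_fun_1)
  next
    case K: (Cons b K')
    show ?thesis
    proof (cases "lyndon w")
      case True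
      then obtain a u where w: "w = a # u" using lyndon_not_Nil by (cases w) auto
      have "pairing (Sigma_word q w) (pi1_word q K) =
          (if a = b then pairing (Sigma_word q u) (pi1_word q K') else 0)" for q :: 'a
        using True unfolding w K by (simp add: pairing_Sigma_lyndon_letter_mult)
      moreover have "pos_fun (\<lambda>q :: 'a. pairing (Sigma_word q u) (pi1_word q K'))"
        using K by (intro less) simp
      ultimately show ?thesis by (simp add: pos_fun_if pos_fun_0)
    next
      case False
      show ?thesis
      proof (cases "fac w")
        case F: Nil
        have "pairing (Sigma_word q w) (pi1_word q K) = 0" for q :: 'a
          using F by (simp add: K Sigma_Nil pairing_one coeff_mult coeff_pi1_letter log_coeff_def)
        then show ?thesis by (simp add: pos_fun_0)
      next
        case F: (Cons l ls)
        let ?w' = "concat ls"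
        have ne: "ls \<noteq> []" using False F by (auto simp: lyndon_iff_length_fac)
        have l: "l \<noteq> []" "?w' \<noteq> []"
          using ne declyn_fac[of w] F by (cases ls; auto simp: declyn_Cons lyndon_not_Nil)+
        let ?f = "\<lambda>q w K. pairing (Sigma_word q w) (pi1_word q K) :: 'a"
        \<comment> \<open>The ratio of factorials comes from passing from \<open>Sigma_word\<close>
          to \<open>sigma\<close> and back; it is the reciprocal of the multiplicity of
          \<open>l\<close> in \<open>fac w\<close>.\<close>
        let ?c = "1 / of_nat (mfact (facm w)) * of_nat (mfact (facm ?w')) :: rat"
        have e: "?f q w K = of_Q ?c * (\<Sum>p\<leftarrow>splits K. ?f q l (fst p) * ?f q ?w' (snd p))" for q
        proof -
          have prim: "P \<in> set (map (\<lambda>a. pi1 q [a]) K) \<Longrightarrow> primitive q P" for P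
            by (auto simp: primitive_pi1_letter)
          have "Sigma_word q w = scl (of_Q (1 / of_nat (mfact (facm w))))
              (stuffle q (Sigma_word q l) (scl (of_nat (mfact (facm ?w'))) (Sigma_word q ?w')))"
            unfolding Sigma_eq_sigma[of q w] sigma_Cons(1)[OF F] by (simp add: sigma_def)
          then have "Sigma_word q w = scl (of_Q ?c) (stuffle q (Sigma_word q l) (Sigma_word q ?w'))"
            unfolding of_Q_mult of_Q_of_nat stuffle_scl_right scl_scl .
          moreover have "pairing (stuffle q (Sigma_word q l) (Sigma_word q ?w')) (pi1_word q K)
              = (\<Sum>p\<leftarrow>splits K. ?f q l (fst p) * ?f q ?w' (snd p))"
            by (subst pairing_stuffle_prod_list) (use prim in \<open>simp_all add: splits_map o_def case_prod_unfold\<close>)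
          ultimately show ?thesis by (simp add: pairing_scl_left)
        qed
        have lens: "length S + length T = length xs" if "(S, T) \<in> set (splits xs)" for S T and xs :: word
          using that by (induction xs arbitrary: S T) auto
        have "pos_fun (\<lambda>q. ?f q l (fst p) * ?f q ?w' (snd p))" if p: "p \<in> set (splits K)" for p
        \<comment> \<open>A split with an empty part contributes nothing, as \<open>l\<close> and
          \<open>?w'\<close> are nonempty; in every other split both parts are shorter than
          \<open>K\<close>.\<close>
        proof (cases "fst p = [] \<or> snd p = []")
          case True
          then have "?f q l (fst p) * ?f q ?w' (snd p) = 0" for q
            using Nil[of q l] Nil[of q ?w'] l by auto
          then show ?thesis by (simp only: pos_fun_0)
        next
          case False
          have "length (fst p) + length (snd p) = length K" using p lens[of "fst p" "snd p" K] by simp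
          moreover have "0 < length (fst p)" "0 < length (snd p)" using False by auto
          ultimately have "length (fst p) < length K" "length (snd p) < length K" by linarith+
          then show ?thesis using less by (intro pos_fun_mult) blast+
        qed
        then have "pos_fun (\<lambda>q. \<Sum>p\<leftarrow>splits K. ?f q l (fst p) * ?f q ?w' (snd p))"
          by (rule pos_fun_sum_list)
        then show ?thesis unfolding e by (intro pos_fun_mult pos_fun_const) simp_all
      qed
    qed
  qed
qed

text \<open>The members are functions of \<open>q\<close>, since both the scalars and the products
  of the \<open>pi1 q [a]\<close> vary with \<open>q\<close>.\<close>

inductive_set pos_comb :: "('k::rat_comm_algebra_1 \<Rightarrow> 'k ncpoly) set" where
  prod: "(\<lambda>q. pi1_word q w) \<in> pos_comb"
| zero: "(\<lambda>_. 0) \<in> pos_comb"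
| add: "F \<in> pos_comb \<Longrightarrow> G \<in> pos_comb \<Longrightarrow> (\<lambda>q. F q + G q) \<in> pos_comb"
| scale: "pos_fun c \<Longrightarrow> F \<in> pos_comb \<Longrightarrow> (\<lambda>q. scl (c q) (F q)) \<in> pos_comb"

lemma pos_comb_mult:
  assumes "F \<in> pos_comb" "G \<in> pos_comb"
  shows "(\<lambda>q. F q * G q) \<in> pos_comb"
  using assms(1)
proof (induction rule: pos_comb.induct)
  case (prod u)
  show ?case using assms(2)
  proof (induction rule: pos_comb.induct)
    case (prod v)
    show ?case using pos_comb.prod[of "u @ v"] by simp
  qed (auto simp: distrib_left scl_mult_right intro: pos_comb.intros)
qed (auto simp: distrib_right scl_mult_left intro: pos_comb.intros)

lemma pos_comb_sum: "(\<And>i. i \<in> A \<Longrightarrow> F i \<in> pos_comb) \<Longrightarrow> (\<lambda>q. \<Sum>i\<in>A. F i q) \<in> pos_comb"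
  by (induction A rule: infinite_finite_induct) (auto intro: pos_comb.intros)

lemma pos_fun_pairing_Sigma: "F \<in> pos_comb \<Longrightarrow> pos_fun (\<lambda>q. pairing (Sigma_word q w) (F q))"
  by (induction rule: pos_comb.induct)
    (auto simp: pairing_simps intro: pos_fun_pairing_Sigma_prod_pi1 pos_fun_0 pos_fun_add pos_fun_mult)

text \<open>
  With \<open>G = \<Sum>\<^sub>k y\<^sub>k t\<^sup>k\<close> and \<open>p = \<Sum>\<^sub>k \<pi>\<^sub>1(y\<^sub>k) t\<^sup>k\<close>, the definition of \<open>\<pi>\<^sub>1\<close> reads
  \<open>1 + q G = exp (q p)\<close>; the factors \<open>q\<close> are distributed so that no division by \<open>q\<close> occurs.
\<close>

definition letter_series :: "'k::rat_comm_algebra_1 ncpoly fps" where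
  "letter_series = Abs_fps (\<lambda>k. if k = 0 then 0 else wd [y k])"

definition pi1_series :: "'k::rat_comm_algebra_1 \<Rightarrow> 'k ncpoly fps" where
  "pi1_series q = Abs_fps (\<lambda>k. if k = 0 then 0 else pi1 q [y k])"

lemma letter_series_nth: "fps_nth letter_series k = (if k = 0 then 0 else wd [y k])"
  by (simp add: letter_series_def)

lemma coeff_letter_series_power:
  "coeff_at (fps_nth (letter_series ^ N) k :: 'k::rat_comm_algebra_1 ncpoly) v = (if length v = N \<and> weight v = k then 1 else 0)"
proof (induction N arbitrary: k v)
  case 0
  then show ?case by (auto simp: coeff_one)
next
  case (Suc N)
  have c: "coeff_at (fps_nth (letter_series ^ Suc N) k :: 'k ncpoly) v =
      (\<Sum>i=0..k. coeff_at (fps_nth letter_series i * fps_nth (letter_series ^ N) (k - i)) v)" for v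
    by (simp add: fps_mult_nth lookup_sum)
  show ?case
  proof (cases v)
    case Nil
    then show ?thesis
      unfolding c by (auto simp: letter_series_nth coeff_letter_mult_Nil intro!: sum.neutral)
  next
    case (Cons a w)
    have "coeff_at (fps_nth letter_series i * fps_nth (letter_series ^ N) (k - i) :: 'k ncpoly) (a # w) =
        (if i = index a then if length w = N \<and> weight w = k - index a then 1 else 0 else 0)" for i
    proof (cases "i = 0")
      case False
      then have "y i = a \<longleftrightarrow> i = index a" by (metis index_y y_index neq0_conv)
      then show ?thesis using False by (auto simp: letter_series_nth coeff_letter_mult_Cons Suc.IH)
    qed (simp add: letter_series_nth)
    then show ?thesis unfolding c Cons by auto
  qed
qed

lemma letter_series_power_eq_0: "k < N \<Longrightarrow> fps_nth (letter_series ^ N) k = 0"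
  by (rule startsby_zero_power_prefix[rule_format]) (simp_all add: letter_series_def)

text \<open>Formally the coefficient of \<open>G^N\<close> in
  \<open>p^j = (log (1 + q G) / q)^j\<close>, with \<open>q^N / q^j\<close> written as
  \<open>q ^ (N - j)\<close>. Truncation of the exponent is harmless because
  \<open>log (1 + t)^j\<close> starts at \<open>t^j\<close>.\<close>

definition log_power_coeff :: "'k::rat_comm_algebra_1 \<Rightarrow> nat \<Rightarrow> nat \<Rightarrow> 'k" where
  "log_power_coeff q j N = of_Q (fps_nth (fps_ln 1 ^ j) N) * q ^ (N - j)"

lemma log_power_coeff_1: "log_power_coeff q 1 N = of_Q (log_coeff N) * q ^ (N - 1)"
  by (simp add: log_power_coeff_def fps_ln_nth log_coeff_def)

lemma fps_ln_power_eq_0: "N < j \<Longrightarrow> fps_nth (fps_ln (1 :: rat) ^ j) N = 0"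
  by (rule startsby_zero_power_prefix[rule_format]) simp_all

lemma of_Q_sum: "of_Q (sum f A) = (\<Sum>i\<in>A. of_Q (f i))"
  by (induction A rule: infinite_finite_induct) (simp_all add: of_Q_add)

lemma log_power_coeff_Suc:
  "log_power_coeff q (Suc j) S = (\<Sum>M=0..S. log_power_coeff q 1 M * log_power_coeff q j (S - M))"
proof -
  have "log_power_coeff q 1 M * log_power_coeff q j (S - M) =
    of_Q (fps_nth (fps_ln 1) M * fps_nth (fps_ln 1 ^ j) (S - M)) * q ^ (S - Suc j)" if "M \<le> S" for M
  proof -
    let ?c = "fps_nth (fps_ln (1 :: rat)) M * fps_nth (fps_ln 1 ^ j) (S - M)"
    have "log_power_coeff q 1 M * log_power_coeff q j (S - M) =
        of_Q ?c * q ^ ((M - 1) + (S - M - j))"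
      unfolding power_add by (simp add: log_power_coeff_def of_Q_mult ac_simps)
    also have "\<dots> = of_Q ?c * q ^ (S - Suc j)"
    \<comment> \<open>Where the truncated exponents may fail to add up, one of the two logarithm
      coefficients is 0.\<close>
    proof (cases "M = 0 \<or> S - M < j")
      case True
      then have "?c = 0" using fps_ln_power_eq_0 by fastforce
      then show ?thesis by (simp only: of_Q_0 mult_zero_left)
    next
      case False
      then have "S - Suc j = (M - 1) + (S - M - j)" using that by linarith
      then show ?thesis by simp
    qed
    finally show ?thesis .
  qed
  then show ?thesis
    by (simp add: log_power_coeff_def[of q "Suc j"] fps_mult_nth of_Q_sum sum_distrib_right)
qed

lemma pi1_series_nth:
  "fps_nth (pi1_series q) k = (\<Sum>N=0..k. scl (log_power_coeff q 1 N) (fps_nth (letter_series ^ N) k))"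
proof (rule poly_mapping_eqI)
  fix v
  have "coeff_at (\<Sum>N=0..k. scl (log_power_coeff q 1 N) (fps_nth (letter_series ^ N) k)) v =
      (\<Sum>N=0..k. if N = length v then if weight v = k then log_power_coeff q 1 N else 0 else 0)"
    unfolding lookup_sum lookup_scl coeff_letter_series_power by (intro sum.cong) auto
  also have "\<dots> = (if weight v = k then log_power_coeff q 1 (length v) else 0)"
    using length_le_weight[of v] by auto
  also have "\<dots> = coeff_at (fps_nth (pi1_series q) k) v"
    unfolding log_power_coeff_1
    by (cases "k = 0") (auto simp: pi1_series_def coeff_pi1_letter index_y log_coeff_def)
  finally show "coeff_at (fps_nth (pi1_series q) k) v =
      coeff_at (\<Sum>N=0..k. scl (log_power_coeff q 1 N) (fps_nth (letter_series ^ N) k)) v" ..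
qed

text \<open>Powers of the single series \<open>G\<close> multiply as in one commuting variable, and
  scalars are central, so the univariate computation applies although letters do not commute. All
  ranges stop at \<open>k\<close> because \<open>G^N\<close> starts in degree
  \<open>N\<close>.\<close>

lemma pi1_series_power_nth:
  "fps_nth (pi1_series q ^ j) k = (\<Sum>N=0..k. scl (log_power_coeff q j N) (fps_nth (letter_series ^ N) k))"
proof (induction j arbitrary: k)
  case 0
  have "fps_nth (1 :: 'a ncpoly fps) k =
      (\<Sum>N=0..k. if N = 0 then fps_nth (1 :: 'a ncpoly fps) k else 0)" by simp
  also have "\<dots> = (\<Sum>N=0..k. scl (log_power_coeff q 0 N) (fps_nth (letter_series ^ N) k))"
    by (intro sum.cong) (auto simp: log_power_coeff_def)
  finally show ?case by simp
next
  case (Suc j)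
  let ?G = "letter_series :: 'a ncpoly fps"
  let ?c = "\<lambda>M N. log_power_coeff q 1 M * log_power_coeff q j N"
  have ext: "(\<Sum>N=0..i. scl (c N) (fps_nth (?G ^ N) i)) = (\<Sum>N=0..k. scl (c N) (fps_nth (?G ^ N) i))"
    if "i \<le> k" for i c
    using that by (intro sum.mono_neutral_left) (auto simp: letter_series_power_eq_0)
  have "fps_nth (pi1_series q ^ Suc j) k =
      (\<Sum>i=0..k. (\<Sum>M=0..k. scl (log_power_coeff q 1 M) (fps_nth (?G ^ M) i)) *
        (\<Sum>N=0..k. scl (log_power_coeff q j N) (fps_nth (?G ^ N) (k - i))))"
    unfolding power_Suc fps_mult_nth Suc pi1_series_nth by (intro sum.cong refl arg_cong2[where f = "(*)"] ext) auto
  also have "\<dots> = (\<Sum>i=0..k. \<Sum>M=0..k. \<Sum>N=0..k. scl (?c M N) (fps_nth (?G ^ M) i * fps_nth (?G ^ N) (k - i)))"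
    by (simp add: sum_product scl_mult_left scl_mult_right mult.commute)
  also have "\<dots> = (\<Sum>M=0..k. \<Sum>N=0..k. \<Sum>i=0..k. scl (?c M N) (fps_nth (?G ^ M) i * fps_nth (?G ^ N) (k - i)))"
    by (subst sum.swap) (intro sum.cong refl sum.swap)
  also have "\<dots> = (\<Sum>M=0..k. \<Sum>N=0..k. scl (?c M N) (fps_nth (?G ^ (M + N)) k))"
    by (simp add: power_add fps_mult_nth ncp.scale_sum_right)
  also have "\<dots> = (\<Sum>M=0..k. \<Sum>S=M..k. scl (?c M (S - M)) (fps_nth (?G ^ S) k))"
  proof (rule sum.cong[OF refl])
    fix M assume M: "M \<in> {0..k}"
    have "(\<Sum>S=M..k. scl (?c M (S - M)) (fps_nth (?G ^ S) k)) =
        (\<Sum>N=0..k - M. scl (?c M N) (fps_nth (?G ^ (M + N)) k))"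
      using M by (intro sum.reindex_bij_witness[of _ "\<lambda>N. M + N" "\<lambda>S. S - M"]) auto
    also have "\<dots> = (\<Sum>N=0..k. scl (?c M N) (fps_nth (?G ^ (M + N)) k))"
      by (intro sum.mono_neutral_left) (auto simp: letter_series_power_eq_0)
    finally show "(\<Sum>N=0..k. scl (?c M N) (fps_nth (?G ^ (M + N)) k)) =
        (\<Sum>S=M..k. scl (?c M (S - M)) (fps_nth (?G ^ S) k))" ..
  qed
  also have "\<dots> = (\<Sum>S=0..k. \<Sum>M=0..S. scl (?c M (S - M)) (fps_nth (?G ^ S) k))"
    by (subst (1 2) sum.Sigma) (auto intro!: sum.reindex_bij_witness[of _ "\<lambda>(S, M). (M, S)" "\<lambda>(M, S). (S, M)"])
  also have "\<dots> = (\<Sum>S=0..k. scl (log_power_coeff q (Suc j) S) (fps_nth (?G ^ S) k))"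
    unfolding log_power_coeff_Suc ncp.scale_sum_left ..
  finally show ?case .
qed

text \<open>This compares \<open>exp (log (1 + t)) - 1 = t\<close> at \<open>t^N\<close>. The upper
  bound \<open>k\<close> in place of \<open>N\<close> adds only zeros and lets one range serve all
  \<open>N \<le> k\<close>.\<close>

lemma sum_exp_ln:
  assumes "N \<le> k"
  shows "(\<Sum>j=1..k. (1 / fact j) * fps_nth (fps_ln (1 :: rat) ^ j) N) = (if N = 1 then 1 else 0)"
proof -
  have "(fps_exp (1 :: rat) - 1) oo fps_ln 1 = fps_X"
    unfolding fps_ln_fps_exp_inv[OF one_neq_zero] by (rule fps_inv_right) simp_all
  then have "(if N = 1 then 1 else 0) = fps_nth ((fps_exp (1 :: rat) - 1) oo fps_ln 1) N" by simp
  also have "\<dots> = (\<Sum>j=0..N. fps_nth (fps_exp (1 :: rat) - 1) j * fps_nth (fps_ln (1 :: rat) ^ j) N)"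
    by (rule fps_compose_nth)
  also have "\<dots> = (\<Sum>j=0..k. fps_nth (fps_exp (1 :: rat) - 1) j * fps_nth (fps_ln (1 :: rat) ^ j) N)"
    using assms fps_ln_power_eq_0 by (intro sum.mono_neutral_left) auto
  also have "\<dots> = (\<Sum>j=1..k. fps_nth (fps_exp (1 :: rat) - 1) j * fps_nth (fps_ln (1 :: rat) ^ j) N)"
    by (intro sum.mono_neutral_right) auto
  also have "\<dots> = (\<Sum>j=1..k. (1 / fact j) * fps_nth (fps_ln (1 :: rat) ^ j) N)"
    by (intro sum.cong) auto
  finally show ?thesis ..
qed

text \<open>Degree \<open>k\<close> of \<open>G = (exp (q p) - 1) / q\<close>, whence the factor
  \<open>q ^ (j - 1)\<close>. After the powers of \<open>p\<close> are expanded in powers of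
  \<open>G\<close>, summing over \<open>j\<close> leaves only \<open>N = 1\<close>.\<close>

lemma letter_eq_exp_pi1:
  fixes q :: "'k::rat_comm_algebra_1"
  assumes "0 < k"
  shows "wd [y k] = (\<Sum>j=1..k. scl (of_Q (1 / fact j) * q ^ (j - 1)) (fps_nth (pi1_series q ^ j) k))"
proof -
  let ?G = "\<lambda>N. fps_nth (letter_series ^ N) k :: 'k ncpoly"
  let ?d = "\<lambda>j N. (1 / fact j) * fps_nth (fps_ln (1 :: rat) ^ j) N"
  have "scl (of_Q (1 / fact j) * q ^ (j - 1) * log_power_coeff q j N) (?G N) =
      scl (of_Q (?d j N) * q ^ (N - 1)) (?G N)" if "1 \<le> j" for j N
  proof (cases "N < j")
    case True
    then show ?thesis by (simp add: log_power_coeff_def fps_ln_power_eq_0)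
  next
    case False
    then have "N - 1 = (j - 1) + (N - j)" using that by simp
    then show ?thesis unfolding log_power_coeff_def of_Q_mult by (simp add: power_add ac_simps)
  qed
  then have "(\<Sum>j=1..k. scl (of_Q (1 / fact j) * q ^ (j - 1)) (fps_nth (pi1_series q ^ j) k)) =
      (\<Sum>j=1..k. \<Sum>N=0..k. scl (of_Q (?d j N) * q ^ (N - 1)) (?G N))"
    unfolding pi1_series_power_nth ncp.scale_sum_right scl_scl by (intro sum.cong refl) auto
  also have "\<dots> = (\<Sum>N=0..k. scl (of_Q (\<Sum>j=1..k. ?d j N) * q ^ (N - 1)) (?G N))"
    unfolding of_Q_sum sum_distrib_right ncp.scale_sum_left by (rule sum.swap)
  also have "\<dots> = (\<Sum>N=0..k. if N = 1 then ?G N else 0)"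
  proof (intro sum.cong refl)
    fix N assume "N \<in> {0..k}"
    then show "scl (of_Q (\<Sum>j=1..k. ?d j N) * q ^ (N - 1)) (?G N) = (if N = 1 then ?G N else 0)"
      by (subst sum_exp_ln) auto
  qed
  also have "\<dots> = wd [y k]" using assms by (simp add: letter_series_def)
  finally show ?thesis ..
qed

lemma pos_comb_wd: "(\<lambda>_. wd w) \<in> pos_comb"
proof (induction w)
  case Nil
  show ?case using pos_comb.prod[of "[]"] by (simp add: wd_Nil)
next
  case (Cons a w)
  have p: "(\<lambda>q. fps_nth (pi1_series q) i) \<in> pos_comb" for i
    using pos_comb.prod[of "[y i]"] by (cases "i = 0") (simp_all add: pi1_series_def pos_comb.zero)
  have pw: "(\<lambda>q. fps_nth (pi1_series q ^ j) k) \<in> pos_comb" for j k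
  proof (induction j arbitrary: k)
    case 0
    show ?case using pos_comb.prod[of "[]"] by (cases "k = 0") (simp_all add: pos_comb.zero)
  next
    case (Suc j)
    then show ?case by (auto simp: fps_mult_nth intro!: pos_comb_sum pos_comb_mult p)
  qed
  have "(\<lambda>q :: 'a. \<Sum>j=1..index a. scl (of_Q (1 / fact j) * q ^ (j - 1)) (fps_nth (pi1_series q ^ j) (index a)))
      \<in> pos_comb"
    by (intro pos_comb_sum pos_comb.scale pw pos_fun_mult pos_fun_const pos_fun_power pos_fun_id) simp
  also have "(\<lambda>q :: 'a. \<Sum>j=1..index a. scl (of_Q (1 / fact j) * q ^ (j - 1)) (fps_nth (pi1_series q ^ j) (index a))) =
      (\<lambda>_. wd [a])"
    by (rule ext) (subst letter_eq_exp_pi1[symmetric], simp_all add: y_index)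
  finally have "(\<lambda>_ :: 'a. wd [a]) \<in> pos_comb" .
  from pos_comb_mult[OF this Cons] show ?case by (simp add: wd_mult)
qed

lemma rational_positive_Sigma: "rational_positive (\<lambda>q. Sigma_word q w)"
  unfolding rational_positive_iff pairing_wd_right[symmetric]
  by (intro allI pos_fun_pairing_Sigma pos_comb_wd)

section \<open>Positivity of stuffle products and of chi\<close>

lemma pos_fun_stuffle_words: "pos_fun (\<lambda>q. coeff_at (stuffle_words q u v) w)"
proof (induction w arbitrary: u v)
  case Nil
  show ?case unfolding coeff_stuffle_words_Nil by (simp add: pos_fun_0 pos_fun_1)
next
  case (Cons c w)
  show ?case
    by (cases u; cases v; simp only: coeff_stuffle_words_Cons)
      (intro pos_fun_add pos_fun_if pos_fun_mult pos_fun_id pos_fun_0 Cons)+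
qed

text \<open>The supports of \<open>F q\<close> and \<open>G q\<close> may change with
  \<open>q\<close>; homogeneity supplies finite index sets common to all \<open>q\<close>.\<close>

lemma rational_positive_stuffle:
  assumes "rational_positive F" "rational_positive G"
    and "\<And>q. weight_homogeneous m (F q)" "\<And>q. weight_homogeneous n (G q)"
  shows "rational_positive (\<lambda>q. stuffle q (F q) (G q))"
  unfolding rational_positive_iff
proof
  fix w
  have "coeff_at (stuffle q (F q) (G q)) w = (\<Sum>u\<in>words_of_weight m. \<Sum>v\<in>words_of_weight n.
      coeff_at (F q) u * coeff_at (G q) v * coeff_at (stuffle_words q u v) w)" for q
    using assms(3,4)[of q]
    by (subst stuffle_eq_sum[of "words_of_weight m" "words_of_weight n"])
      (auto simp: weight_homogeneous_def lookup_sum lookup_scl)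
  then show "pos_fun (\<lambda>q. coeff_at (stuffle q (F q) (G q)) w)"
    using assms(1,2) unfolding rational_positive_iff
    by (auto intro!: pos_fun_sum pos_fun_mult pos_fun_stuffle_words)
qed

lemma rational_positive_wd: "rational_positive (\<lambda>_. wd w)"
  unfolding rational_positive_iff by (auto simp: coeff_wd pos_fun_0 pos_fun_1)

lemma rational_positive_chi: "rational_positive (\<lambda>q. chi q w)"
proof -
  have "rational_positive (\<lambda>q :: 'a. stuffle_list q (map wd ls))" for ls
  proof (induction ls)
    case (Cons l ls)
    show ?case
      using rational_positive_stuffle[OF rational_positive_wd Cons homogeneous_wd homogeneous_stuffle_list]
      by simp
  qed (simp add: rational_positive_wd)
  then show ?thesis
    unfolding rational_positive_iff chi_eq lookup_scl lyndon_product_def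
    by (intro allI pos_fun_mult pos_fun_const) auto
qed

section \<open>Factorization of the diagonal series\<close>

lemma double_sums_diagonal:
  assumes "dual_bases B S"
  shows "double_sums (\<lambda>w. tensor (S w) (B w)) diagonal"
  unfolding double_sums_def
proof (intro allI conjI)
  fix u v
  have sub: "{w. tensor (S w) (B w) u v \<noteq> 0} \<subseteq> words_of_weight (weight u)"
  proof
    fix w assume "w \<in> {w. tensor (S w) (B w) u v \<noteq> 0}"
    then have "coeff_at (S w) u \<noteq> 0" by (auto simp: tensor_def)
    then show "w \<in> words_of_weight (weight u)"
      using homogeneousD[OF dual_basesD(2)[OF assms]] by simp
  qed
  then show "finite {w. tensor (S w) (B w) u v \<noteq> 0}" by (rule finite_subset) simp
  have "(\<Sum>w | tensor (S w) (B w) u v \<noteq> 0. tensor (S w) (B w) u v) =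
      (\<Sum>w\<in>words_of_weight (weight u). tensor (S w) (B w) u v)"
    using sub by (intro sum.mono_neutral_left) auto
  also have "\<dots> = diagonal u v"
    using dual_basesD(4)[OF assms, of u v] by (simp add: tensor_def diagonal_def)
  finally show "(\<Sum>w | tensor (S w) (B w) u v \<noteq> 0. tensor (S w) (B w) u v) = diagonal u v" .
qed

text \<open>Only prefixes and suffixes of \<open>v\<close> enter the coefficient, so it is enough
  that both series agree there with finite sums of tensors. This reduces products in the completion
  to products of polynomials.\<close>

lemma dbl_mult_finite_sums:
  assumes "finite I" "finite J"
    and F: "\<And>k u. k \<le> length v \<Longrightarrow> F u (take k v) = (\<Sum>i\<in>I. coeff_at (a i) u * coeff_at (b i) (take k v))"
    and G: "\<And>k u. k \<le> length v \<Longrightarrow> G u (drop k v) = (\<Sum>j\<in>J. coeff_at (c j) u * coeff_at (d j) (drop k v))"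
  shows "dbl_mult q F G u v =
    (\<Sum>(i, j)\<in>I \<times> J. coeff_at (stuffle q (a i) (c j)) u * coeff_at (b i * d j) v)"
proof -
  define K where "K = (\<Union>i\<in>I. supp (a i))"
  define L where "L = (\<Union>j\<in>J. supp (c j))"
  have fin: "finite K" "finite L" using assms(1,2) by (auto simp: K_def L_def)
  have aK: "coeff_at (a i) w = 0" if "w \<notin> K" "i \<in> I" for w i
    using that by (auto simp: K_def in_keys_iff)
  have cL: "coeff_at (c j) w = 0" if "w \<notin> L" "j \<in> J" for w j
    using that by (auto simp: L_def in_keys_iff)
  let ?s = "\<lambda>(u1, u2). \<Sum>k\<le>length v. F u1 (take k v) * G u2 (drop k v) * coeff_at (stuffle_words q u1 u2) u"
  let ?t = "\<lambda>p k r. (case (p, r) of ((u1, u2), (i, j)) \<Rightarrow>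
      (coeff_at (a i) u1 * coeff_at (c j) u2 * coeff_at (stuffle_words q u1 u2) u) *
      (coeff_at (b i) (take k v) * coeff_at (d j) (drop k v)))"
  have supp: "p \<in> K \<times> L" if "?s p \<noteq> 0" for p
  proof (rule ccontr)
    assume "p \<notin> K \<times> L"
    then have "F (fst p) (take k v) * G (snd p) (drop k v) = 0" if "k \<le> length v" for k
      using that aK cL by (cases p) (auto simp: F G)
    then have "?s p = 0" by (cases p) auto
    then show False using that by simp
  qed
  have "dbl_mult q F G u v = Sum_any ?s" by (simp add: dbl_mult_def)
  also have "\<dots> = (\<Sum>p\<in>K \<times> L. ?s p)"
  proof (rule Sum_any.expand_superset)
    show "{p. ?s p \<noteq> 0} \<subseteq> K \<times> L" using supp by blast
  qed (use fin in simp)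
  also have "\<dots> = (\<Sum>p\<in>K \<times> L. \<Sum>k\<le>length v. \<Sum>r\<in>I \<times> J. ?t p k r)"
  proof (rule sum.cong[OF refl])
    fix p :: "word \<times> word"
    obtain u1 u2 where p: "p = (u1, u2)" by (cases p)
    have "F u1 (take k v) * G u2 (drop k v) * coeff_at (stuffle_words q u1 u2) u =
        (\<Sum>r\<in>I \<times> J. ?t (u1, u2) k r)" if "k \<le> length v" for k
      unfolding F[OF that] G[OF that] sum_product sum.cartesian_product
      unfolding sum_distrib_right by (intro sum.cong) (auto simp: ac_simps)
    then have "(\<Sum>k\<le>length v. F u1 (take k v) * G u2 (drop k v) * coeff_at (stuffle_words q u1 u2) u) =
        (\<Sum>k\<le>length v. \<Sum>r\<in>I \<times> J. ?t p k r)"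
      unfolding p by (intro sum.cong) auto
    then show "?s p = (\<Sum>k\<le>length v. \<Sum>r\<in>I \<times> J. ?t p k r)" by (simp only: p prod.case)
  qed
  also have "\<dots> = (\<Sum>r\<in>I \<times> J. \<Sum>p\<in>K \<times> L. \<Sum>k\<le>length v. ?t p k r)"
    by (subst sum.swap[of _ "I \<times> J"]) (rule sum.swap)
  also have "\<dots> = (\<Sum>(i, j)\<in>I \<times> J. coeff_at (stuffle q (a i) (c j)) u * coeff_at (b i * d j) v)"
  proof (rule sum.cong[OF refl])
    fix r assume "r \<in> I \<times> J"
    then obtain i j where r: "r = (i, j)" and ij: "i \<in> I" "j \<in> J" by auto
    have st: "coeff_at (stuffle q (a i) (c j)) u =
        (\<Sum>(u1, u2)\<in>K \<times> L. coeff_at (a i) u1 * coeff_at (c j) u2 * coeff_at (stuffle_words q u1 u2) u)"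
    proof -
      have "supp (a i) \<subseteq> K" "supp (c j) \<subseteq> L" using ij by (auto simp: K_def L_def)
      then show ?thesis
        by (subst stuffle_eq_sum[OF fin]) (simp_all add: lookup_sum lookup_scl sum.cartesian_product case_prod_unfold)
    qed
    have "(\<Sum>p\<in>K \<times> L. \<Sum>k\<le>length v. ?t p k r) =
        coeff_at (stuffle q (a i) (c j)) u * coeff_at (b i * d j) v"
      unfolding st coeff_mult sum_product r by (intro sum.cong refl) auto
    then show "(\<Sum>p\<in>K \<times> L. \<Sum>k\<le>length v. ?t p k r) =
        (case r of (i, j) \<Rightarrow> coeff_at (stuffle q (a i) (c j)) u * coeff_at (b i * d j) v)"
      by (simp only: r prod.case)
  qed
  finally show ?thesis .
qed

lemma dbl_pow_tensor: "dbl_pow q (tensor S P) n = tensor (stuffle_pow q S n) (P ^ n)"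
proof (induction n)
  case 0
  show ?case by (auto simp: dbl_one_def tensor_def stuffle_pow_def coeff_wd coeff_one)
next
  case (Suc n)
  show ?case
  proof (intro ext)
    fix u v
    have "dbl_mult q (tensor S P) (tensor (stuffle_pow q S n) (P ^ n)) u v =
        (\<Sum>(i, j)\<in>{()} \<times> {()}. coeff_at (stuffle q S (stuffle_pow q S n)) u * coeff_at (P * P ^ n) v)"
      by (rule dbl_mult_finite_sums) (simp_all add: tensor_def)
    also have "\<dots> = tensor (stuffle_pow q S (Suc n)) (P ^ Suc n) u v"
      by (simp add: tensor_def stuffle_pow_def)
    finally show "dbl_pow q (tensor S P) (Suc n) u v = tensor (stuffle_pow q S (Suc n)) (P ^ Suc n) u v"
      unfolding dbl_pow.simps Suc .
  qed
qed

text \<open>The part of the diagonal carried by words with all Lyndon factors in \<open>A\<close>.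
  The sum is made finite by keeping only words of the weight of \<open>v\<close>; the others vanish
  at \<open>v\<close> by homogeneity of \<open>Pi_word\<close>.\<close>

definition partial_diagonal :: "'k::rat_comm_algebra_1 \<Rightarrow> word set \<Rightarrow> 'k double_series" where
  "partial_diagonal q A = (\<lambda>u v. \<Sum>w | weight w = weight v \<and> set (fac w) \<subseteq> A.
     coeff_at (Sigma_word q w) u * coeff_at (Pi_word q w) v)"

lemma coeff_Pi_word_0: "weight w \<noteq> weight v \<Longrightarrow> coeff_at (Pi_word q w) v = 0"
  using homogeneous_coeff_0[OF upperD(1)[OF upper_Pi_word[of w q]], of v] by simp

lemma finite_words_weight_le: "finite {w. weight w \<le> N \<and> Q w}"
  by (rule finite_subset[of _ "\<Union>n\<le>N. words_of_weight n"]) auto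

lemma partial_diagonal_eq:
  assumes "finite W" "{w. weight w = weight v \<and> set (fac w) \<subseteq> A} \<subseteq> W"
    "\<And>w. w \<in> W \<Longrightarrow> weight w = weight v \<Longrightarrow> set (fac w) \<subseteq> A"
  shows "partial_diagonal q A u v =
    (\<Sum>w\<in>W. coeff_at (Sigma_word q w) u * coeff_at (Pi_word q w) v)"
  unfolding partial_diagonal_def
proof (rule sum.mono_neutral_left[OF assms(1,2)], rule ballI)
  fix w assume "w \<in> W - {w. weight w = weight v \<and> set (fac w) \<subseteq> A}"
  then have "weight w \<noteq> weight v" using assms(3) by blast
  then show "coeff_at (Sigma_word q w) u * coeff_at (Pi_word q w) v = 0" by (simp add: coeff_Pi_word_0)
qed

lemma partial_diagonal_empty: "partial_diagonal q {} = dbl_one"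
proof (intro ext)
  fix u v :: word
  have "{w. weight w = weight v \<and> set (fac w) \<subseteq> {}} = (if v = [] then {[]} else {})"
    by auto
  then show "partial_diagonal q {} u v = dbl_one u v"
    by (auto simp: partial_diagonal_def dbl_one_def Sigma_Nil coeff_one Pi_word_eq)
qed

lemma declyn_replicate: "lyndon l \<Longrightarrow> declyn (replicate n l)"
  by (induction n) (auto simp: declyn_Cons)

lemma mfact_replicate_mset: "mfact (replicate_mset n l) = fact n"
  using mfact_replicate[of l "{#}" n] by simp

lemma sigma_power:
  assumes "lyndon l"
  shows "sigma q (concat (replicate n l)) = stuffle_pow q (Sigma_word q l) n"
proof (induction n)
  case 0
  show ?case by (simp add: stuffle_pow_def sigma_def Sigma_Nil wd_Nil)
next
  case (Suc n)
  have "fac (concat (replicate (Suc n) l)) = l # replicate n l"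
    using fac_concat[OF declyn_replicate[OF assms, of "Suc n"]] by simp
  from sigma_Cons(1)[OF this, of q] show ?case using Suc by (simp add: stuffle_pow_def)
qed

lemma fac_subset_singleton:
  assumes "set (fac w) \<subseteq> {l}"
  shows "w = concat (replicate (length (fac w)) l)"
proof -
  have "fac w = replicate (length (fac w)) l" using assms by (intro replicate_eqI) auto
  then show ?thesis by (metis concat_fac)
qed

lemma weight_concat_replicate: "weight (concat (replicate n l)) = n * weight l"
  by (induction n) auto

lemma scaleQ_eq: "scaleQ r x = of_Q r * x"
  by (simp add: of_Q_def scaleQ_mult_left)

text \<open>The words with all factors equal to \<open>l\<close> are its powers, and the
  \<open>1 / fact n\<close> of the exponential is the divided power hidden in
  \<open>Sigma_word\<close> at the \<open>n\<close>-th power of \<open>l\<close>.\<close>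

lemma dbl_exp_eq_partial_diagonal:
  fixes q :: "'k::rat_comm_algebra_1"
  assumes "lyndon l"
  shows "dbl_exp q (tensor (Sigma_word q l) (Pi_word q l)) = partial_diagonal q {l}"
proof (intro ext)
  fix u v
  define w where "w n = concat (replicate n l)" for n
  let ?g = "\<lambda>w. coeff_at (Sigma_word q w) u * coeff_at (Pi_word q w) v"
  have fw: "fac (w n) = replicate n l" for n
    unfolding w_def by (rule fac_concat[OF declyn_replicate[OF assms]])
  have inj: "inj w" by (rule injI) (metis fw length_replicate)
  have ww: "weight (w n) = n * weight l" for n by (simp add: w_def weight_concat_replicate)
  have wl: "0 < weight l" using lyndon_not_Nil[OF assms] by (metis neq0_conv weight_eq_0_iff)
  have trm: "scaleQ (1 / fact n) (dbl_pow q (tensor (Sigma_word q l) (Pi_word q l)) n u v) = ?g (w n)" for n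
  proof -
    have "Pi_word q (w n) = Pi_word q l ^ n"
      by (simp add: Pi_word_eq fw Pi_word_lyndon[OF assms] fac_lyndon[OF assms] prod_list_replicate)
    moreover have "Sigma_word q (w n) = scl (of_Q (1 / fact n)) (stuffle_pow q (Sigma_word q l) n)"
      by (subst Sigma_eq_sigma) (simp add: fw mset_replicate mfact_replicate_mset w_def sigma_power[OF assms]
          fac_concat[OF declyn_replicate[OF assms]])
    ultimately show ?thesis
      unfolding dbl_pow_tensor by (simp add: tensor_def scaleQ_eq lookup_scl mult.assoc)
  qed
  have "dbl_exp q (tensor (Sigma_word q l) (Pi_word q l)) u v = Sum_any (\<lambda>n. ?g (w n))"
    by (simp only: dbl_exp_def trm)
  also have "\<dots> = (\<Sum>n\<in>{..weight v}. ?g (w n))"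
  proof (rule Sum_any.expand_superset)
    have "n \<le> weight v" if "?g (w n) \<noteq> 0" for n
    proof -
      have "weight (w n) = weight v" using that coeff_Pi_word_0[of "w n" v q] by fastforce
      then have "n * weight l = weight v" using ww by simp
      then show ?thesis using wl by (metis Suc_leI mult.right_neutral mult_le_mono2 One_nat_def)
    qed
    then show "{n. ?g (w n) \<noteq> 0} \<subseteq> {..weight v}" by blast
  qed simp
  also have "\<dots> = (\<Sum>x\<in>w ` {..weight v}. ?g x)"
    by (simp add: sum.reindex[OF inj_on_subset[OF inj subset_UNIV]])
  also have "\<dots> = partial_diagonal q {l} u v"
  proof (rule partial_diagonal_eq[symmetric])
    show "{x. weight x = weight v \<and> set (fac x) \<subseteq> {l}} \<subseteq> w ` {..weight v}"
    proof safe
      fix x assume x: "weight x = weight v" "set (fac x) \<subseteq> {l}"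
      have e: "x = w (length (fac x))" unfolding w_def by (rule fac_subset_singleton[OF x(2)])
      then have "length (fac x) * weight l = weight v" using ww x(1) by metis
      then have "length (fac x) \<le> weight v" using wl
        by (metis Suc_leI mult.right_neutral mult_le_mono2 One_nat_def)
      then show "x \<in> w ` {..weight v}" using e by blast
    qed
    show "\<And>x. x \<in> w ` {..weight v} \<Longrightarrow> set (fac x) \<subseteq> {l}" by (auto simp: fw)
  qed simp
  finally show "dbl_exp q (tensor (Sigma_word q l) (Pi_word q l)) u v = partial_diagonal q {l} u v" .
qed

lemma declyn_filter_max:
  "declyn ls \<Longrightarrow> (\<And>m. m \<in> set ls \<Longrightarrow> m \<le> l) \<Longrightarrow> ls = filter (\<lambda>m. m = l) ls @ filter (\<lambda>m. m \<noteq> l) ls"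
proof (induction ls)
  case (Cons m ls)
  show ?case
  proof (cases "m = l")
    case False
    then have "m < l" using Cons.prems(2)[of m] by simp
    then have "x \<noteq> l" if "x \<in> set ls" for x
      using Cons.prems(1) that by (auto simp: declyn_Cons)
    then have "filter (\<lambda>m. m = l) ls = []" "filter (\<lambda>m. m \<noteq> l) ls = ls"
      by (auto simp: filter_empty_conv filter_id_conv)
    then show ?thesis using False by simp
  qed (use Cons in \<open>auto simp: declyn_Cons\<close>)
qed simp

text \<open>The two multisets of factors are disjoint, so their factorials multiply and no
  coefficient remains in the stuffle product; the order condition makes concatenation agree with
  \<open>merge\<close>.\<close>

lemma Sigma_append_max:
  fixes q :: "'k::rat_comm_algebra_1"
  assumes "lyndon l" "set (fac a) \<subseteq> {l}" "\<And>m. m \<in> set (fac b) \<Longrightarrow> m < l"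
  shows "fac (a @ b) = fac a @ fac b" "Pi_word q (a @ b) = Pi_word q a * Pi_word q b"
    "Sigma_word q (a @ b) = stuffle q (Sigma_word q a) (Sigma_word q b)"
proof -
  have d: "declyn (replicate n l @ fac b)" for n
    by (induction n) (auto simp: declyn_Cons assms(1) dest: assms(3) less_imp_le)
  obtain n where n: "fac a = replicate n l" using assms(2) by (metis replicate_eqI singletonD subsetD)
  have "declyn (fac a @ fac b)" unfolding n by (rule d)
  then show f: "fac (a @ b) = fac a @ fac b" by (rule fac_eqI) simp
  then show "Pi_word q (a @ b) = Pi_word q a * Pi_word q b" by (simp add: Pi_word_eq)
  have m: "merge a b = a @ b" by (rule facm_inject[THEN iffD1]) (simp add: facm_merge f)
  have mf: "mfact (facm (a @ b)) = mfact (facm a) * mfact (facm b)"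
    using mfact_replicate[of l "facm b" n] assms(3) by (auto simp: f n mset_replicate mfact_replicate_mset)
  have "stuffle q (sigma q a) (sigma q b) = sigma q (a @ b)" by (simp add: stuffle_sigma m)
  then have e: "scl (of_nat (mfact (facm (a @ b)))) (stuffle q (Sigma_word q a) (Sigma_word q b)) = sigma q (a @ b)"
    by (simp add: sigma_def stuffle_scl_left stuffle_scl_right mf mult.commute)
  show "Sigma_word q (a @ b) = stuffle q (Sigma_word q a) (Sigma_word q b)"
    unfolding Sigma_eq_sigma[of q "a @ b"] e[symmetric] by (simp add: of_Q_inverse_of_nat mfact_pos)
qed

text \<open>As \<open>l\<close> exceeds every element of \<open>A\<close>, each word with factors in
  \<open>insert l A\<close> is uniquely a power of \<open>l\<close> followed by a word with factors
  in \<open>A\<close>.\<close>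

lemma dbl_mult_partial_diagonal:
  fixes q :: "'k::rat_comm_algebra_1"
  assumes l: "lyndon l" and A: "\<And>m. m \<in> A \<Longrightarrow> m < l"
  shows "dbl_mult q (partial_diagonal q {l}) (partial_diagonal q A) = partial_diagonal q (insert l A)"
proof (intro ext)
  fix u v
  define I where "I = {w. weight w \<le> weight v \<and> set (fac w) \<subseteq> {l}}"
  define J where "J = {w. weight w \<le> weight v \<and> set (fac w) \<subseteq> A}"
  let ?g = "\<lambda>w. coeff_at (Sigma_word q w) u * coeff_at (Pi_word q w) v"
  have fin: "finite I" "finite J" by (simp_all add: I_def J_def finite_words_weight_le)
  have wt: "weight (take k v) \<le> weight v" "weight (drop k v) \<le> weight v" for k
    by (metis append_take_drop_id le_add1 weight_append, metis append_take_drop_id le_add2 weight_append)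
  have app: "fac (a @ b) = fac a @ fac b" "Pi_word q (a @ b) = Pi_word q a * Pi_word q b"
      "Sigma_word q (a @ b) = stuffle q (Sigma_word q a) (Sigma_word q b)" if "a \<in> I" "b \<in> J" for a b
  proof -
    have b: "m < l" if "m \<in> set (fac b)" for m
      using \<open>b \<in> J\<close> that A by (auto simp: J_def)
    have a: "set (fac a) \<subseteq> {l}" using that(1) by (simp add: I_def)
    show "fac (a @ b) = fac a @ fac b" "Pi_word q (a @ b) = Pi_word q a * Pi_word q b"
      "Sigma_word q (a @ b) = stuffle q (Sigma_word q a) (Sigma_word q b)"
      by (rule Sigma_append_max[OF l a], erule b)+
  qed
  have "dbl_mult q (partial_diagonal q {l}) (partial_diagonal q A) u v =
    (\<Sum>(a, b)\<in>I \<times> J. coeff_at (stuffle q (Sigma_word q a) (Sigma_word q b)) u *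
      coeff_at (Pi_word q a * Pi_word q b) v)"
    by (rule dbl_mult_finite_sums[OF fin]; rule partial_diagonal_eq) (use fin wt in \<open>auto simp: I_def J_def\<close>)
  also have "\<dots> = (\<Sum>p\<in>I \<times> J. ?g (fst p @ snd p))"
    using app by (intro sum.cong) auto
  also have "\<dots> = (\<Sum>w\<in>(\<lambda>p. fst p @ snd p) ` (I \<times> J). ?g w)"
  proof (rule sum.reindex_cong[symmetric, OF _ refl refl, unfolded o_def])
    show "inj_on (\<lambda>p. fst p @ snd p) (I \<times> J)"
    proof (rule inj_onI, clarsimp)
      fix a b a' b' assume ab: "a \<in> I" "b \<in> J" "a' \<in> I" "b' \<in> J" "a @ b = a' @ b'"
      have "fac a = filter (\<lambda>m. m = l) (fac a @ fac b)" if "a \<in> I" "b \<in> J" for a b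
      proof -
        have "filter (\<lambda>m. m = l) (fac a) = fac a" using that by (auto simp: I_def filter_id_conv)
        moreover have "filter (\<lambda>m. m = l) (fac b) = []" using that A by (auto simp: J_def filter_empty_conv)
        ultimately show ?thesis by simp
      qed
      then have "fac a = fac a'" using ab app(1) by metis
      then have "a = a'" by (metis concat_fac)
      then show "a = a' \<and> b = b'" using ab by simp
    qed
  qed
  also have "\<dots> = partial_diagonal q (insert l A) u v"
  proof (rule partial_diagonal_eq[symmetric])
    show "finite ((\<lambda>p. fst p @ snd p) ` (I \<times> J))" using fin by simp
    show "set (fac w) \<subseteq> insert l A" if "w \<in> (\<lambda>p. fst p @ snd p) ` (I \<times> J)" for w
      using that app(1) by (auto simp: I_def J_def)
    show "{w. weight w = weight v \<and> set (fac w) \<subseteq> insert l A} \<subseteq> (\<lambda>p. fst p @ snd p) ` (I \<times> J)"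
    proof safe
      fix w assume w: "weight w = weight v" "set (fac w) \<subseteq> insert l A"
      let ?a = "filter (\<lambda>m. m = l) (fac w)" and ?b = "filter (\<lambda>m. m \<noteq> l) (fac w)"
      have fw: "fac w = ?a @ ?b" using w(2) A by (intro declyn_filter_max) (auto intro: less_imp_le)
      have dec: "declyn (filter P ls)" if "declyn ls" for P ls
        using that by (induction ls) (auto simp: declyn_Cons)
      have "w = concat ?a @ concat ?b" using fw concat_fac[of w] by (metis concat_append)
      moreover from this have "weight (concat ?a) \<le> weight v" "weight (concat ?b) \<le> weight v"
        using w(1) by (metis le_add1 weight_append, metis le_add2 w(1) weight_append)
      then have "concat ?a \<in> I" "concat ?b \<in> J"
        using w(2) by (auto simp: I_def J_def fac_concat[OF dec[OF declyn_fac]])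
      ultimately show "w \<in> (\<lambda>p. fst p @ snd p) ` (I \<times> J)"
        by (intro image_eqI[of _ _ "(concat ?a, concat ?b)"]) auto
    qed
  qed
  finally show "dbl_mult q (partial_diagonal q {l}) (partial_diagonal q A) u v =
      partial_diagonal q (insert l A) u v" .
qed

lemma decreasing_prod_partial_diagonal:
  fixes q :: "'k::rat_comm_algebra_1"
  assumes "finite A" "A \<subseteq> Lyn"
  shows "decreasing_prod q (\<lambda>l. dbl_exp q (tensor (Sigma_word q l) (Pi_word q l))) A = partial_diagonal q A"
  using assms
proof (induction A rule: finite_linorder_max_induct)
  case empty
  show ?case by (simp add: decreasing_prod_def partial_diagonal_empty)
next
  case (insert l A)
  have "sorted_list_of_set (insert l A) = insort l (sorted_list_of_set A)"
    using insert.hyps by (intro sorted_list_of_set.sorted_key_list_of_set_insert) auto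
  also have "\<dots> = sorted_list_of_set A @ [l]"
    using insert.hyps by (intro sorted_insort_is_snoc) (auto intro: less_imp_le)
  finally have "sorted_list_of_set (insert l A) = sorted_list_of_set A @ [l]" .
  then have "decreasing_prod q (\<lambda>l. dbl_exp q (tensor (Sigma_word q l) (Pi_word q l))) (insert l A) =
      dbl_mult q (dbl_exp q (tensor (Sigma_word q l) (Pi_word q l))) (partial_diagonal q A)"
    using insert by (simp add: decreasing_prod_def)
  also have "\<dots> = partial_diagonal q (insert l A)"
    using insert by (simp add: Lyn_def dbl_exp_eq_partial_diagonal dbl_mult_partial_diagonal)
  finally show ?case .
qed

lemma weight_mem_le: "l \<in> set ls \<Longrightarrow> weight l \<le> weight (concat ls)"
  by (induction ls) auto

lemma has_decreasing_prod_diagonal: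
  fixes q :: "'k::rat_comm_algebra_1"
  shows "has_decreasing_prod q (\<lambda>l. dbl_exp q (tensor (Sigma_word q l) (Pi_word q l))) Lyn diagonal"
  unfolding has_decreasing_prod_def
proof (intro allI)
  fix u v
  \<comment> \<open>Lyndon words heavier than \<open>v\<close> cannot be factors of a word of the
    weight of \<open>v\<close>, so the coefficient is constant once \<open>A\<close> contains
    \<open>?X\<close>.\<close>
  let ?X = "{l\<in>Lyn. weight l \<le> weight v}"
  have X: "finite ?X" using finite_words_weight_le[of "weight v" "\<lambda>l. l \<in> Lyn"] by (simp add: conj_commute)
  have "partial_diagonal q A u v = diagonal u v" if "?X \<subseteq> A" for A
  proof -
    have "set (fac w) \<subseteq> A" if "weight w = weight v" for w
      using \<open>?X \<subseteq> A\<close> that weight_mem_le[of _ "fac w"] by (auto simp: Lyn_def lyndon_of_mem_fac)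
    then have "partial_diagonal q A u v =
        (\<Sum>w\<in>words_of_weight (weight v). coeff_at (Sigma_word q w) u * coeff_at (Pi_word q w) v)"
      by (intro partial_diagonal_eq) auto
    also have "\<dots> = diagonal u v"
    proof (cases "weight u = weight v")
      case True
      then show ?thesis
        using dual_basesD(4)[OF dual_bases_Pi_Sigma, of q u v] by (simp add: diagonal_def)
    next
      case False
      then have "(\<Sum>w\<in>words_of_weight (weight v). coeff_at (Sigma_word q w) u * coeff_at (Pi_word q w) v) = 0"
        by (intro sum.neutral) (simp add: homogeneous_coeff_0[OF homogeneous_Sigma])
      then show ?thesis using False by (auto simp: diagonal_def)
    qed
    finally show ?thesis .
  qed
  then have "decreasing_prod q (\<lambda>l. dbl_exp q (tensor (Sigma_word q l) (Pi_word q l))) A u v = diagonal u v"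
    if "finite A" "?X \<subseteq> A" "A \<subseteq> Lyn" for A
    using that by (simp add: decreasing_prod_partial_diagonal)
  then show "eventually (\<lambda>A. decreasing_prod q (\<lambda>l. dbl_exp q (tensor (Sigma_word q l) (Pi_word q l))) A u v =
      diagonal u v) (finite_subsets_at_top Lyn)"
    unfolding eventually_finite_subsets_at_top using X by (intro exI[of _ ?X]) auto
qed

section \<open>Lyndon words as a transcendence basis\<close>

text \<open>Identifies monomials in Lyndon words with words; \<open>rev\<close> turns the increasing
  list of indeterminates into the decreasing order of the factorization.\<close>

definition word_of_exponents :: "(word \<Rightarrow>\<^sub>0 nat) \<Rightarrow> word" where
  "word_of_exponents m =
     concat (expand (rev (map (\<lambda>l. (l, Poly_Mapping.lookup m l)) (sorted_list_of_set (supp m)))))"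

lemma facm_word_of_exponents:
  assumes "supp m \<subseteq> Lyn"
  shows "count (facm (word_of_exponents m)) l = Poly_Mapping.lookup m l"
    and "stuffle_list q (map (\<lambda>l. stuffle_pow q (wd l) (Poly_Mapping.lookup m l))
        (sorted_list_of_set (supp m))) =
      lyndon_product (q :: 'k::rat_comm_algebra_1) (word_of_exponents m)"
proof -
  let ?s = "sorted_list_of_set (supp m)"
  let ?fs = "rev (map (\<lambda>l. (l, Poly_Mapping.lookup m l)) ?s)"
  have "sorted_wrt (>) (rev ?s)" by (simp add: sorted_wrt_rev strict_sorted_iff)
  then have g: "grouped ?fs" by (auto simp: grouped_def rev_map o_def in_keys_iff)
  then have "declyn (expand ?fs)" using assms by (auto simp: declyn_def set_expand sorted_expand Lyn_def)
  then have f: "fac (word_of_exponents m) = expand ?fs"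
    unfolding word_of_exponents_def by (rule fac_concat)
  have "count (mset (expand (map (\<lambda>l. (l, h l)) xs))) l = (if l \<in> set xs then h l else 0)"
    if "distinct xs" for h :: "word \<Rightarrow> nat" and xs
    using that by (induction xs) (auto simp: mset_replicate)
  from this[of "rev ?s" "Poly_Mapping.lookup m"]
  show "count (facm (word_of_exponents m)) l = Poly_Mapping.lookup m l"
    unfolding f by (simp add: rev_map in_keys_iff)
  have "stuffle_list q (map (\<lambda>l. stuffle_pow q (wd l) (Poly_Mapping.lookup m l)) ?s) =
      stuffle_list q (map (\<lambda>(l, i). stuffle_pow q (wd l) i) ?fs)"
    by (rule stuffle_list_mset) (simp add: rev_map[symmetric] o_def)
  also have "\<dots> = lyndon_product q (word_of_exponents m)"
    unfolding stuffle_list_powers lyndon_product_def f ..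
  finally show "stuffle_list q (map (\<lambda>l. stuffle_pow q (wd l) (Poly_Mapping.lookup m l)) ?s) =
      lyndon_product q (word_of_exponents m)" .
qed

lemma word_of_exponents_inject:
  assumes "supp m \<subseteq> Lyn" "supp n \<subseteq> Lyn"
    and "word_of_exponents m = word_of_exponents n"
  shows "m = n"
  using facm_word_of_exponents(1)[OF assms(1)] facm_word_of_exponents(1)[OF assms(2)] assms(3)
  by (metis poly_mapping_eqI)

lemma word_of_exponents_surj: "\<exists>m. supp m \<subseteq> Lyn \<and> word_of_exponents m = w"
proof -
  define m where "m = Abs_poly_mapping (count (facm w))"
  have "finite {l. count (facm w) l \<noteq> 0}" by (simp add: count_eq_zero_iff)
  then have m: "Poly_Mapping.lookup m l = count (facm w) l" for l by (simp add: m_def)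
  have k: "supp m \<subseteq> Lyn"
    by (auto simp: in_keys_iff m count_eq_zero_iff Lyn_def lyndon_of_mem_fac)
  have "facm (word_of_exponents m) = facm w"
    by (rule multiset_eqI) (simp add: facm_word_of_exponents(1)[OF k] m)
  then show ?thesis using k by (auto simp: facm_inject)
qed

lemma stuffle_eval_eq_sum:
  fixes q :: "'k::rat_comm_algebra_1"
  assumes "finite M" "supp p \<subseteq> M" "\<And>m. m \<in> M \<Longrightarrow> supp m \<subseteq> Lyn"
  shows "stuffle_eval q wd p =
    (\<Sum>m\<in>M. scl (Poly_Mapping.lookup p m) (lyndon_product q (word_of_exponents m)))"
proof -
  have "stuffle_eval q wd p = (\<Sum>m\<in>supp p. scl (Poly_Mapping.lookup p m) (lyndon_product q (word_of_exponents m)))"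
    unfolding stuffle_eval_def
    using assms(2,3) by (intro sum.cong refl arg_cong2[where f = scl] facm_word_of_exponents(2)) auto
  also have "\<dots> = (\<Sum>m\<in>M. scl (Poly_Mapping.lookup p m) (lyndon_product q (word_of_exponents m)))"
    using assms(1,2) by (intro sum.mono_neutral_left) (auto simp: in_keys_iff)
  finally show ?thesis .
qed

text \<open>Monomials in Lyndon words evaluate to invertible multiples of the
  \<open>chi q w\<close>, each \<open>w\<close> arising from exactly one monomial, so independence
  and generation are both read off from the dual pair \<open>chi\<close>, \<open>xi\<close>.\<close>

lemma stuffle_transcendence_basis_Lyn:
  fixes q :: "'k::rat_comm_algebra_1"
  shows "stuffle_transcendence_basis q wd Lyn"
  unfolding stuffle_transcendence_basis_def
proof (intro conjI ballI impI allI)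
  fix p :: "'k cpoly" assume p: "p \<in> cpolys_in Lyn" "stuffle_eval q wd p = 0"
  let ?w = word_of_exponents
  have k: "supp m \<subseteq> Lyn" if "m \<in> supp p" for m
    using p(1) that by (auto simp: cpolys_in_def)
  have "Poly_Mapping.lookup p n = 0" if n: "n \<in> supp p" for n
  proof -
    let ?f = "of_nat (mfact (facm (?w n))) :: 'k"
    have "0 = pairing (xi q (?w n)) (stuffle_eval q wd p)" using p(2) by simp
    also have "stuffle_eval q wd p =
        (\<Sum>m\<in>supp p. scl (Poly_Mapping.lookup p m) (lyndon_product q (?w m)))"
      using k by (intro stuffle_eval_eq_sum) auto
    also have "pairing (xi q (?w n)) \<dots> =
        (\<Sum>m\<in>supp p. if m = n then Poly_Mapping.lookup p n * ?f else 0)"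
      unfolding pairing_sum_right
      using word_of_exponents_inject[OF k k[OF n]]
      by (intro sum.cong refl)
        (auto simp: pairing_scl_right lyndon_product_eq_chi dual_basesD(3)[OF dual_bases_chi_xi])
    also have "\<dots> = Poly_Mapping.lookup p n * ?f" using n by simp
    finally have "0 = Poly_Mapping.lookup p n * ?f * of_Q (1 / of_nat (mfact (facm (?w n))))" by simp
    then show ?thesis
      using of_Q_inverse_of_nat[OF mfact_pos, of "facm (?w n)", where 'k = 'k]
      by (simp add: mult.assoc mult.commute[of ?f])
  qed
  then show "p = 0" by (intro poly_mapping_eqI) (metis in_keys_iff lookup_zero)
next
  fix P :: "'k ncpoly"
  let ?w = word_of_exponents and ?W = "words_of_weights P"
  obtain M where M: "\<And>w. supp (M w) \<subseteq> Lyn" "\<And>w. ?w (M w) = w"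
    using word_of_exponents_surj by metis
  have inj: "inj M" by (rule injI) (metis M(2))
  define d where "d w = pairing (xi q w) P * of_Q (1 / of_nat (mfact (facm w)))" for w
  define p where "p = (\<Sum>w\<in>?W. Poly_Mapping.single (M w) (d w))"
  have lp: "Poly_Mapping.lookup p (M w) = d w" if "w \<in> ?W" for w
    using that inj by (simp add: p_def lookup_sum lookup_single when_def inj_eq)
  have kp: "supp p \<subseteq> M ` ?W"
    by (auto simp: p_def in_keys_iff lookup_sum lookup_single when_def intro!: sum.neutral)
  have "stuffle_eval q wd p =
      (\<Sum>m\<in>M ` ?W. scl (Poly_Mapping.lookup p m) (lyndon_product q (?w m)))"
    using kp M(1) by (intro stuffle_eval_eq_sum) auto
  also have "\<dots> = (\<Sum>w\<in>?W. scl (d w) (lyndon_product q w))"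
    by (subst sum.reindex[OF inj_on_subset[OF inj subset_UNIV]]) (simp add: lp M(2))
  also have "\<dots> = (\<Sum>w\<in>?W. scl (pairing (xi q w) P) (chi q w))"
    by (simp add: d_def lyndon_product_eq_chi mult.assoc of_Q_inverse_of_nat mfact_pos)
  also have "\<dots> = P" using dual_bases_expand[OF dual_bases_chi_xi, of P q] by simp
  finally have "P = stuffle_eval q wd p" ..
  moreover have "p \<in> cpolys_in Lyn" using kp M(1) by (auto simp: cpolys_in_def)
  ultimately show "\<exists>p\<in>cpolys_in Lyn. P = stuffle_eval q wd p" by blast
qed

theorem proposition5:
  fixes q :: "'k::rat_comm_algebra_1"
  shows
    "(\<forall>w. w \<noteq> [] \<longrightarrow>
        proper (Sigma_word q w) \<and>
        weight_homogeneous (weight w) (Sigma_word q w) \<and>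
        rational_positive (\<lambda>q'::'k. Sigma_word q' w))
   \<and> (double_sums (\<lambda>w. tensor (Sigma_word q w) (Pi_word q w)) diagonal \<and>
      has_decreasing_prod q (\<lambda>l. dbl_exp q (tensor (Sigma_word q l) (Pi_word q l))) Lyn diagonal)
   \<and> (stuffle_transcendence_basis q wd Lyn \<and>
      (\<forall>w. w \<noteq> [] \<longrightarrow> proper (chi q w) \<and> rational_positive (\<lambda>q'::'k. chi q' w)) \<and>
      basis_family (chi q) UNIV UNIV)
   \<and> (basis_family (xi q) UNIV UNIV \<and>
      (\<forall>u v. pairing (chi q v) (xi q u) = (if u = v then 1 else 0)) \<and>
      bij (lie_identification q) \<and>
      basis_family (xi q) Lyn (lie_identification q ` free_lie))"
proof (intro conjI allI impI)
  fix w :: word assume w: "w \<noteq> []"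
  show "proper (Sigma_word q w)" "proper (chi q w)"
    unfolding proper_def using w homogeneous_coeff_0[OF homogeneous_Sigma[of w q], of "[]"]
      homogeneous_coeff_0[OF homogeneous_chi[of w q], of "[]"] by simp_all
  show "weight_homogeneous (weight w) (Sigma_word q w)" by (rule homogeneous_Sigma)
  show "rational_positive (\<lambda>q'::'k. Sigma_word q' w)" by (rule rational_positive_Sigma)
  show "rational_positive (\<lambda>q'::'k. chi q' w)" by (rule rational_positive_chi)
next
  show "double_sums (\<lambda>w. tensor (Sigma_word q w) (Pi_word q w)) diagonal"
    by (rule double_sums_diagonal[OF dual_bases_Pi_Sigma])
  show "has_decreasing_prod q (\<lambda>l. dbl_exp q (tensor (Sigma_word q l) (Pi_word q l))) Lyn diagonal"
    by (rule has_decreasing_prod_diagonal)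
  show "stuffle_transcendence_basis q wd Lyn" by (rule stuffle_transcendence_basis_Lyn)
  show "basis_family (chi q) UNIV UNIV"
    by (rule dual_bases_basis_family[OF dual_bases_chi_xi]) simp
  show "basis_family (xi q) UNIV UNIV"
    by (rule dual_bases_basis_family[OF dual_bases_sym[OF dual_bases_chi_xi]]) simp
  show "bij (lie_identification q)" by (rule bij_lie_identification)
  show "basis_family (xi q) Lyn (lie_identification q ` free_lie)"
    \<comment> \<open>The image of the free Lie algebra is generated by the
      \<open>pi1 q [a]\<close>, and that Lie algebra consists of all primitive elements, for which
      the basis is already known.\<close>
    unfolding lie_identification_free_lie primitive_eq_lie_generated[symmetric]
    by (rule basis_family_xi_primitive)
next
  fix u v
  show "pairing (chi q v) (xi q u) = (if u = v then 1 else 0)"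
    using dual_basesD(3)[OF dual_bases_chi_xi[of q], of u v] by (subst pairing_commute) auto
qed

end
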